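(* Let $f\in\mathscr F^n$, $g\in C^0(\overline I\times\mathbb R^n\times\mathbb R;\mathbb R)$, $u_o\in L^\infty(\mathbb R^n;\mathbb R)$ and $u\in L^\infty(I\times\mathbb R^n;\mathbb R)$. Then the following statements are equivalent: (1) $u$ is a distributional solution to the Cauchy problem $\partial_tu+\operatorname{div}_xf(t,x,u)=g(t,x,u)$, $u(0,x)=u_o(x)$; (2) for all $E\in C^2(\mathbb R;\mathbb R)$, $$\mathcal M_u(E)=\frac12\int_{J_u}E''(k)\,\mu_k\,dk ,$$ i.e. $(\mathcal M_u(E))(\varphi)=\frac12\int_{J_u}E''(k)\,\mu_k(\varphi)\,dk$ for all $\varphi\in\mathcal D(I\times\mathbb R^n;\mathbb R)$.
   Context: Let $n\ge1$ be an integer and let $I=[0,+\infty)$ or $I=[0,T)$ for some $T>0$, with closure $\overline I$. $\nabla_x$ and $\operatorname{div}_x$ applied to functions of $(t,x,u)$ denote derivatives with respect to $x$ only, with $t$ and $u$ fixed; e.g. $(\operatorname{div}_xF)(t,x,u(t,x))$ is the partial divergence evaluated at $(t,x,u(t,x))$. $\mathcal D(I\times\mathbb R^n;\mathbb R)=C_c^\infty(I\times\mathbb R^n;\mathbb R)$, where compact support means that the support is a compact subset of $I\times\mathbb R^n$ (so $\varphi(0,\cdot)$ need not vanish), and $\mathcal D'(I\times\mathbb R^n;\mathbb R)$ is the corresponding space of distributions. $\mathscr F$ is the set of $\zeta\in C^1(\overline I\times\mathbb R^n\times\mathbb R;\mathbb R)$, with variables $(t,x,u)$, such that $\partial^2_{tu}\zeta$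 and $\nabla_x\partial_u\zeta$ are continuous on $\overline I\times\mathbb R^n\times\mathbb R$; $\mathscr F^n$ is the analogous space of $\mathbb R^n$-valued functions. $J_u=[\operatorname{ess\,inf}u,\operatorname{ess\,sup}u]$, over $I\times\mathbb R^n$. Distributional solution: for all $\varphi\in C^1_c(I\times\mathbb R^n;\mathbb R)$, $$\int_I\int_{\mathbb R^n}\big(u\,\partial_t\varphi+f(t,x,u)\cdot\nabla_x\varphi\big)dx\,dt+\int_I\int_{\mathbb R^n}g(t,x,u)\,\varphi\,dx\,dt+\int_{\mathbb R^n}u_o(x)\varphi(0,x)\,dx=0 .$$ Entropy production: for $E\in C^1(\mathbb R;\mathbb R)$ let $F\in\mathscr F^n$ be any function with $\partial_uF(t,x,u)=E'(u)\,\partial_uf(t,x,u)$ (the choice is irrelevant; e.g. $F=\int_0^uE'(w)\partial_uf(t,x,w)dw$); then $$(\mathcal M_u(E))(\varphi)=\int_I\int_{\mathbb R^n}\big(E(u)\,\partial_t\varphi+F(t,x,u)\cdot\nabla_x\varphi\big)dx\,dt-\int_I\int_{\mathbb R^n}E'(u)\,(\operatorname{div}_xf)(t,x,u)\,\varphi\,dx\,dt$$ $$+\int_I\int_{\mathbb R^n}(\operatorname{div}_xF)(t,x,u)\,\varphi\,dx\,dt+\int_I\int_{\mathbb R^n}E'(u)\,g(t,x,u)\,\varphi\,dx\,dt+\int_{\mathbb R^n}E(u_o(x))\,\varphi(0,x)\,dx .$$ Kruzhkov entropy production: with $\operatorname{sgn}z=1,0,-1$ for $z>0$, $z=0$, $z<0$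 and $\Phi(t,x,u,k)=\operatorname{sgn}(u-k)\,(f(t,x,u)-f(t,x,k))$, for $k\in\mathbb R$ $$\mu_k(\varphi)=\int_I\int_{\mathbb R^n}\big(|u-k|\,\partial_t\varphi+\Phi(t,x,u,k)\cdot\nabla_x\varphi\big)dx\,dt-\int_I\int_{\mathbb R^n}\operatorname{sgn}(u-k)\,\operatorname{div}_xf(t,x,k)\,\varphi\,dx\,dt$$ $$+\int_I\int_{\mathbb R^n}\operatorname{sgn}(u-k)\,g(t,x,u)\,\varphi\,dx\,dt+\int_{\mathbb R^n}|u_o(x)-k|\,\varphi(0,x)\,dx .$$ In all formulas $u=u(t,x)$ and $\varphi=\varphi(t,x)$. *)

theory Defs
  imports "HOL-Analysis.Analysis" "HOL-Probability.Essential_Supremum"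
begin

text \<open>
  Space-time points are pairs \<open>(t, x)\<close>, and arguments of the flux and of the source are triples
  \<open>(t, x, u)\<close>.  The dimension \<open>n\<close> is \<open>CARD('n)\<close>, which is at least 1.

  \<open>Ck_on k S h\<close>: the function \<open>h\<close> is of class \<open>C^k\<close> on \<open>S\<close>, up to and including the boundary points
  that belong to \<open>S\<close>, where derivatives are taken within \<open>S\<close>.  It is meant for sets on which
  derivatives within the set are unique, such as \<open>I \<times> UNIV\<close> for a nondegenerate interval \<open>I\<close>.
  Requiring every directional derivative \<open>\<lambda>z. h' z v\<close> to be of class \<open>C^k\<close> amounts, in finite
  dimension, to requiring it of \<open>h'\<close>.
\<close>

primrec Ck_on :: "nat \<Rightarrow> 'a::euclidean_space set \<Rightarrow> ('a \<Rightarrow> 'b::real_normed_vector) \<Rightarrow> bool" where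
  "Ck_on 0 S h \<longleftrightarrow> continuous_on S h"
| "Ck_on (Suc k) S h \<longleftrightarrow>
     (\<exists>h'. (\<forall>z\<in>S. (h has_derivative h' z) (at z within S)) \<and> (\<forall>v. Ck_on k S (\<lambda>z. h' z v)))"

text \<open>
  In \<open>d_t\<close> the derivative is taken within \<open>J\<close>, hence it is one-sided at an endpoint of \<open>J\<close>; the
  remaining variables \<open>p\<close> are either \<open>x\<close> or \<open>(x, u)\<close>.
\<close>

definition d_t :: "real set \<Rightarrow> (real \<times> 'p \<Rightarrow> 'b::real_normed_vector) \<Rightarrow> real \<times> 'p \<Rightarrow> 'b" where
  "d_t J h = (\<lambda>(t, p). vector_derivative (\<lambda>s. h (s, p)) (at t within J))"

definition d_u :: "(real \<times> 'x \<times> real \<Rightarrow> 'b::real_normed_vector) \<Rightarrow> real \<times> 'x \<times> real \<Rightarrow> 'b" where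
  "d_u h = (\<lambda>(t, x, u). vector_derivative (\<lambda>w. h (t, x, w)) (at u))"

definition pderiv_x :: "'n::finite \<Rightarrow> (real^'n \<Rightarrow> 'b::real_normed_vector) \<Rightarrow> real^'n \<Rightarrow> 'b" where
  "pderiv_x i h x = vector_derivative (\<lambda>s. h (x + s *\<^sub>R axis i 1)) (at 0)"

definition grad_x :: "(real \<times> (real^'n) \<Rightarrow> real) \<Rightarrow> real \<times> (real^'n) \<Rightarrow> real^'n" where
  "grad_x h = (\<lambda>(t, x). \<chi> i. pderiv_x i (\<lambda>y. h (t, y)) x)"

definition div_x ::
  "(real \<times> (real^'n) \<times> real \<Rightarrow> real^'n) \<Rightarrow> real \<times> (real^'n) \<times> real \<Rightarrow> real" where
  "div_x h = (\<lambda>(t, x, u). \<Sum>i\<in>UNIV. pderiv_x i (\<lambda>y. h (t, y, u)) x $ i)"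

definition time_interval :: "real set \<Rightarrow> bool" where
  "time_interval I \<longleftrightarrow> I = {0..} \<or> (\<exists>T>0. I = {0..<T})"

text \<open>
  The class \<open>\<F>\<close> (for \<open>'b = real\<close>) and the class \<open>\<F>^n\<close> (for \<open>'b = real^'n\<close>).  Since
  \<open>vector_derivative\<close> is total, existence of the second derivatives is required separately
  from their continuity.
\<close>

definition class_F ::
  "real set \<Rightarrow> (real \<times> (real^'n) \<times> real \<Rightarrow> 'b::real_normed_vector) set" where
  "class_F I = {h.
     Ck_on 1 (closure I \<times> UNIV) h \<and>
     (\<forall>t\<in>closure I. \<forall>x u. (\<lambda>s. d_u h (s, x, u)) differentiable (at t within closure I)) \<and>
     continuous_on (closure I \<times> UNIV) (d_t (closure I) (d_u h)) \<and>
     (\<forall>i. (\<forall>t\<in>closure I. \<forall>x u.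
             (\<lambda>s. d_u h (t, x + s *\<^sub>R axis i 1, u)) differentiable (at 0)) \<and>
          continuous_on (closure I \<times> UNIV) (\<lambda>(t, x, u). pderiv_x i (\<lambda>y. d_u h (t, y, u)) x))}"

text \<open>
  Elements of \<open>L^\<infinity>\<close> are represented by Lebesgue measurable, essentially bounded functions.
\<close>

definition L_inf :: "'a measure \<Rightarrow> ('a \<Rightarrow> real) set" where
  "L_inf M = {h. h \<in> borel_measurable M \<and> (\<exists>C. AE z in M. \<bar>h z\<bar> \<le> C)}"

definition ess_range_hull ::
  "real set \<Rightarrow> (real \<times> (real^'n) \<Rightarrow> real) \<Rightarrow> real set" where
  "ess_range_hull I u =
     (let M = lebesgue_on (I \<times> UNIV) in
      {k. - esssup M (\<lambda>z. ereal (- u z)) \<le> ereal k \<and> ereal k \<le> esssup M (\<lambda>z. ereal (u z))})"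

text \<open>
  Only the values of \<open>\<phi>\<close> on \<open>I \<times> UNIV\<close> matter.  The closure below is taken in the whole
  space; that it lies in \<open>I \<times> UNIV\<close> makes the support compact in \<open>I \<times> UNIV\<close>, so \<open>\<phi>\<close> vanishes
  near an open right endpoint of \<open>I\<close> but not necessarily at time 0.
\<close>

definition compact_support_on ::
  "real set \<Rightarrow> (real \<times> (real^'n) \<Rightarrow> real) \<Rightarrow> bool" where
  "compact_support_on I \<phi> \<longleftrightarrow>
     (let K = closure {z \<in> I \<times> UNIV. \<phi> z \<noteq> 0} in compact K \<and> K \<subseteq> I \<times> UNIV)"

definition C1c :: "real set \<Rightarrow> (real \<times> (real^'n) \<Rightarrow> real) set" where
  "C1c I = {\<phi>. Ck_on 1 (I \<times> UNIV) \<phi> \<and> compact_support_on I \<phi>}"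

definition test_fun :: "real set \<Rightarrow> (real \<times> (real^'n) \<Rightarrow> real) set" where
  "test_fun I = {\<phi>. (\<forall>k. Ck_on k (I \<times> UNIV) \<phi>) \<and> compact_support_on I \<phi>}"

definition distributional_solution ::
  "real set \<Rightarrow> (real \<times> (real^'n) \<times> real \<Rightarrow> real^'n) \<Rightarrow> (real \<times> (real^'n) \<times> real \<Rightarrow> real)
    \<Rightarrow> (real^'n \<Rightarrow> real) \<Rightarrow> (real \<times> (real^'n) \<Rightarrow> real) \<Rightarrow> bool" where
  "distributional_solution I f g uo u \<longleftrightarrow> (\<forall>\<phi>\<in>C1c I.
     (LINT t:I|lebesgue. LINT x|lebesgue.
        u (t, x) * d_t I \<phi> (t, x) + f (t, x, u (t, x)) \<bullet> grad_x \<phi> (t, x))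
     + (LINT t:I|lebesgue. LINT x|lebesgue. g (t, x, u (t, x)) * \<phi> (t, x))
     + (LINT x|lebesgue. uo x * \<phi> (0, x)) = 0)"

text \<open>
  \<open>entropy_flux I f E\<close> is the set of all admissible entropy fluxes.  For \<open>f \<in> class_F I\<close> and \<open>E\<close> of
  class \<open>C^1\<close> it contains \<open>\<lambda>(t, x, u). \<integral>\<^sub>0\<^sup>u E'(w) \<partial>\<^sub>u f(t, x, w) dw\<close>, and two of its members differ by
  a function of \<open>(t, x)\<close> only, which does not affect the value of \<open>entropy_production\<close>.
\<close>

definition entropy_flux ::
  "real set \<Rightarrow> (real \<times> (real^'n) \<times> real \<Rightarrow> real^'n) \<Rightarrow> (real \<Rightarrow> real)
    \<Rightarrow> (real \<times> (real^'n) \<times> real \<Rightarrow> real^'n) set" where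
  "entropy_flux I f E =
     {F \<in> class_F I. \<forall>t\<in>closure I. \<forall>x u. d_u F (t, x, u) = deriv E u *\<^sub>R d_u f (t, x, u)}"

definition entropy_production ::
  "real set \<Rightarrow> (real \<times> (real^'n) \<times> real \<Rightarrow> real^'n) \<Rightarrow> (real \<times> (real^'n) \<times> real \<Rightarrow> real)
    \<Rightarrow> (real^'n \<Rightarrow> real) \<Rightarrow> (real \<times> (real^'n) \<Rightarrow> real) \<Rightarrow> (real \<Rightarrow> real)
    \<Rightarrow> (real \<times> (real^'n) \<times> real \<Rightarrow> real^'n) \<Rightarrow> (real \<times> (real^'n) \<Rightarrow> real) \<Rightarrow> real" where
  "entropy_production I f g uo u E F \<phi> =
     (LINT t:I|lebesgue. LINT x|lebesgue.
        E (u (t, x)) * d_t I \<phi> (t, x) + F (t, x, u (t, x)) \<bullet> grad_x \<phi> (t, x))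
     - (LINT t:I|lebesgue. LINT x|lebesgue.
          deriv E (u (t, x)) * div_x f (t, x, u (t, x)) * \<phi> (t, x))
     + (LINT t:I|lebesgue. LINT x|lebesgue. div_x F (t, x, u (t, x)) * \<phi> (t, x))
     + (LINT t:I|lebesgue. LINT x|lebesgue.
          deriv E (u (t, x)) * g (t, x, u (t, x)) * \<phi> (t, x))
     + (LINT x|lebesgue. E (uo x) * \<phi> (0, x))"

definition kruzhkov_flux ::
  "(real \<times> (real^'n) \<times> real \<Rightarrow> real^'n) \<Rightarrow> real \<Rightarrow> real^'n \<Rightarrow> real \<Rightarrow> real \<Rightarrow> real^'n" where
  "kruzhkov_flux f t x u k = sgn (u - k) *\<^sub>R (f (t, x, u) - f (t, x, k))"

definition kruzhkov_production ::
  "real set \<Rightarrow> (real \<times> (real^'n) \<times> real \<Rightarrow> real^'n) \<Rightarrow> (real \<times> (real^'n) \<times> real \<Rightarrow> real)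
    \<Rightarrow> (real^'n \<Rightarrow> real) \<Rightarrow> (real \<times> (real^'n) \<Rightarrow> real) \<Rightarrow> real \<Rightarrow> (real \<times> (real^'n) \<Rightarrow> real) \<Rightarrow> real" where
  "kruzhkov_production I f g uo u k \<phi> =
     (LINT t:I|lebesgue. LINT x|lebesgue.
        \<bar>u (t, x) - k\<bar> * d_t I \<phi> (t, x) + kruzhkov_flux f t x (u (t, x)) k \<bullet> grad_x \<phi> (t, x))
     - (LINT t:I|lebesgue. LINT x|lebesgue. sgn (u (t, x) - k) * div_x f (t, x, k) * \<phi> (t, x))
     + (LINT t:I|lebesgue. LINT x|lebesgue.
          sgn (u (t, x) - k) * g (t, x, u (t, x)) * \<phi> (t, x))
     + (LINT x|lebesgue. \<bar>uo x - k\<bar> * \<phi> (0, x))"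

end

theory Submission
  imports Defs
begin

text \<open>
  Write \<open>D(\<phi>)\<close> for the left-hand side of the distributional formulation, \<open>M(E)(\<phi>)\<close> and \<open>\<mu>\<^sub>k(\<phi>)\<close> for
  the entropy productions of \<open>E\<close> and of \<open>|u - k|\<close>, and let \<open>[l, r]\<close> be the essential range hull of
  \<open>u\<close>.  For \<open>v\<close> in \<open>[l, r]\<close>, two integrations by parts in \<open>k\<close> show that
  \<open>1/2 \<integral> E''(k) |v - k| dk\<close> over \<open>[l, r]\<close> equals \<open>E(v) - \<alpha> v + c\<close> with \<open>\<alpha> = (E'(l) + E'(r)) / 2\<close>.
  The relation \<open>\<partial>\<^sub>u F = E'(u) \<partial>\<^sub>u f\<close> makes the same computation work for the fluxes, and differentiating
  the resulting identity in \<open>x\<close> gives it for their divergences.  After exchanging the \<open>k\<close>-integral with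
  the space-time integrals one obtains
  \<open>1/2 \<integral> E''(k) \<mu>\<^sub>k(\<phi>) dk = M(E)(\<phi>) - \<alpha> D(\<phi>)\<close>
  (lemma \<open>integral_kruzhkov_form\<close>): the leftover terms do not involve \<open>u\<close> and vanish by the fundamental
  theorem of calculus in time and by translation invariance in space (\<open>weak_form_trivial\<close>).

  If \<open>u\<close> is a solution, then \<open>D = 0\<close> and the kinetic formula follows, except for one point:
  the representation of \<open>E\<close> by the functions \<open>|v - k|\<close> is valid on \<open>[l, r]\<close> only, so it must be known
  that the initial datum takes its values there.  This is true because a solution attains its initial
  datum weakly as \<open>t\<close> tends to 0, and bounds pass to weak limits
  (\<open>conservation_form_initial_bounds\<close>).

  Conversely, the kinetic formula for \<open>E(k) = k\<close> and \<open>F = f\<close> says that \<open>D(\<phi>) = 0\<close> for all smooth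
  \<open>\<phi>\<close>, and \<open>D\<close> is continuous under bounded pointwise convergence of \<open>\<phi>\<close> and of its first derivatives, so
  the equation extends to \<open>C\<^sup>1\<close> test functions by mollification (\<open>weak_form_density\<close>).  The mollifying
  kernel looks only forward in time: then no values of \<open>\<phi>\<close> at negative times are needed and the support
  does not move towards an open right endpoint of the time interval.

  The iterated integrals in the definitions have Lebesgue measurable integrands, whose sections are
  measurable for almost every \<open>t\<close> only.  They are first turned into integrals over the space-time domain
  (\<open>iterated_integral_eq_AE\<close>); from then on \<open>u\<close> and the initial datum may be changed on null sets, and
  they are replaced by functions that are bounded everywhere.
\<close>

section \<open>Calculus of functions of class C^k\<close>

lemma Ck_on_SucE:
  assumes "Ck_on (Suc k) S f"
  obtains f' where "\<And>z. z \<in> S \<Longrightarrow> (f has_derivative f' z) (at z within S)"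
    "\<And>v. Ck_on k S (\<lambda>z. f' z v)"
  using assms by auto

lemma Ck_on_cong:
  assumes "\<And>z. z \<in> S \<Longrightarrow> f z = g z" "Ck_on k S f"
  shows "Ck_on k S g"
  using assms
proof (cases k)
  case 0
  then show ?thesis using assms continuous_on_cong by force
next
  case (Suc j)
  with assms(2) obtain f' where f': "\<And>z. z \<in> S \<Longrightarrow> (f has_derivative f' z) (at z within S)"
     "\<And>v. Ck_on j S (\<lambda>z. f' z v)" by auto
  have "(g has_derivative f' z) (at z within S)" if "z \<in> S" for z
    using f'(1)[OF that] by (rule has_derivative_transform[rotated 2]) (use assms(1) that in auto)
  then show ?thesis using f'(2) Suc by auto
qed

lemma Ck_on_subset:
  assumes "Ck_on k T f" "S \<subseteq> T"
  shows "Ck_on k S f"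
  using assms(1)
proof (induction k arbitrary: f)
  case 0
  then show ?case using assms(2) continuous_on_subset by auto
next
  case (Suc k)
  then obtain f' where f': "\<And>z. z \<in> T \<Longrightarrow> (f has_derivative f' z) (at z within T)"
     "\<And>v. Ck_on k T (\<lambda>z. f' z v)" by auto
  then have "\<forall>z\<in>S. (f has_derivative f' z) (at z within S)"
    using assms(2) has_derivative_subset by blast
  then show ?case using f'(2) Suc.IH by auto
qed

lemma Ck_on_SucD:
  assumes "Ck_on (Suc k) S f"
  shows "Ck_on k S f"
  using assms
proof (induction k arbitrary: f)
  case 0
  then show ?case
    using has_derivative_continuous_on by (metis Ck_on.simps)
next
  case (Suc k)
  then obtain f' where f': "\<forall>z\<in>S. (f has_derivative f' z) (at z within S)"
     "\<And>v. Ck_on (Suc k) S (\<lambda>z. f' z v)" by (auto simp: Ck_on.simps(2)[of "Suc k"] simp del: Ck_on.simps)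
  show ?case unfolding Ck_on.simps(2)[of k]
    using f' Suc.IH by blast
qed

lemma Ck_on_imp_continuous_on: "Ck_on k S f \<Longrightarrow> continuous_on S f"
  by (induction k) (use Ck_on_SucD in auto)

lemma Ck_on_const [simp]: "Ck_on k S (\<lambda>z. c)"
proof (induction k arbitrary: c)
  case (Suc k)
  then show ?case by (auto intro!: exI[of _ "\<lambda>z v. 0"])
qed simp

lemma Ck_on_add:
  assumes "Ck_on k S f" "Ck_on k S g"
  shows "Ck_on k S (\<lambda>z. f z + g z)"
  using assms
proof (induction k arbitrary: f g)
  case 0
  then show ?case by (auto intro: continuous_intros)
next
  case (Suc k)
  obtain f' where f': "\<And>z. z \<in> S \<Longrightarrow> (f has_derivative f' z) (at z within S)"
     "\<And>v. Ck_on k S (\<lambda>z. f' z v)" using Ck_on_SucE[OF Suc.prems(1)] by blast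
  obtain g' where g': "\<And>z. z \<in> S \<Longrightarrow> (g has_derivative g' z) (at z within S)"
     "\<And>v. Ck_on k S (\<lambda>z. g' z v)" using Ck_on_SucE[OF Suc.prems(2)] by blast
  show ?case
    by (auto intro!: exI[of _ "\<lambda>z v. f' z v + g' z v"] has_derivative_add f' g' Suc.IH)
qed

lemma Ck_on_mult:
  fixes f g :: "'a::euclidean_space \<Rightarrow> real"
  assumes "Ck_on k S f" "Ck_on k S g"
  shows "Ck_on k S (\<lambda>z. f z * g z)"
  using assms
proof (induction k arbitrary: f g)
  case 0
  then show ?case by (auto intro: continuous_intros)
next
  case (Suc k)
  obtain f' where f': "\<And>z. z \<in> S \<Longrightarrow> (f has_derivative f' z) (at z within S)"
     "\<And>v. Ck_on k S (\<lambda>z. f' z v)" using Ck_on_SucE[OF Suc.prems(1)] by blast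
  obtain g' where g': "\<And>z. z \<in> S \<Longrightarrow> (g has_derivative g' z) (at z within S)"
     "\<And>v. Ck_on k S (\<lambda>z. g' z v)" using Ck_on_SucE[OF Suc.prems(2)] by blast
  have "Ck_on k S f" "Ck_on k S g" using Suc.prems Ck_on_SucD by blast+
  then have "Ck_on k S (\<lambda>z. f z * g' z v + f' z v * g z)" for v
    by (intro Ck_on_add Suc.IH f' g')
  then show ?case
    by (auto intro!: exI[of _ "\<lambda>z v. f z * g' z v + f' z v * g z"] has_derivative_mult f' g')
qed

lemma Ck_on_prod:
  fixes f :: "'i \<Rightarrow> 'a::euclidean_space \<Rightarrow> real"
  assumes "\<And>i. i \<in> A \<Longrightarrow> Ck_on k S (f i)"
  shows "Ck_on k S (\<lambda>z. \<Prod>i\<in>A. f i z)"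
  using assms by (induction A rule: infinite_finite_induct) (auto intro: Ck_on_mult)

lemma Ck_on_power:
  fixes f :: "'a::euclidean_space \<Rightarrow> real"
  shows "Ck_on k S f \<Longrightarrow> Ck_on k S (\<lambda>z. f z ^ n)"
  by (induction n) (auto intro: Ck_on_mult)

lemma Ck_on_diff:
  fixes f :: "'a::euclidean_space \<Rightarrow> real"
  assumes "Ck_on k S f" "Ck_on k S g"
  shows "Ck_on k S (\<lambda>z. f z - g z)"
  using Ck_on_add[OF assms(1) Ck_on_mult[OF Ck_on_const[of k S "-1"] assms(2)]] by simp

lemma Ck_on_affine:
  assumes "Ck_on k UNIV h" "bounded_linear A"
  shows "Ck_on k S (\<lambda>z. h (A z + c))"
  using assms(1)
proof (induction k arbitrary: h)
  case 0
  have "continuous_on S (\<lambda>z. A z + c)"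
    using assms(2) by (intro continuous_intros linear_continuous_on)
  with 0 show ?case
    using continuous_on_compose2[of UNIV h S "\<lambda>z. A z + c"] by auto
next
  case (Suc k)
  then obtain h' where h': "\<And>z. (h has_derivative h' z) (at z)" "\<And>v. Ck_on k UNIV (\<lambda>z. h' z v)"
    by auto
  have "((\<lambda>z. A z + c) has_derivative A) (at z within S)" for z
    using has_derivative_add_const bounded_linear_imp_has_derivative[OF assms(2)] by blast
  then have "((\<lambda>z. h (A z + c)) has_derivative (\<lambda>v. h' (A z + c) (A v))) (at z within S)" for z
    using h'(1) has_derivative_compose by blast
  then show ?case
    using Suc.IH[OF h'(2)] by (auto intro!: exI[of _ "\<lambda>z v. h' (A z + c) (A v)"])
qed

lemma Ck_on_real_Suc:
  fixes h :: "real \<Rightarrow> real"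
  assumes "\<And>s. (h has_real_derivative h' s) (at s)" "Ck_on k UNIV h'"
  shows "Ck_on (Suc k) UNIV h"
proof -
  have "Ck_on k UNIV (\<lambda>z. h' z * v)" for v
    by (rule Ck_on_mult[OF assms(2) Ck_on_const])
  then show ?thesis using assms(1)
    by (auto simp: has_field_derivative_def intro!: exI[of _ "\<lambda>z v. h' z * v"])
qed

section \<open>Smooth bump functions\<close>

text \<open>
  The functions \<open>p(1/s) exp(-1/s)\<close>, extended by 0 to \<open>s \<le> 0\<close>, form a class that is closed under
  differentiation.  Carrying the polynomial \<open>p\<close> along is what makes the induction over the order of
  smoothness go through.
\<close>

definition flat_poly :: "real poly \<Rightarrow> real \<Rightarrow> real" where
  "flat_poly p s = (if s > 0 then poly p (1 / s) * exp (- (1 / s)) else 0)"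

lemma poly_exp_tendsto_0: "((\<lambda>s. poly p (1 / s) * exp (- (1 / s)) :: real) \<longlongrightarrow> 0) (at_right 0)"
proof -
  \<comment> \<open>in the variable \<open>y = 1/s\<close> this is the decay of polynomials times \<open>exp (-y)\<close>\<close>
  have 1: "((\<lambda>y::real. y ^ i * exp (- y)) \<longlongrightarrow> 0) at_top" for i
    using tendsto_power_div_exp_0[of i] by (simp add: exp_minus field_simps)
  have "((\<lambda>y::real. \<Sum>i\<le>degree p. coeff p i * (y ^ i * exp (- y))) \<longlongrightarrow> (\<Sum>i\<le>degree p. coeff p i * 0)) at_top"
    by (intro tendsto_sum tendsto_mult tendsto_const 1)
  then have "((\<lambda>y::real. poly p y * exp (- y)) \<longlongrightarrow> 0) at_top"
    by (simp add: poly_altdef sum_distrib_right mult.assoc)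
  moreover have "filterlim (\<lambda>s::real. 1 / s) at_top (at_right 0)"
    using filterlim_inverse_at_top_right by (simp add: inverse_eq_divide)
  ultimately show ?thesis by (rule filterlim_compose)
qed

lemma flat_poly_deriv:
  "(flat_poly p has_real_derivative flat_poly ([:0, 0, 1:] * (p - pderiv p)) s) (at s)"
proof -
  consider "s > 0" | "s < 0" | "s = 0" by linarith
  then show ?thesis
  proof cases
    case 1
    have "((\<lambda>s. poly p (1 / s) * exp (- (1 / s))) has_real_derivative flat_poly ([:0, 0, 1:] * (p - pderiv p)) s) (at s)"
      using 1
      by (auto intro!: derivative_eq_intros poly_DERIV[THEN DERIV_chain2]
          simp: flat_poly_def field_simps power2_eq_square)
    then show ?thesis
      by (rule has_field_derivative_transform_within_open[where S="{0<..}"])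
        (use 1 in \<open>auto simp: flat_poly_def\<close>)
  next
    case 2
    have "((\<lambda>s. 0) has_real_derivative flat_poly ([:0, 0, 1:] * (p - pderiv p)) s) (at s)"
      using 2 by (auto simp: flat_poly_def)
    then show ?thesis
      by (rule has_field_derivative_transform_within_open[where S="{..<0}"])
        (use 2 in \<open>auto simp: flat_poly_def\<close>)
  next
    case 3
    have "((\<lambda>s. poly (pCons 0 p) (1 / s) * exp (- (1 / s))) \<longlongrightarrow> 0) (at_right 0)"
      by (rule poly_exp_tendsto_0)
    then have r: "((\<lambda>y. flat_poly p y / y) \<longlongrightarrow> 0) (at_right 0)"
      by (rule Lim_transform_eventually)
        (auto simp: flat_poly_def eventually_at_right_less intro!: eventually_mono[OF eventually_at_right_less])
    have l: "((\<lambda>y. flat_poly p y / y) \<longlongrightarrow> 0) (at_left 0)"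
      by (rule Lim_transform_eventually[OF tendsto_const])
        (auto simp: flat_poly_def eventually_at_left_field intro!: exI[of _ "-1"])
    have "((\<lambda>y. flat_poly p y / y) \<longlongrightarrow> 0) (at 0)"
      using l r by (simp add: filterlim_split_at)
    then show ?thesis using 3
      by (simp add: has_field_derivative_iff flat_poly_def)
  qed
qed

lemma Ck_on_flat_poly: "Ck_on k UNIV (flat_poly p)"
proof (induction k arbitrary: p)
  case 0
  then show ?case
    using flat_poly_deriv by (auto intro!: DERIV_continuous_on)
next
  case (Suc k)
  show ?case by (rule Ck_on_real_Suc[OF flat_poly_deriv Suc.IH])
qed

definition box_bump :: "'a::euclidean_space \<Rightarrow> 'a \<Rightarrow> 'a \<Rightarrow> real" where
  "box_bump a b z = (\<Prod>i\<in>Basis. flat_poly 1 ((z - a) \<bullet> i) * flat_poly 1 ((b - z) \<bullet> i))"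

lemma Ck_on_box_bump: "Ck_on k S (box_bump a b)"
proof -
  have "Ck_on k UNIV (\<lambda>z. flat_poly 1 ((z - a) \<bullet> i))" for i
    using Ck_on_affine[OF Ck_on_flat_poly bounded_linear_inner_left[of i], of k UNIV 1 "- (a \<bullet> i)"]
    by (simp add: inner_diff_left)
  moreover have "Ck_on k UNIV (\<lambda>z. flat_poly 1 ((b - z) \<bullet> i))" for i
    using Ck_on_affine[OF Ck_on_flat_poly bounded_linear_minus[OF bounded_linear_inner_left[of i]], of k UNIV 1 "(b \<bullet> i)"]
    by (simp add: inner_diff_left)
  ultimately have "Ck_on k UNIV (\<lambda>z. \<Prod>i\<in>Basis. flat_poly 1 ((z - a) \<bullet> i) * flat_poly 1 ((b - z) \<bullet> i))"
    by (intro Ck_on_prod Ck_on_mult)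
  then show ?thesis unfolding box_bump_def using Ck_on_subset by (metis (no_types, lifting) ext subset_UNIV box_bump_def)
qed

lemma box_bump_bounds: "0 \<le> box_bump a b z" "box_bump a b z \<le> 1"
  by (auto simp: box_bump_def flat_poly_def intro!: prod_nonneg prod_le_1 mult_le_one)

text \<open>
  Positivity exactly on the open box is used twice: the bump serves as a mollifying kernel supported
  in a box, and the expression \<open>1 - (1 - bump) ^ n\<close> approximates the indicator function of the box.
\<close>

lemma box_bump_pos_iff: "box_bump a b z > 0 \<longleftrightarrow> z \<in> box a b"
proof -
  have "box_bump a b z \<noteq> 0 \<longleftrightarrow> z \<in> box a b"
    by (auto simp: box_bump_def flat_poly_def mem_box inner_diff_left)
  then show ?thesis using box_bump_bounds(1)[of a b z] by linarith
qed

lemma box_bump_eq_0_iff: "box_bump a b z = 0 \<longleftrightarrow> z \<notin> box a b"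
  using box_bump_pos_iff[of a b z] box_bump_bounds(1)[of a b z] by linarith

section \<open>Differentiation under the integral and convolution\<close>

text \<open>
  In finite dimension, continuity of the derivative on each fixed vector amounts to continuity in
  operator norm; the former is the form in which \<open>Ck_on\<close> provides derivatives.
\<close>

lemma has_derivative_integral_cbox:
  fixes k :: "'a::euclidean_space \<Rightarrow> 'b::euclidean_space \<Rightarrow> real"
  assumes der: "\<And>z w. z \<in> U \<Longrightarrow> w \<in> cbox a b \<Longrightarrow> ((\<lambda>z. k z w) has_derivative k' z w) (at z within U)"
    and cont: "\<And>v. continuous_on (U \<times> cbox a b) (\<lambda>(z, w). k' z w v)"
    and int: "\<And>z. z \<in> U \<Longrightarrow> k z integrable_on cbox a b"
    and U: "z \<in> U" "convex U"
  shows "((\<lambda>z. integral (cbox a b) (k z)) has_derivative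
     (\<lambda>v. integral (cbox a b) (\<lambda>w. k' z w v))) (at z within U)"
proof -
  define K where "K z w = Blinfun (k' z w)" for z w
  have K: "blinfun_apply (K z w) = k' z w" if "z \<in> U" "w \<in> cbox a b" for z w
    unfolding K_def by (intro bounded_linear_Blinfun_apply has_derivative_bounded_linear[OF der[OF that]])
  have c: "continuous_on (U \<times> cbox a b) (\<lambda>(z, w). K z w)"
  proof (rule continuous_on_blinfun_componentwise)
    fix i :: 'a assume "i \<in> Basis"
    show "continuous_on (U \<times> cbox a b) (\<lambda>p. (case p of (z, w) \<Rightarrow> K z w) i)"
      by (rule continuous_on_eq[OF cont[of i]]) (auto simp: K)
  qed
  have "((\<lambda>z. integral (cbox a b) (k z)) has_derivative
     blinfun_apply (integral (cbox a b) (K z))) (at z within U)"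
    by (rule leibniz_rule[OF _ int c U]) (use der K in auto)
  moreover have "continuous_on (cbox a b) (\<lambda>w. (z, w))"
    by (intro continuous_intros)
  from continuous_on_compose2[OF c this] have "(\<lambda>w. K z w) integrable_on cbox a b"
    using U(1) by (intro integrable_continuous) auto
  then have "blinfun_apply (integral (cbox a b) (K z)) v = integral (cbox a b) (\<lambda>w. k' z w v)" for v
    using U(1) by (subst blinfun_apply_integral) (auto intro!: integral_cong simp: K)
  then have "blinfun_apply (integral (cbox a b) (K z)) = (\<lambda>v. integral (cbox a b) (\<lambda>w. k' z w v))"
    by (rule ext)
  ultimately show ?thesis by simp
qed

text \<open>
  All derivatives fall on the smooth factor, so \<open>q\<close> needs only to be continuous on the box of
  integration; it may jump to 0 across the boundary of that box, for instance at time 0.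
\<close>

lemma Ck_on_convolution:
  fixes h :: "'a::euclidean_space \<Rightarrow> real"
  assumes "Ck_on k UNIV h" "continuous_on (cbox a b) q"
  shows "Ck_on k UNIV (\<lambda>z. integral (cbox a b) (\<lambda>w. q w * h (c *\<^sub>R (w - z))))"
  using assms(1)
proof (induction k arbitrary: h)
  have *: "continuous_on (UNIV \<times> cbox a b) (\<lambda>(z, w). q w * h (c *\<^sub>R (w - z)))"
    if "continuous_on UNIV h" for h
    unfolding split_beta
    by (intro continuous_intros continuous_on_compose2[OF assms(2)] continuous_on_compose2[OF that]) auto
  {
    case 0
    then have "continuous_on (UNIV \<times> cbox a b) (\<lambda>(z, w). q w * h (c *\<^sub>R (w - z)))"
      by (intro *) auto
    then show ?case using integral_continuous_on_param[of UNIV a b] by (fastforce simp: case_prod_unfold)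
  next
    case (Suc k)
    then obtain h' where h': "\<And>z. (h has_derivative h' z) (at z)" "\<And>v. Ck_on k UNIV (\<lambda>z. h' z v)"
      by auto
    have hc: "continuous_on UNIV h" using Suc.prems Ck_on_imp_continuous_on by blast
    have "((\<lambda>z. integral (cbox a b) (\<lambda>w. q w * h (c *\<^sub>R (w - z)))) has_derivative
      (\<lambda>v. integral (cbox a b) (\<lambda>w. q w * h' (c *\<^sub>R (w - z)) (- c *\<^sub>R v)))) (at z)" for z
    proof (rule has_derivative_integral_cbox[where k="\<lambda>z w. q w * h (c *\<^sub>R (w - z))" and U=UNIV and k'="\<lambda>z w v. q w * h' (c *\<^sub>R (w - z)) (- c *\<^sub>R v)"])
      fix z w
      have "((\<lambda>z. h (c *\<^sub>R (w - z))) has_derivative (\<lambda>v. h' (c *\<^sub>R (w - z)) (- c *\<^sub>R v))) (at z)"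
        by (rule has_derivative_compose[OF _ h'(1), of "\<lambda>z. c *\<^sub>R (w - z)"])
          (auto intro!: derivative_eq_intros)
      then show "((\<lambda>z. q w * h (c *\<^sub>R (w - z))) has_derivative (\<lambda>v. q w * h' (c *\<^sub>R (w - z)) (- c *\<^sub>R v))) (at z)"
        by (rule has_derivative_mult_right)
    next
      fix v
      show "continuous_on (UNIV \<times> cbox a b) (\<lambda>(z, w). q w * h' (c *\<^sub>R (w - z)) (- c *\<^sub>R v))"
        by (rule *[where h="\<lambda>z. h' z (- c *\<^sub>R v)"]) (use h'(2) Ck_on_imp_continuous_on in blast)
    next
      fix z
      show "(\<lambda>w. q w * h (c *\<^sub>R (w - z))) integrable_on cbox a b"
        by (intro integrable_continuous continuous_intros assms(2) continuous_on_compose2[OF hc]) auto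
    qed auto
    moreover have "Ck_on k UNIV (\<lambda>z. integral (cbox a b) (\<lambda>w. q w * h' (c *\<^sub>R (w - z)) (- c *\<^sub>R v)))" for v
      by (rule Suc.IH[OF h'(2)])
    ultimately show ?case unfolding Ck_on.simps
      by (intro exI[of _ "\<lambda>z v. integral (cbox a b) (\<lambda>w. q w * h' (c *\<^sub>R (w - z)) (- c *\<^sub>R v))"]
          conjI ballI allI)
  }
qed

section \<open>One-sided mollification\<close>

text \<open>
  A smooth probability density whose support lies in the cone of nonnegative coordinates: averages
  against it use only points ahead of the base point.
\<close>

definition unit_kernel :: "'a::euclidean_space \<Rightarrow> real" where
  "unit_kernel z = box_bump 0 One z / integral (cbox 0 One) (box_bump 0 (One::'a))"

lemma integral_box_bump_pos: "integral (cbox 0 One) (box_bump 0 (One::'a::euclidean_space)) > 0"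
proof -
  have c: "continuous_on (cbox 0 One) (box_bump 0 (One::'a))"
    using Ck_on_box_bump[of 0] by simp
  have i: "box_bump 0 (One::'a) integrable_on cbox 0 One"
    using c integrable_continuous by blast
  have "integral (cbox 0 One) (box_bump 0 (One::'a)) \<noteq> 0"
  proof
    assume "integral (cbox 0 One) (box_bump 0 (One::'a)) = 0"
    then have "(box_bump 0 (One::'a) has_integral 0) (cbox 0 One)"
      using i by (metis integrable_integral)
    moreover have h: "(1/2) *\<^sub>R One \<in> box 0 (One::'a)"
      by (auto simp: mem_box)
    moreover have "(1/2) *\<^sub>R One \<in> cbox 0 (One::'a)"
      using h box_subset_cbox by blast
    ultimately have "box_bump 0 (One::'a) ((1/2) *\<^sub>R One) = 0"
      using has_integral_0_cbox_imp_0[OF c box_bump_bounds(1)] by blast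
    then show False using h by (simp add: box_bump_eq_0_iff)
  qed
  moreover have "integral (cbox 0 One) (box_bump 0 (One::'a)) \<ge> 0"
    using i box_bump_bounds(1) by (intro integral_nonneg) auto
  ultimately show ?thesis by simp
qed

lemma Ck_on_unit_kernel: "Ck_on k S unit_kernel"
proof -
  have "Ck_on k S (\<lambda>z. box_bump 0 One z * (1 / integral (cbox 0 One) (box_bump 0 (One::'a))))"
    by (intro Ck_on_mult Ck_on_box_bump Ck_on_const)
  then show ?thesis by (simp add: unit_kernel_def[abs_def])
qed

lemma unit_kernel_nonneg: "unit_kernel z \<ge> 0"
  using integral_box_bump_pos box_bump_bounds(1) by (auto simp: unit_kernel_def intro!: divide_nonneg_pos)

lemma continuous_unit_kernel: "continuous_on S unit_kernel"
  using Ck_on_unit_kernel[of 0] by simp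

lemma unit_kernel_outside: "z \<notin> cbox 0 One \<Longrightarrow> unit_kernel z = 0"
  using box_bump_eq_0_iff[of 0 One z] box_subset_cbox by (auto simp: unit_kernel_def)

lemma integral_unit_kernel: "integral (cbox 0 One) (unit_kernel :: 'a::euclidean_space \<Rightarrow> real) = 1"
  using integral_box_bump_pos[where 'a='a] by (simp add: unit_kernel_def[abs_def])

definition mollify :: "real \<Rightarrow> ('a::euclidean_space \<Rightarrow> real) \<Rightarrow> 'a \<Rightarrow> real" where
  "mollify e q z = integral (cbox 0 One) (\<lambda>w. unit_kernel w * q (z + e *\<^sub>R w))"

text \<open>
  The sets on which mollification makes sense without extending the function: averages over
  \<open>z + e w\<close> with \<open>w\<close> in the unit box use only values on such a set.  The half space of nonnegative
  times is the example of interest.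
\<close>

definition forward_closed :: "'a::euclidean_space set \<Rightarrow> bool" where
  "forward_closed S \<longleftrightarrow> (\<forall>z\<in>S. \<forall>w\<in>cbox 0 One. \<forall>e>0. z + e *\<^sub>R w \<in> S)"

lemma mollify_integrable:
  assumes "forward_closed S" "continuous_on S q" "z \<in> S" "e > 0"
  shows "(\<lambda>w. unit_kernel w * q (z + e *\<^sub>R w)) integrable_on cbox 0 One"
  using assms by (intro integrable_continuous continuous_intros continuous_unit_kernel
      continuous_on_compose2[OF assms(2)]) (auto simp: forward_closed_def)

text \<open>
  The kernel is a probability density, so an average is as close to \<open>c\<close> as the averaged values are.
  Both the bound and the convergence of mollifications are instances.
\<close>

lemma mollify_close:
  fixes z :: "'a::euclidean_space"
  assumes S: "forward_closed S" and q: "continuous_on S q" and z: "z \<in> S" and e: "e > 0"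
    and close: "\<And>w. w \<in> cbox 0 One \<Longrightarrow> \<bar>q (z + e *\<^sub>R w) - c\<bar> \<le> d"
  shows "\<bar>mollify e q z - c\<bar> \<le> d"
proof -
  have "mollify e q z - c = integral (cbox 0 One) (\<lambda>w. unit_kernel w * q (z + e *\<^sub>R w)) - integral (cbox 0 (One::'a)) (\<lambda>w. unit_kernel w * c)"
    by (simp add: mollify_def integral_unit_kernel)
  also have "\<dots> = integral (cbox 0 One) (\<lambda>w. unit_kernel w * q (z + e *\<^sub>R w) - unit_kernel w * c)"
    by (intro integral_diff[symmetric] mollify_integrable[OF S q z e] integrable_continuous continuous_intros continuous_unit_kernel)
  finally have "\<bar>mollify e q z - c\<bar> = norm (integral (cbox 0 One) (\<lambda>w. unit_kernel w * q (z + e *\<^sub>R w) - unit_kernel w * c))"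
    by simp
  also have "\<dots> \<le> integral (cbox 0 (One::'a)) (\<lambda>w. unit_kernel w * d)"
  proof (rule integral_norm_bound_integral)
    show "(\<lambda>w. unit_kernel w * q (z + e *\<^sub>R w) - unit_kernel w * c) integrable_on cbox 0 One"
      by (intro integrable_diff mollify_integrable[OF S q z e] integrable_continuous continuous_intros continuous_unit_kernel)
    show "(\<lambda>w. unit_kernel w * d) integrable_on cbox 0 (One::'a)"
      by (intro integrable_continuous continuous_intros continuous_unit_kernel)
    fix w :: 'a assume w: "w \<in> cbox 0 One"
    have "norm (unit_kernel w * q (z + e *\<^sub>R w) - unit_kernel w * c) = unit_kernel w * \<bar>q (z + e *\<^sub>R w) - c\<bar>"
      using unit_kernel_nonneg[of w] by (simp add: right_diff_distrib[symmetric] abs_mult)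
    also have "\<dots> \<le> unit_kernel w * d"
      using close[OF w] unit_kernel_nonneg[of w] by (intro mult_left_mono)
    finally show "norm (unit_kernel w * q (z + e *\<^sub>R w) - unit_kernel w * c) \<le> unit_kernel w * d" .
  qed
  finally show ?thesis by (simp add: integral_unit_kernel)
qed

lemma mollify_tendsto:
  assumes S: "forward_closed S" and q: "continuous_on S q" and z: "z \<in> S"
  shows "(\<lambda>n. mollify (1 / Suc n) q z) \<longlonglongrightarrow> q z"
proof (rule LIMSEQ_I)
  fix r :: real assume r: "r > 0"
  obtain d where d: "d > 0" "\<And>y. y \<in> S \<Longrightarrow> dist y z < d \<Longrightarrow> dist (q y) (q z) < r/2"
    using q z r unfolding continuous_on_iff by (meson half_gt_zero)
  obtain B where B: "B > 0" "\<And>w. w \<in> cbox 0 (One::'a) \<Longrightarrow> norm w \<le> B"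
    using bounded_cbox[of 0 "One::'a"] bounded_pos by blast
  obtain N where N: "B / d < real N" using reals_Archimedean2 by blast
  show "\<exists>no. \<forall>n\<ge>no. norm (mollify (1 / Suc n) q z - q z) < r"
  proof (intro exI allI impI)
    fix n assume n: "n \<ge> N"
    have "\<bar>mollify (1 / Suc n) q z - q z\<bar> \<le> r / 2"
    proof (rule mollify_close[OF S q z])
      fix w :: 'a assume w: "w \<in> cbox 0 One"
      then have zs: "z + (1 / Suc n) *\<^sub>R w \<in> S" using S z unfolding forward_closed_def by simp
      have "B / d < Suc n" using N n by linarith
      then have "B < d * Suc n" using d(1) by (simp only: pos_divide_less_eq mult.commute)
      then have "norm w / Suc n < d" using B(2)[OF w] by (simp add: field_simps)
      then show "\<bar>q (z + (1 / Suc n) *\<^sub>R w) - q z\<bar> \<le> r / 2"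
        using d(2)[OF zs] by (simp add: dist_norm)
    qed simp
    then show "norm (mollify (1 / Suc n) q z - q z) < r" using r by simp
  qed
qed

lemma mollify_bound:
  assumes "forward_closed S" "continuous_on S q" "z \<in> S" "e > 0" "\<And>y. y \<in> S \<Longrightarrow> \<bar>q y\<bar> \<le> B"
  shows "\<bar>mollify e q z\<bar> \<le> B"
  using mollify_close[OF assms(1-4), of 0 B] assms(1,3,4,5) by (auto simp: forward_closed_def)

lemma has_derivative_mollify:
  assumes S: "forward_closed S" "convex S" and z: "z \<in> S" and e: "e > 0"
    and q: "\<And>z. z \<in> S \<Longrightarrow> (q has_derivative D z) (at z within S)"
    and D: "\<And>v. continuous_on S (\<lambda>z. D z v)"
  shows "(mollify e q has_derivative (\<lambda>v. mollify e (\<lambda>z. D z v) z)) (at z within S)"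
proof -
  have qc: "continuous_on S q" using q has_derivative_continuous_on by blast
  have fw: "z + e *\<^sub>R w \<in> S" if "z \<in> S" "w \<in> cbox 0 One" for z w
    using S(1) that e by (auto simp: forward_closed_def)
  show ?thesis unfolding mollify_def
  proof (rule has_derivative_integral_cbox[where U=S and
        k="\<lambda>z w. unit_kernel w * q (z + e *\<^sub>R w)" and k'="\<lambda>z w v. unit_kernel w * D (z + e *\<^sub>R w) v"])
    fix z w :: 'a assume zw: "z \<in> S" "w \<in> cbox 0 One"
    have "((\<lambda>z. z + e *\<^sub>R w) has_derivative (\<lambda>v. v)) (at z within S)"
      by (auto intro!: derivative_eq_intros)
    then have "((\<lambda>z. q (z + e *\<^sub>R w)) has_derivative (\<lambda>v. D (z + e *\<^sub>R w) v)) (at z within S)"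
      by (rule has_derivative_in_compose2[of S q D "\<lambda>z. z + e *\<^sub>R w", rotated 3])
        (use q fw zw in auto)
    then show "((\<lambda>z. unit_kernel w * q (z + e *\<^sub>R w)) has_derivative (\<lambda>v. unit_kernel w * D (z + e *\<^sub>R w) v)) (at z within S)"
      by (rule has_derivative_mult_right)
  next
    show "continuous_on (S \<times> cbox 0 One) (\<lambda>(z, w). unit_kernel w * D (z + e *\<^sub>R w) v)" for v
      unfolding split_beta
      by (intro continuous_intros continuous_on_compose2[OF D] continuous_on_compose2[OF continuous_unit_kernel[of UNIV]])
        (auto intro: fw)
  next
    show "(\<lambda>w. unit_kernel w * q (z + e *\<^sub>R w)) integrable_on cbox 0 One" if "z \<in> S" for z
      by (rule mollify_integrable[OF S(1) qc that e])
  qed (use z S in auto)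
qed

text \<open>
  Substituting \<open>z + e w\<close> moves the dependence on \<open>z\<close> from \<open>q\<close> to the kernel.
\<close>

lemma mollify_as_convolution:
  fixes z :: "'a::euclidean_space"
  assumes S: "forward_closed S" and z: "z \<in> S" and e: "e > 0"
    and c: "continuous_on (cbox a b) q" and off: "\<And>y. y \<in> S - cbox a b \<Longrightarrow> q y = 0"
  shows "mollify e q z = integral (cbox a b) (\<lambda>w. q w * unit_kernel ((1 / e) *\<^sub>R (w - z))) * (1 / e ^ DIM('a))"
  proof -
  define i where "i = integral (cbox a b) (\<lambda>w. q w * unit_kernel ((1 / e) *\<^sub>R (w - z)))"
  have "((\<lambda>w. q w * unit_kernel ((1 / e) *\<^sub>R (w - z))) has_integral i) (cbox a b)"
    unfolding i_def by (intro integrable_integral integrable_continuous continuous_intros c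
        continuous_on_compose2[OF continuous_unit_kernel[of UNIV]]) auto
  from has_integral_affinity[OF this, of e z]
  have "((\<lambda>w. q (e *\<^sub>R w + z) * unit_kernel w) has_integral (1 / e ^ DIM('a)) * i)
     ((\<lambda>x. (1 / e) *\<^sub>R x + - ((1 / e) *\<^sub>R z)) ` cbox a b)"
    using e by simp
  also have "(\<lambda>x. (1 / e) *\<^sub>R x + - ((1 / e) *\<^sub>R z)) ` cbox a b = {w. z + e *\<^sub>R w \<in> cbox a b}" (is "?L = ?T")
  proof -
    have "w \<in> ?L" if "z + e *\<^sub>R w \<in> cbox a b" for w
      using that e by (intro image_eqI[of _ _ "z + e *\<^sub>R w"]) (auto simp: scaleR_add_right)
    moreover have "z + e *\<^sub>R ((1 / e) *\<^sub>R x + - ((1 / e) *\<^sub>R z)) = x" for x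
      using e by (simp add: scaleR_diff_right)
    ultimately show ?thesis by auto
  qed
  finally have "((\<lambda>w. if w \<in> ?T then q (e *\<^sub>R w + z) * unit_kernel w else 0) has_integral (1 / e ^ DIM('a)) * i) UNIV"
    by (simp only: has_integral_restrict_UNIV)
  also have "(\<lambda>w. if w \<in> ?T then q (e *\<^sub>R w + z) * unit_kernel w else 0) =
    (\<lambda>w. if w \<in> cbox 0 One then unit_kernel w * q (z + e *\<^sub>R w) else 0)"
  proof
    \<comment> \<open>outside the unit box the kernel vanishes, and in \<open>S\<close> but outside the box from \<open>a\<close> to \<open>b\<close> the function \<open>q\<close> does\<close>
    fix w
    consider "w \<notin> cbox 0 One" | "w \<in> cbox 0 One" "z + e *\<^sub>R w \<in> cbox a b"
      | "w \<in> cbox 0 One" "z + e *\<^sub>R w \<in> S - cbox a b"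
      using S z e by (auto simp: forward_closed_def)
    then show "(if w \<in> ?T then q (e *\<^sub>R w + z) * unit_kernel w else 0) =
      (if w \<in> cbox 0 One then unit_kernel w * q (z + e *\<^sub>R w) else 0)"
      by cases (use off unit_kernel_outside[of w] in \<open>simp_all add: add.commute[of _ z] mult.commute[of "q _"]\<close>)
  qed
  finally have "((\<lambda>w. unit_kernel w * q (z + e *\<^sub>R w)) has_integral (1 / e ^ DIM('a)) * i) (cbox 0 One)"
    by (simp only: has_integral_restrict_UNIV)
  then show ?thesis unfolding mollify_def i_def by (simp add: integral_unique)
qed

lemma Ck_on_mollify:
  assumes "forward_closed S" "e > 0" "continuous_on (cbox a b) q" "\<And>y. y \<in> S - cbox a b \<Longrightarrow> q y = 0"
  shows "Ck_on k S (mollify e q)"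
proof (rule Ck_on_cong[OF mollify_as_convolution[OF assms(1) _ assms(2-4), symmetric]])
  show "Ck_on k S (\<lambda>z. integral (cbox a b) (\<lambda>w. q w * unit_kernel ((1 / e) *\<^sub>R (w - z))) * (1 / e ^ DIM('a)))"
    by (intro Ck_on_mult Ck_on_const Ck_on_subset[OF Ck_on_convolution[OF Ck_on_unit_kernel assms(3)]]) auto
qed auto

section \<open>Derivatives on the space-time domain\<close>

lemma line_derivative:
  assumes "(h has_derivative D) (at p within S)" "\<And>s. p + s *\<^sub>R v \<in> S"
  shows "((\<lambda>s. h (p + s *\<^sub>R v)) has_vector_derivative D v) (at 0)"
proof -
  have l: "linear D" using assms(1) has_derivative_linear by blast
  have "((\<lambda>s. p + s *\<^sub>R v) has_derivative (\<lambda>s. s *\<^sub>R v)) (at 0)"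
    by (auto intro!: derivative_eq_intros)
  moreover have "(h has_derivative D) (at (p + 0 *\<^sub>R v) within (\<lambda>s. p + s *\<^sub>R v) ` UNIV)"
    using assms by (auto intro: has_derivative_subset)
  ultimately have "((\<lambda>s. h (p + s *\<^sub>R v)) has_derivative (\<lambda>s. D (s *\<^sub>R v))) (at 0)"
    using has_derivative_in_compose by blast
  then show ?thesis
    by (simp add: has_vector_derivative_def linear_scale[OF l])
qed

lemma pderiv_x_eq2:
  assumes "(h has_derivative D) (at (t, x) within A \<times> UNIV)" "t \<in> A"
  shows "pderiv_x i (\<lambda>y. h (t, y)) x = D (0, axis i 1)"
  using line_derivative[OF assms(1), of "(0, axis i 1)"] assms(2)
  by (simp add: pderiv_x_def vector_derivative_at)

lemma pderiv_x_eq3: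
  assumes "(h has_derivative D) (at (t, x, u) within A \<times> UNIV)" "t \<in> A"
  shows "pderiv_x i (\<lambda>y. h (t, y, u)) x = D (0, axis i 1, 0)"
  using line_derivative[OF assms(1), of "(0, axis i 1, 0)"] assms(2)
  by (simp add: pderiv_x_def vector_derivative_at)

text \<open>
  Time intervals have no last point.  This is used to see that one-sided time derivatives are unique,
  and to leave room between the support of a test function and the right endpoint.
\<close>

lemma time_interval_forward:
  assumes "time_interval I" "t \<in> I" "e > 0"
  shows "\<exists>d>0. d < e \<and> t + d \<in> I"
proof -
  from assms(1) consider "I = {0..}" | T where "I = {0..<T}" unfolding time_interval_def by blast
  then show ?thesis
  proof cases
    case 1
    then show ?thesis using assms by (intro exI[of _ "e/2"]) auto
  next
    case 2
    then show ?thesis using assms by (intro exI[of _ "min (e/2) ((T - t)/2)"]) (auto simp: min_def field_simps)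
  qed
qed

lemma time_interval_at_within:
  assumes "time_interval I" "t \<in> I"
  shows "at t within I \<noteq> bot"
proof -
  have "t islimpt I" unfolding islimpt_approachable
  proof (intro allI impI)
    fix e :: real assume "e > 0"
    then obtain d where "d > 0" "d < e" "t + d \<in> I" using time_interval_forward[OF assms] by blast
    then show "\<exists>x'\<in>I. x' \<noteq> t \<and> dist x' t < e" by (intro bexI[of _ "t + d"]) (auto simp: dist_real_def)
  qed
  then show ?thesis by (simp add: trivial_limit_within)
qed

lemma d_t_has_vector_derivative:
  assumes "(h has_derivative D) (at (t, p) within I \<times> UNIV)"
  shows "((\<lambda>s. h (s, p)) has_vector_derivative D (1, 0)) (at t within I)"
proof -
  have l: "linear D" using assms(1) has_derivative_linear by blast
  have "((\<lambda>s. (s, p)) has_derivative (\<lambda>s. (s, 0))) (at t within I)"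
    by (auto intro!: derivative_eq_intros)
  moreover have "(h has_derivative D) (at (t, p) within (\<lambda>s. (s, p)) ` I)"
    by (rule has_derivative_subset[OF assms]) auto
  ultimately have "((\<lambda>s. h (s, p)) has_derivative (\<lambda>s. D (s, 0))) (at t within I)"
    using has_derivative_in_compose by blast
  moreover have "(\<lambda>s. D (s, 0)) = (\<lambda>s. s *\<^sub>R D (1, 0))"
  proof
    show "D (s, 0) = s *\<^sub>R D (1, 0)" for s
      using linear_scale[OF l, of s "(1, 0)"] by simp
  qed
  ultimately show ?thesis unfolding has_vector_derivative_def by (simp only:)
qed

lemma d_t_eq:
  assumes "(h has_derivative D) (at (t, p) within I \<times> UNIV)" "time_interval I" "t \<in> I"
  shows "d_t I h (t, p) = D (1, 0)"
  using vector_derivative_within[OF time_interval_at_within[OF assms(2,3)] d_t_has_vector_derivative[OF assms(1)]]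
  by (simp add: d_t_def)

lemma grad_x_eq:
  assumes "(h has_derivative D) (at (t, x) within I \<times> UNIV)" "t \<in> I"
  shows "grad_x h (t, x) = (\<chi> i. D (0, axis i 1))"
  using pderiv_x_eq2[OF assms] by (simp add: grad_x_def)

lemma compact_support_onI:
  assumes "time_interval I" "T \<in> I" "\<And>t x. t \<in> I \<Longrightarrow> \<phi> (t, x) \<noteq> 0 \<Longrightarrow> t \<le> T \<and> norm x \<le> R"
  shows "compact_support_on I \<phi>"
proof -
  have I: "{0..T} \<subseteq> I" "\<And>t. t \<in> I \<Longrightarrow> t \<ge> 0" using assms(1,2) unfolding time_interval_def by auto
  have "closure {z \<in> I \<times> UNIV. \<phi> z \<noteq> 0} \<subseteq> {0..T} \<times> cball 0 R"
    using assms(3) I(2) by (intro closure_minimal closed_Times) (auto simp: mem_cball_0)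
  moreover have "compact ({0..T} \<times> cball (0::real^'a) R)"
    by (intro compact_Times) auto
  ultimately have "compact (closure {z \<in> I \<times> UNIV. \<phi> z \<noteq> 0})"
    by (meson bounded_subset closed_closure compact_eq_bounded_closed)
  moreover have "{0..T} \<times> cball (0::real^'a) R \<subseteq> I \<times> UNIV" using I(1) by auto
  ultimately show ?thesis unfolding compact_support_on_def Let_def
    using \<open>closure _ \<subseteq> _\<close> by (meson order_trans)
qed

text \<open>
  A \<open>C\<^sup>1\<close> test function together with a Frechet derivative \<open>\<phi>'\<close> and a box outside of which both vanish.
  The vanishing includes the time \<open>T\<close> itself, which belongs to \<open>I\<close>; so \<open>T\<close> can serve as final time in
  the fundamental theorem of calculus.
\<close>

definition C1_data where
  "C1_data I T R \<phi> \<phi>' \<longleftrightarrow> T \<in> I \<and> R > 0 \<and>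
     (\<forall>z\<in>I \<times> UNIV. (\<phi> has_derivative \<phi>' z) (at z within I \<times> UNIV)) \<and>
     (\<forall>v. continuous_on (I \<times> UNIV) (\<lambda>z. \<phi>' z v)) \<and>
     (\<forall>t\<in>I. \<forall>x. t \<ge> T \<or> norm x \<ge> R \<longrightarrow> \<phi> (t, x) = 0 \<and> (\<forall>v. \<phi>' (t, x) v = 0))"

text \<open>
  The derivative within the domain is unique because from each point the domain contains small steps
  in every positive coordinate direction; hence it vanishes wherever \<open>\<phi>\<close> vanishes locally.
\<close>

lemma C1c_obtain_data:
  fixes I :: "real set" and \<phi> :: "real \<times> (real^'n) \<Rightarrow> real"
  assumes I: "time_interval I" and \<phi>: "\<phi> \<in> C1c I"
  obtains T R \<phi>' where "C1_data I T R \<phi> \<phi>'"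
proof -
  define K where "K = closure {z \<in> I \<times> UNIV. \<phi> z \<noteq> 0}"
  have K: "compact K" "K \<subseteq> I \<times> UNIV" using \<phi> unfolding C1c_def compact_support_on_def K_def Let_def by auto
  obtain \<phi>' where D: "\<And>z. z \<in> I \<times> UNIV \<Longrightarrow> (\<phi> has_derivative \<phi>' z) (at z within I \<times> UNIV)"
    "\<And>v. continuous_on (I \<times> UNIV) (\<lambda>z. \<phi>' z v)"
    using \<phi> unfolding C1c_def by auto
  have I0: "0 \<in> I" using I unfolding time_interval_def by auto
  have "compact (fst ` K)" using K by (intro compact_continuous_image continuous_intros)
  then have "compact (insert 0 (fst ` K))" by auto
  then obtain T0 where T0: "T0 \<in> insert 0 (fst ` K)" "\<And>t. t \<in> fst ` K \<Longrightarrow> t \<le> T0"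
    using compact_attains_sup[of "insert 0 (fst ` K)"] by auto
  then have "T0 \<in> I" using K I0 by auto
  then obtain T where T: "T > T0" "T \<in> I" using time_interval_forward[OF I, of T0 1] by (metis less_add_same_cancel1 zero_less_one)
  have "bounded (snd ` K)"
    using K by (intro compact_imp_bounded compact_continuous_image continuous_intros)
  then obtain R where R: "R > 0" "\<And>x. x \<in> snd ` K \<Longrightarrow> norm x < R"
    unfolding bounded_pos_less by blast
  have "\<phi> z = 0 \<and> (\<forall>v. \<phi>' z v = 0)" if z: "z \<in> I \<times> UNIV" "z \<notin> K" for z
  proof
    have off: "\<phi> y = 0" if "y \<in> I \<times> UNIV" "y \<in> - K" for y
    proof (rule ccontr)
      assume "\<phi> y \<noteq> 0"
      then have "y \<in> K" unfolding K_def using that(1) by (intro subsetD[OF closure_subset]) simp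
      then show False using that(2) by simp
    qed
    then show "\<phi> z = 0" using z by auto
    have "open (- K)" using K compact_imp_closed by auto
    then obtain e where e: "e > 0" "ball z e \<subseteq> - K" using z open_contains_ball by blast
    have "(\<phi> has_derivative (\<lambda>v. 0)) (at z within I \<times> UNIV)"
    proof (rule has_derivative_transform_within[OF has_derivative_const[of 0] e(1) z(1)])
      fix y assume "y \<in> I \<times> UNIV" "dist y z < e"
      then show "0 = \<phi> y" using e(2) off[of y] by (auto simp: mem_ball dist_commute)
    qed
    moreover have "\<exists>d. 0 < \<bar>d\<bar> \<and> \<bar>d\<bar> < e \<and> z + d *\<^sub>R i \<in> I \<times> UNIV" if "i \<in> Basis" "e > 0" for i e
    proof -
      obtain d where "d > 0" "d < e" "fst z + d \<in> I"
        using time_interval_forward[OF I, of "fst z" e] z(1) \<open>e > 0\<close> by (metis mem_Times_iff)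
      then show ?thesis using \<open>i \<in> Basis\<close> z(1) by (intro exI[of _ d]) (auto simp: Basis_prod_def)
    qed
    ultimately have "\<phi>' z = (\<lambda>v. 0)"
      using frechet_derivative_unique_within[OF D(1)[OF z(1)]] by blast
    then show "\<forall>v. \<phi>' z v = 0" by simp
  qed
  moreover have "(t, x) \<notin> K" if "t \<ge> T \<or> norm x \<ge> R" for t x
  proof
    assume "(t, x) \<in> K"
    then have "t \<in> fst ` K" "x \<in> snd ` K" by force+
    then show False using T0(2)[of t] T(1) R(2)[of x] that by auto
  qed
  ultimately have "C1_data I T R \<phi> \<phi>'"
    unfolding C1_data_def using T R D by blast
  then show thesis by (rule that)
qed

section \<open>Iterated integrals of Lebesgue measurable functions\<close>

text \<open>
  Lebesgue measure on a product is the completion of the product measure, not the product of the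
  completions.  Fubini's theorem is therefore applied to Borel representatives.
\<close>

lemma time_interval_sets: "time_interval I \<Longrightarrow> I \<in> sets borel"
  unfolding time_interval_def by auto

lemma time_interval_domain_sets:
  "time_interval I \<Longrightarrow> I \<times> (UNIV :: (real^'n) set) \<in> sets borel"
  using time_interval_sets by (auto intro: borel_Times)

lemma time_interval_domain_lebesgue [simp]:
  "time_interval I \<Longrightarrow> I \<times> (UNIV :: (real^'n) set) \<in> sets lebesgue"
  using time_interval_domain_sets[where 'n='n] by (intro sets_completionI_sets) simp

lemma borel_measurable_lebesgue_AE:
  fixes f g :: "'a::euclidean_space \<Rightarrow> real"
  assumes ae: "AE x in lborel. f x = g x" and g: "g \<in> borel_measurable lebesgue"
  shows "f \<in> borel_measurable lebesgue"
proof (rule borel_measurableI_greater)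
  fix a
  have "{x \<in> space lebesgue. g x > a} \<in> sets lebesgue" using g by measurable
  moreover have "AE x in lebesgue. x \<in> {x \<in> space lebesgue. g x > a} \<longleftrightarrow> x \<in> {x \<in> space lebesgue. f x > a}"
    using AE_completion[OF ae] by eventually_elim auto
  ultimately show "{x \<in> space lebesgue. f x > a} \<in> sets lebesgue"
    using completion.in_sets_AE by blast
qed

lemma integral_lebesgue_eq_lborel_AE:
  fixes f g :: "'a::euclidean_space \<Rightarrow> real"
  assumes ae: "AE x in lborel. f x = g x" and g: "g \<in> borel_measurable lborel"
  shows "integral\<^sup>L lebesgue f = integral\<^sup>L lborel g"
proof -
  have g': "g \<in> borel_measurable lebesgue" using g by (rule measurable_completion)
  have "integral\<^sup>L lebesgue f = integral\<^sup>L lebesgue g"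
    by (intro integral_cong_AE borel_measurable_lebesgue_AE[OF ae] g' AE_completion ae)
  then show ?thesis using integral_completion[OF g] by simp
qed

text \<open>
  A representative \<open>G\<close> of the integrand agrees with it at almost every point, hence for almost every
  \<open>t\<close> at almost every \<open>x\<close>; completeness of Lebesgue measure makes the measurability of the
  sections, which may fail on a null set of times, harmless.
\<close>

lemma iterated_integral_eq_AE:
  fixes h h' :: "real \<times> (real^'n) \<Rightarrow> real"
  assumes I: "time_interval I" and h: "integrable (lebesgue_on (I \<times> UNIV)) h"
    and ae: "AE z in lebesgue_on (I \<times> UNIV). h' z = h z"
  shows "(LINT t:I|lebesgue. LINT x|lebesgue. h' (t, x)) = integral\<^sup>L (lebesgue_on (I \<times> UNIV)) h"
proof -
  note S [simp] = time_interval_domain_lebesgue[OF I, where 'n='n]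
  define H where "H z = indicator (I \<times> UNIV) z *\<^sub>R h z" for z
  have H: "integrable lebesgue H" unfolding H_def using h by (subst (asm) integrable_restrict_space) auto
  then obtain G where G: "G \<in> borel_measurable lborel" "AE z in lborel. H z = G z"
    using completion_ex_borel_measurable_real by blast
  have intG: "integrable lborel G"
  proof -
    have "integrable lebesgue G"
      using H G AE_completion[OF G(2)] by (intro integrable_cong_AE_imp[OF H measurable_completion]) (auto elim: eventually_mono)
    then show ?thesis using integrable_completion[OF G(1)] by simp
  qed
  have "integral\<^sup>L (lebesgue_on (I \<times> UNIV)) h = integral\<^sup>L lebesgue H"
    unfolding H_def by (subst integral_restrict_space) auto
  also have "\<dots> = integral\<^sup>L lborel G" by (rule integral_lebesgue_eq_lborel_AE[OF G(2,1)])
  also have "\<dots> = (LINT t|lborel. LINT x|lborel. G (t, x))"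
    using lborel_pair.integral_fst'[of G] intG by (simp add: lborel_prod)
  finally have 1: "integral\<^sup>L (lebesgue_on (I \<times> UNIV)) h = (LINT t|lborel. LINT x|lborel. G (t, x))" .
  have "AE z in lebesgue. z \<in> I \<times> UNIV \<longrightarrow> h' z = h z"
    using ae by (subst (asm) AE_restrict_space_iff) auto
  then have "AE z in lborel. z \<in> I \<times> UNIV \<longrightarrow> h' z = h z"
    by (simp add: AE_completion_iff)
  then have "AE z in lborel. indicator I (fst z) *\<^sub>R h' z = G z"
    using G(2) by eventually_elim (auto simp: H_def indicator_def split: if_splits)
  then have "AE z in lborel \<Otimes>\<^sub>M lborel. indicator I (fst z) *\<^sub>R h' z = G z"
    unfolding lborel_prod .
  from lborel_pair.AE_pair[OF this]
  have "AE t in lborel. AE x in lborel. indicator I t *\<^sub>R h' (t, x) = G (t, x)" by simp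
  then have "AE t in lborel. indicator I t *\<^sub>R (LINT x|lebesgue. h' (t, x)) = (LINT x|lborel. G (t, x))"
  proof eventually_elim
    fix t assume a: "AE x in lborel. indicator I t *\<^sub>R h' (t, x) = G (t, x)"
    show "indicator I t *\<^sub>R (LINT x|lebesgue. h' (t, x)) = (LINT x|lborel. G (t, x))"
      using integral_lebesgue_eq_lborel_AE[OF a] G(1) by simp
  qed
  moreover have "(\<lambda>t. LINT x|lborel. G (t, x)) \<in> borel_measurable lborel"
    using lborel_pair.integrable_fst'[of G] intG by (simp add: lborel_prod)
  ultimately have "(LINT t|lebesgue. indicator I t *\<^sub>R (LINT x|lebesgue. h' (t, x))) = (LINT t|lborel. LINT x|lborel. G (t, x))"
    by (rule integral_lebesgue_eq_lborel_AE)
  then show ?thesis using 1 by (simp add: set_lebesgue_integral_def)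
qed

lemma sigma_finite_lebesgue: "sigma_finite_measure (lebesgue :: 'a::euclidean_space measure)"
proof
  obtain A :: "'a set set" where "countable A" "A \<subseteq> sets lborel" "\<Union> A = space lborel" "\<forall>a\<in>A. emeasure lborel a \<noteq> \<infinity>"
    using lborel.sigma_finite_countable by blast
  then show "\<exists>A::'a set set. countable A \<and> A \<subseteq> sets lebesgue \<and> \<Union> A = space lebesgue \<and> (\<forall>a\<in>A. emeasure lebesgue a \<noteq> \<infinity>)"
    by (intro exI[of _ A]) (auto simp: subset_iff)
qed

lemma borel_measurable_compose_continuous_on:
  fixes G :: "'a::topological_space \<Rightarrow> 'b::topological_space"
  assumes "continuous_on S G" "p \<in> borel_measurable Q" "\<And>w. w \<in> space Q \<Longrightarrow> p w \<in> S"
  shows "(\<lambda>w. G (p w)) \<in> borel_measurable Q"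
proof -
  have "p \<in> measurable Q (restrict_space borel S)"
    using assms(2,3) by (intro measurable_restrict_space2) auto
  then show ?thesis
    using borel_measurable_continuous_on_restrict[OF assms(1)] by (rule measurable_compose)
qed

section \<open>Integration by parts on the space-time domain\<close>

lemma integrable_bounded_support:
  fixes h :: "real \<times> (real^'n) \<Rightarrow> real"
  assumes I: "time_interval I" and h: "h \<in> borel_measurable (lebesgue_on (I \<times> UNIV))"
    and off: "\<And>t x. t \<in> I \<Longrightarrow> t \<ge> T \<or> norm x \<ge> R \<Longrightarrow> h (t, x) = 0"
    and B: "\<And>t x. t \<in> I \<Longrightarrow> t < T \<Longrightarrow> norm x < R \<Longrightarrow> \<bar>h (t, x)\<bar> \<le> B"
  shows "integrable (lebesgue_on (I \<times> UNIV)) h"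
proof (rule integrableI_bounded_set[where A="(I \<inter> {..<T}) \<times> ball 0 R" and B=B])
  have pos: "t \<ge> 0" if "t \<in> I" for t using I that unfolding time_interval_def by auto
  have A: "(I \<inter> {..<T}) \<times> ball (0::real^'n) R \<in> sets borel"
    using time_interval_sets[OF I] by (intro borel_Times) auto
  then have A': "(I \<inter> {..<T}) \<times> ball (0::real^'n) R \<in> sets lebesgue" by simp
  have sub: "(I \<inter> {..<T}) \<times> ball (0::real^'n) R \<subseteq> I \<times> UNIV" by blast
  show "(I \<inter> {..<T}) \<times> ball (0::real^'n) R \<in> sets (lebesgue_on (I \<times> UNIV))"
  proof (rule iffD2[OF sets_restrict_space_iff])
    show "I \<times> UNIV \<inter> space lebesgue \<in> sets (lebesgue :: (real \<times> (real^'n)) measure)"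
      using time_interval_domain_lebesgue[OF I, where 'n='n] by simp
    show "(I \<inter> {..<T}) \<times> ball (0::real^'n) R \<subseteq> I \<times> UNIV \<and> (I \<inter> {..<T}) \<times> ball (0::real^'n) R \<in> sets lebesgue"
      by (rule conjI[OF sub A'])
  qed
  have "bounded ((I \<inter> {..<T}) \<times> ball (0::real^'n) R)"
    using pos by (intro bounded_Times bounded_ball bounded_subset[OF bounded_closed_interval, of _ 0 T]) auto
  then have "(I \<inter> {..<T}) \<times> ball (0::real^'n) R \<in> lmeasurable"
    using A by (intro bounded_set_imp_lmeasurable) auto
  then show "emeasure (lebesgue_on (I \<times> UNIV)) ((I \<inter> {..<T}) \<times> ball (0::real^'n) R) < \<infinity>"
    using time_interval_domain_lebesgue[OF I, where 'n='n] sub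
    by (subst emeasure_restrict_space) (simp_all add: fmeasurable_def del: emeasure_completion)
  show "AE x in lebesgue_on (I \<times> UNIV). x \<in> (I \<inter> {..<T}) \<times> ball 0 R \<longrightarrow> norm (h x) \<le> B"
    using B by (auto intro!: AE_I2)
  show "AE x in lebesgue_on (I \<times> UNIV). x \<notin> (I \<inter> {..<T}) \<times> ball 0 R \<longrightarrow> h x = 0"
  proof (intro AE_I2 impI)
    fix z assume "z \<in> space (lebesgue_on (I \<times> UNIV))" "z \<notin> (I \<inter> {..<T}) \<times> ball (0::real^'n) R"
    then show "h z = 0" using off[of "fst z" "snd z"] by (auto simp: mem_Times_iff not_less)
  qed
qed (use h in auto)

lemma integrable_bounded_support_lebesgue:
  fixes h :: "'a::euclidean_space \<Rightarrow> real"
  assumes h: "h \<in> borel_measurable lebesgue"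
    and off: "\<And>x. norm x \<ge> R \<Longrightarrow> h x = 0"
    and B: "\<And>x. norm x < R \<Longrightarrow> \<bar>h x\<bar> \<le> B"
  shows "integrable lebesgue h"
proof (rule integrableI_bounded_set[where A="ball 0 R" and B=B])
  have "ball (0::'a) R \<in> lmeasurable" by simp
  then show "emeasure lebesgue (ball (0::'a) R) < \<infinity>" by (auto simp: fmeasurable_def)
qed (use h off B in \<open>auto intro!: AE_I2\<close>)

text \<open>
  The integral of a difference quotient \<open>(h(z + s v) - h(z)) / s\<close> is 0 by translation invariance.
  By the mean value theorem these quotients are dominated by the bound on \<open>h'\<close> on a fixed ball, so the
  limit \<open>s \<rightarrow> 0\<close> may be taken under the integral.
\<close>

lemma integral_directional_derivative_eq_0:
  fixes h h' :: "'a::euclidean_space \<Rightarrow> real"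
  assumes h: "h \<in> borel_measurable borel"
    and D: "\<And>z s. ((\<lambda>s. h (z + s *\<^sub>R v)) has_real_derivative h' (z + s *\<^sub>R v)) (at s)"
    and bnd: "\<And>z. \<bar>h z\<bar> \<le> C" "\<And>z. \<bar>h' z\<bar> \<le> B"
    and supp: "\<And>z. norm z \<ge> R \<Longrightarrow> h z = 0"
  shows "integral\<^sup>L lborel h' = 0"
proof -
  define q where "q n z = (h (z + (1 / Suc n) *\<^sub>R v) - h z) / (1 / Suc n)" for n z
  have hi: "integrable lborel h"
  proof (rule integrableI_bounded_set[where A="ball 0 R" and B=C])
    show "emeasure lborel (ball (0::'a) R) < \<infinity>" using emeasure_bounded_finite[OF bounded_ball, of 0 R] by simp
  qed (use h bnd supp in \<open>auto intro!: AE_I2\<close>)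
  have shift: "(\<lambda>z. h (z + c)) \<in> borel_measurable borel" for c
    using h by measurable
  have si: "integrable lborel (\<lambda>z. h (z + c)) \<and> (LINT z|lborel. h (z + c)) = (LINT z|lborel. h z)" for c
  proof -
    have "integrable (distr lborel borel ((+) c)) h" using hi by (simp add: lborel_distr_plus)
    then have "integrable lborel (\<lambda>z. h (c + z))" by (subst (asm) integrable_distr_eq) (use h in auto)
    moreover have "integral\<^sup>L (distr lborel borel ((+) c)) h = (LINT z|lborel. h (c + z))"
      by (subst integral_distr) (use h in auto)
    ultimately show ?thesis by (simp add: lborel_distr_plus add.commute)
  qed
  have q0: "integral\<^sup>L lborel (q n) = 0" for n
    unfolding q_def using si hi by (simp add: Bochner_Integration.integral_diff)
  have lim: "(\<lambda>n. q n z) \<longlonglongrightarrow> h' z" for z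
  proof -
    have "((\<lambda>s. (h (z + s *\<^sub>R v) - h z) / s) \<longlongrightarrow> h' z) (at 0)"
      using D[of z 0] by (simp add: has_field_derivative_iff)
    moreover have "filterlim (\<lambda>n. 1 / real (Suc n)) (at 0) sequentially"
      unfolding filterlim_at using LIMSEQ_Suc[OF lim_1_over_n] by (auto simp: )
    ultimately show ?thesis unfolding q_def by (rule filterlim_compose)
  qed
  have q: "q n \<in> borel_measurable borel" for n
    unfolding q_def using h shift by measurable
  have bound: "norm (q n z) \<le> B * indicator (ball 0 (R + norm v)) z" for n z
  proof (cases "norm z < R + norm v")
    case True
    have "\<exists>y>0. y < 1 / Suc n \<and> h (z + (1 / Suc n) *\<^sub>R v) - h (z + 0 *\<^sub>R v) = (1 / Suc n - 0) * h' (z + y *\<^sub>R v)"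
      by (rule MVT2[where f="\<lambda>s. h (z + s *\<^sub>R v)" and f'="\<lambda>s. h' (z + s *\<^sub>R v)"]) (simp, rule D)
    then obtain y where "h (z + (1 / Suc n) *\<^sub>R v) - h z = (1 / Suc n) * h' (z + y *\<^sub>R v)" by auto
    then have "q n z = h' (z + y *\<^sub>R v)" unfolding q_def by simp
    then show ?thesis using True bnd(2) by simp
  next
    case False
    have "norm ((1 / Suc n) *\<^sub>R v) \<le> norm v"
      using mult_right_mono[of "1 / Suc n" 1 "norm v"] by (simp add: field_simps)
    then have "norm (z + (1 / Suc n) *\<^sub>R v) \<ge> R"
      using False norm_triangle_ineq2[of z "- ((1 / Suc n) *\<^sub>R v)"] by simp
    moreover have "norm z \<ge> R" using False norm_ge_zero[of v] by linarith
    ultimately show ?thesis using False supp unfolding q_def by simp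
  qed
  have "(\<lambda>n. integral\<^sup>L lborel (q n)) \<longlonglongrightarrow> integral\<^sup>L lborel h'"
  proof (rule integral_dominated_convergence[where w="\<lambda>z. B * indicator (ball 0 (R + norm v)) z"])
    show "h' \<in> borel_measurable lborel"
      by (rule borel_measurable_LIMSEQ_metric[where f=q]) (use q lim in auto)
    show "integrable lborel (\<lambda>z. B * indicator (ball 0 (R + norm v)) z)"
      by (intro integrable_mult_right integrable_real_indicator) (use emeasure_bounded_finite[OF bounded_ball, of 0 "R + norm v"] in simp_all)
  qed (use q lim bound in auto)
  then show ?thesis using LIMSEQ_unique[OF _ tendsto_const[of 0]] by (simp add: q0)
qed

lemma integral_domain_eq_lborel:
  fixes q :: "real \<times> (real^'n) \<Rightarrow> real"
  assumes I: "time_interval I" and q: "continuous_on (I \<times> UNIV) q"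
  shows "integral\<^sup>L (lebesgue_on (I \<times> UNIV)) q = (LINT z|lborel. indicator (I \<times> UNIV) z *\<^sub>R q z)"
    "integrable (lebesgue_on (I \<times> UNIV)) q \<longleftrightarrow> integrable lborel (\<lambda>z. indicator (I \<times> UNIV) z *\<^sub>R q z)"
proof -
  note S = time_interval_domain_lebesgue[OF I, where 'n='n]
  have m: "(\<lambda>z. indicator (I \<times> UNIV) z *\<^sub>R q z) \<in> borel_measurable lborel"
    using borel_measurable_continuous_on_indicator[OF time_interval_domain_sets[OF I] q] by simp
  show "integral\<^sup>L (lebesgue_on (I \<times> UNIV)) q = (LINT z|lborel. indicator (I \<times> UNIV) z *\<^sub>R q z)"
    using S integral_completion[OF m] by (subst integral_restrict_space) auto
  show "integrable (lebesgue_on (I \<times> UNIV)) q \<longleftrightarrow> integrable lborel (\<lambda>z. indicator (I \<times> UNIV) z *\<^sub>R q z)"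
    using S integrable_completion[OF m] by (subst integrable_restrict_space) auto
qed


lemma C1_data_continuous:
  assumes "C1_data I T R \<phi> \<phi>'"
  shows "continuous_on (I \<times> UNIV) \<phi>"
  by (rule has_derivative_continuous_on[of _ _ \<phi>']) (use assms[unfolded C1_data_def] in blast)

lemma continuous_on_bounded_support:
  fixes q :: "real \<times> (real^'n) \<Rightarrow> real"
  assumes I: "time_interval I" "T \<in> I" and q: "continuous_on (I \<times> UNIV) q"
    and off: "\<And>t x. t \<in> I \<Longrightarrow> t \<ge> T \<or> norm x \<ge> R \<Longrightarrow> q (t, x) = 0"
  obtains B where "B > 0" "\<And>z. z \<in> I \<times> UNIV \<Longrightarrow> \<bar>q z\<bar> \<le> B"
proof -
  have sub: "{0..T} \<subseteq> I" and pos: "\<And>t. t \<in> I \<Longrightarrow> t \<ge> 0" using I unfolding time_interval_def by auto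
  have "compact ({0..T} \<times> cball (0::real^'n) R)" by (intro compact_Times) auto
  moreover have "continuous_on ({0..T} \<times> cball (0::real^'n) R) q"
    by (rule continuous_on_subset[OF q]) (use sub in auto)
  ultimately have "bounded (q ` ({0..T} \<times> cball (0::real^'n) R))"
    using compact_continuous_image compact_imp_bounded by blast
  then obtain B where B: "B > 0" "\<And>z. z \<in> {0..T} \<times> cball (0::real^'n) R \<Longrightarrow> \<bar>q z\<bar> \<le> B"
    unfolding bounded_pos by force
  have "\<bar>q z\<bar> \<le> B" if z: "z \<in> I \<times> UNIV" for z
  proof -
    obtain t x where [simp]: "z = (t, x)" and t: "t \<in> I" using z by auto
    show ?thesis
    proof (cases "t \<ge> T \<or> norm x \<ge> R")
      case True
      then show ?thesis using off[OF t] B(1) by simp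
    next
      case False
      then show ?thesis using B(2)[of z] pos[OF t] by auto
    qed
  qed
  with B(1) show thesis by (rule that)
qed

text \<open>
  For each \<open>x\<close> this is the fundamental theorem of calculus on \<open>[0, T]\<close>; the upper boundary term is 0.
\<close>

lemma integral_time_derivative:
  fixes \<phi> :: "real \<times> (real^'n) \<Rightarrow> real"
  assumes I: "time_interval I" and C: "C1_data I T R \<phi> \<phi>'"
  shows "integral\<^sup>L (lebesgue_on (I \<times> UNIV)) (\<lambda>z. \<phi>' z (1, 0)) = - (LINT x|lebesgue. \<phi> (0, x))"
proof -
  note S = time_interval_domain_lebesgue[OF I, where 'n='n]
  have T: "T \<in> I" and c: "continuous_on (I \<times> UNIV) (\<lambda>z. \<phi>' z (1, 0))"
    and der: "\<And>z. z \<in> I \<times> UNIV \<Longrightarrow> (\<phi> has_derivative \<phi>' z) (at z within I \<times> UNIV)"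
    and off: "\<And>t x. t \<in> I \<Longrightarrow> t \<ge> T \<or> norm x \<ge> R \<Longrightarrow> \<phi> (t, x) = 0 \<and> \<phi>' (t, x) (1, 0) = 0"
    using C unfolding C1_data_def by auto
  have sub: "{0..T} \<subseteq> I" and pos: "\<And>t. t \<in> I \<Longrightarrow> t \<ge> 0" and I0: "0 \<in> I"
    using I T unfolding time_interval_def by auto
  define H where "H z = indicator (I \<times> UNIV) z *\<^sub>R \<phi>' z (1, 0)" for z
  obtain B where B: "\<And>z. z \<in> I \<times> UNIV \<Longrightarrow> \<bar>\<phi>' z (1, 0)\<bar> \<le> B"
    using continuous_on_bounded_support[OF I T c] off by metis
  have "integrable (lebesgue_on (I \<times> UNIV)) (\<lambda>z. \<phi>' z (1, 0))"
    by (rule integrable_bounded_support[OF I, of _ T R B])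
      (use off B in \<open>auto intro!: continuous_imp_measurable_on_sets_lebesgue c S\<close>)
  then have Hi: "integrable lborel H" using integral_domain_eq_lborel(2)[OF I c] by (simp add: H_def[abs_def])
  have inner: "(LINT t|lborel. H (t, x)) = - \<phi> (0, x)" for x
  proof -
    have "(LINT t|lborel. H (t, x)) = (LINT t|lborel. indicator {0..T} t *\<^sub>R \<phi>' (t, x) (1, 0))"
      using off[of _ x] pos sub by (intro Bochner_Integration.integral_cong) (auto simp: H_def indicator_def)
    also have "\<dots> = \<phi> (T, x) - \<phi> (0, x)"
    proof (rule integral_FTC_atLeastAtMost)
      show "0 \<le> T" using pos T by auto
      show "((\<lambda>t. \<phi> (t, x)) has_vector_derivative \<phi>' (t, x) (1, 0)) (at t within {0..T})"
        if "0 \<le> t" "t \<le> T" for t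
      proof (rule has_vector_derivative_within_subset[OF d_t_has_vector_derivative sub])
        show "(\<phi> has_derivative \<phi>' (t, x)) (at (t, x) within I \<times> UNIV)"
          by (rule der) (use that sub in auto)
      qed
      show "continuous_on {0..T} (\<lambda>t. \<phi>' (t, x) (1, 0))"
        by (rule continuous_on_compose2[OF c, of _ "\<lambda>t. (t, x)"]) (use sub in \<open>auto intro!: continuous_intros\<close>)
    qed
    also have "\<phi> (T, x) = 0" using off[OF T, of x] by simp
    finally show ?thesis by simp
  qed
  have "integral\<^sup>L (lebesgue_on (I \<times> UNIV)) (\<lambda>z. \<phi>' z (1, 0)) = integral\<^sup>L lborel H"
    unfolding H_def by (rule integral_domain_eq_lborel(1)[OF I c])
  also have "\<dots> = (LINT x|lborel. LINT t|lborel. H (t, x))"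
    using lborel_pair.integral_snd[of "\<lambda>t x. H (t, x)"] Hi by (simp add: lborel_prod)
  also have "\<dots> = (LINT x|lborel. - \<phi> (0, x))" by (simp only: inner)
  also have "(LINT x|lborel. - \<phi> (0, x)) = - (LINT x|lebesgue. \<phi> (0, x))"
  proof -
    have "continuous_on UNIV (\<lambda>x. \<phi> (0, x))"
      by (rule continuous_on_compose2[OF C1_data_continuous[OF C], of _ "\<lambda>x. (0, x)"]) (use I0 in \<open>auto intro!: continuous_intros\<close>)
    then have "(\<lambda>x. \<phi> (0, x)) \<in> borel_measurable lborel"
      by (simp add: borel_measurable_continuous_onI)
    then show ?thesis using integral_completion[of "\<lambda>x. \<phi> (0, x)" lborel] by simp
  qed
  finally show ?thesis .
qed

text \<open>
  Extended by 0 to times outside \<open>I\<close>, the product \<open>w \<phi>\<close> is still differentiable along spatial directions,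
  because they do not change \<open>t\<close>.
\<close>

lemma integral_by_parts_x:
  fixes \<phi> :: "real \<times> (real^'n) \<Rightarrow> real" and w :: "real \<times> (real^'n) \<Rightarrow> real"
  assumes I: "time_interval I" and C: "C1_data I T R \<phi> \<phi>'"
    and w: "continuous_on (I \<times> UNIV) w" and w': "continuous_on (I \<times> UNIV) w'"
    and wd: "\<And>t x. t \<in> I \<Longrightarrow> ((\<lambda>s. w (t, x + s *\<^sub>R axis i 1)) has_real_derivative w' (t, x)) (at 0)"
  shows "integral\<^sup>L (lebesgue_on (I \<times> UNIV)) (\<lambda>z. w z * \<phi>' z (0, axis i 1) + w' z * \<phi> z) = 0"
proof -
  note S = time_interval_domain_lebesgue[OF I, where 'n='n]
  have T: "T \<in> I" and c: "continuous_on (I \<times> UNIV) (\<lambda>z. \<phi>' z (0, axis i 1))"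
    and der: "\<And>z. z \<in> I \<times> UNIV \<Longrightarrow> (\<phi> has_derivative \<phi>' z) (at z within I \<times> UNIV)"
    and off: "\<And>t x. t \<in> I \<Longrightarrow> t \<ge> T \<or> norm x \<ge> R \<Longrightarrow> \<phi> (t, x) = 0 \<and> \<phi>' (t, x) (0, axis i 1) = 0"
    using C unfolding C1_data_def by auto
  have pos: "\<And>t. t \<in> I \<Longrightarrow> t \<ge> 0" and T0: "T \<ge> 0" using I T unfolding time_interval_def by auto
  define h where "h z = indicator (I \<times> UNIV) z *\<^sub>R (w z * \<phi> z)" for z
  define h' where "h' z = indicator (I \<times> UNIV) z *\<^sub>R (w z * \<phi>' z (0, axis i 1) + w' z * \<phi> z)" for z
  have c1: "continuous_on (I \<times> UNIV) (\<lambda>z. w z * \<phi> z)"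
    by (intro continuous_intros w C1_data_continuous[OF C])
  have c2: "continuous_on (I \<times> UNIV) (\<lambda>z. w z * \<phi>' z (0, axis i 1) + w' z * \<phi> z)"
    by (intro continuous_intros w w' c C1_data_continuous[OF C])
  obtain B1 where B1: "B1 > 0" "\<And>z. z \<in> I \<times> UNIV \<Longrightarrow> \<bar>w z * \<phi> z\<bar> \<le> B1"
    using continuous_on_bounded_support[OF I T c1, of R] off by auto
  obtain B2 where B2: "B2 > 0" "\<And>z. z \<in> I \<times> UNIV \<Longrightarrow> \<bar>w z * \<phi>' z (0, axis i 1) + w' z * \<phi> z\<bar> \<le> B2"
    using continuous_on_bounded_support[OF I T c2, of R] off by auto
  have "integral\<^sup>L (lebesgue_on (I \<times> UNIV)) (\<lambda>z. w z * \<phi>' z (0, axis i 1) + w' z * \<phi> z) = integral\<^sup>L lborel h'"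
    unfolding h'_def by (rule integral_domain_eq_lborel(1)[OF I c2])
  also have "\<dots> = 0"
  proof (rule integral_directional_derivative_eq_0[of h "(0, axis i 1)" h' B1 B2 "T + R"])
    show "h \<in> borel_measurable borel" unfolding h_def
      using borel_measurable_continuous_on_indicator[OF time_interval_domain_sets[OF I] c1] by simp
    show "\<bar>h z\<bar> \<le> B1" "\<bar>h' z\<bar> \<le> B2" for z
      using B1 B2 by (auto simp: h_def h'_def indicator_def)
    show "h z = 0" if "norm z \<ge> T + R" for z
    proof (cases "z \<in> I \<times> UNIV")
      case True
      have "norm z \<le> norm (fst z) + norm (snd z)" using norm_Pair_le[of "fst z" "snd z"] by simp
      then have "fst z \<ge> T \<or> norm (snd z) \<ge> R" using that pos True by (auto simp: mem_Times_iff)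
      then show ?thesis using off[of "fst z" "snd z"] True by (auto simp: h_def mem_Times_iff)
    qed (simp add: h_def)
    fix z :: "real \<times> (real^'n)" and s
    obtain t x where z: "z = (t, x)" by force
    show "((\<lambda>s. h (z + s *\<^sub>R (0, axis i 1))) has_real_derivative h' (z + s *\<^sub>R (0, axis i 1))) (at s)"
    proof (cases "t \<in> I")
      case False
      then show ?thesis by (simp add: z h_def h'_def)
    next
      case True
      \<comment> \<open>differentiability is known at parameter 0 only; the base point is moved to \<open>y\<close>\<close>
      define y where "y = x + s *\<^sub>R axis i 1"
      have "((\<lambda>r. \<phi> ((t, y) + r *\<^sub>R (0, axis i 1))) has_vector_derivative \<phi>' (t, y) (0, axis i 1)) (at 0)"
        by (rule line_derivative[OF der]) (use True in auto)
      then have p: "((\<lambda>r. \<phi> (t, y + r *\<^sub>R axis i 1)) has_real_derivative \<phi>' (t, y) (0, axis i 1)) (at 0)"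
        by (simp add: has_real_derivative_iff_has_vector_derivative)
      have "((\<lambda>r. w (t, y + r *\<^sub>R axis i 1) * \<phi> (t, y + r *\<^sub>R axis i 1)) has_real_derivative h' (t, y)) (at 0)"
        using DERIV_mult[OF wd[OF True, of y] p] True by (simp add: h'_def algebra_simps)
      then have "((\<lambda>r. w (t, y + (r - s) *\<^sub>R axis i 1) * \<phi> (t, y + (r - s) *\<^sub>R axis i 1)) has_real_derivative h' (t, y)) (at s)"
        using DERIV_shift[of "\<lambda>r. w (t, y + (r - s) *\<^sub>R axis i 1) * \<phi> (t, y + (r - s) *\<^sub>R axis i 1)" "h' (t, y)" 0 s]
        by simp
      then show ?thesis using True
        by (simp add: z h_def y_def algebra_simps)
    qed
  qed
  finally show ?thesis .
qed

section \<open>Weak formulations and density of smooth test functions\<close>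

text \<open>
  Boundedness on the bounded sets that may carry test functions: \<open>T\<close> is required to belong to \<open>I\<close>, so
  nothing is asserted near an open right endpoint.
\<close>

definition locally_bounded :: "real set \<Rightarrow> (real \<times> (real^'n) \<Rightarrow> real) \<Rightarrow> bool" where
  "locally_bounded I h \<longleftrightarrow> h \<in> borel_measurable (lebesgue_on (I \<times> UNIV)) \<and>
     (\<forall>T\<in>I. \<forall>R. \<exists>B. \<forall>t\<in>I. \<forall>x. t \<le> T \<longrightarrow> norm x \<le> R \<longrightarrow> \<bar>h (t, x)\<bar> \<le> B)"

lemma integrable_locally_bounded_mult:
  fixes h q :: "real \<times> (real^'n) \<Rightarrow> real"
  assumes I: "time_interval I" "T \<in> I" and h: "locally_bounded I h"
    and q: "continuous_on (I \<times> UNIV) q"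
    and off: "\<And>t x. t \<in> I \<Longrightarrow> t \<ge> T \<or> norm x \<ge> R \<Longrightarrow> q (t, x) = 0"
  shows "integrable (lebesgue_on (I \<times> UNIV)) (\<lambda>z. h z * q z)"
proof -
  obtain B1 where B1: "\<And>t x. t \<in> I \<Longrightarrow> t \<le> T \<Longrightarrow> norm x \<le> R \<Longrightarrow> \<bar>h (t, x)\<bar> \<le> B1"
    using h I(2) unfolding locally_bounded_def by blast
  obtain B2 where B2: "B2 > 0" "\<And>z. z \<in> I \<times> UNIV \<Longrightarrow> \<bar>q z\<bar> \<le> B2"
    using continuous_on_bounded_support[OF I q off] by blast
  have qm: "q \<in> borel_measurable (lebesgue_on (I \<times> UNIV))"
    using q I by (intro continuous_imp_measurable_on_sets_lebesgue) auto
  show ?thesis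
  proof (rule integrable_bounded_support[OF I(1), of _ T R "B1 * B2"])
    show "(\<lambda>z. h z * q z) \<in> borel_measurable (lebesgue_on (I \<times> UNIV))"
      using h qm unfolding locally_bounded_def by auto
    show "h (t, x) * q (t, x) = 0" if "t \<in> I" "T \<le> t \<or> R \<le> norm x" for t x
      using off[OF that] by simp
    show "\<bar>h (t, x) * q (t, x)\<bar> \<le> B1 * B2" if "t \<in> I" "t < T" "norm x < R" for t x
      unfolding abs_mult using B1[of t x] B2(2)[of "(t, x)"] that
      by (intro mult_mono) (auto intro: order_trans[OF abs_ge_zero])
  qed
qed

text \<open>
  All expressions in the theorem have this shape: \<open>w\<close> is the density, \<open>b\<close> the flux, \<open>c\<close> the
  zeroth-order term and \<open>w0\<close> the initial density.
\<close>

definition weak_form :: "real set \<Rightarrow> (real \<times> (real^'n) \<Rightarrow> real) \<Rightarrow> ('n \<Rightarrow> real \<times> (real^'n) \<Rightarrow> real) \<Rightarrow>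
    (real \<times> (real^'n) \<Rightarrow> real) \<Rightarrow> (real^'n \<Rightarrow> real) \<Rightarrow>
    (real \<times> (real^'n) \<Rightarrow> real) \<Rightarrow> (real \<times> (real^'n) \<Rightarrow> real \<times> (real^'n) \<Rightarrow> real) \<Rightarrow> real" where
  "weak_form I w b c w0 \<phi> \<phi>' =
     (LINT z|lebesgue_on (I \<times> UNIV). w z * \<phi>' z (1, 0) + (\<Sum>i\<in>UNIV. b i z * \<phi>' z (0, axis i 1)) + c z * \<phi> z)
     + (LINT x|lebesgue. w0 x * \<phi> (0, x))"

lemma C1_dataD:
  assumes "C1_data I T R \<phi> \<phi>'"
  shows "T \<in> I" "R > 0"
    "\<And>z. z \<in> I \<times> UNIV \<Longrightarrow> (\<phi> has_derivative \<phi>' z) (at z within I \<times> UNIV)"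
    "\<And>v. continuous_on (I \<times> UNIV) (\<lambda>z. \<phi>' z v)"
    "\<And>t x. t \<in> I \<Longrightarrow> t \<ge> T \<or> norm x \<ge> R \<Longrightarrow> \<phi> (t, x) = 0"
    "\<And>t x v. t \<in> I \<Longrightarrow> t \<ge> T \<or> norm x \<ge> R \<Longrightarrow> \<phi>' (t, x) v = 0"
    "continuous_on (I \<times> UNIV) \<phi>"
  using assms C1_data_continuous[OF assms] unfolding C1_data_def by blast+

lemma initial_trace_continuous:
  assumes "time_interval I" "C1_data I T R \<phi> \<phi>'"
  shows "continuous_on UNIV (\<lambda>x. \<phi> (0, x))"
  by (rule continuous_on_compose2[OF C1_dataD(7)[OF assms(2)], of _ "\<lambda>x. (0, x)"])
    (use assms(1) in \<open>auto intro!: continuous_intros simp: time_interval_def\<close>)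

lemma weak_form_tendsto:
  fixes \<phi> :: "real \<times> (real^'n) \<Rightarrow> real"
  assumes I: "time_interval I"
    and w: "locally_bounded I w" and b: "\<And>i. locally_bounded I (b i)" and c: "locally_bounded I c"
    and w0: "w0 \<in> borel_measurable lebesgue" "\<And>x. \<bar>w0 x\<bar> \<le> C"
    and n: "\<And>n. C1_data I T R (\<phi>n n) (\<phi>n' n)" and \<phi>: "C1_data I T R \<phi> \<phi>'"
    and lim: "\<And>z. z \<in> I \<times> UNIV \<Longrightarrow> (\<lambda>n. \<phi>n n z) \<longlonglongrightarrow> \<phi> z"
    and lim': "\<And>z v. z \<in> I \<times> UNIV \<Longrightarrow> (\<lambda>n. \<phi>n' n z v) \<longlonglongrightarrow> \<phi>' z v"
    and B: "\<And>n z. z \<in> I \<times> UNIV \<Longrightarrow> \<bar>\<phi>n n z\<bar> \<le> B"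
    and B': "\<And>n z v. z \<in> I \<times> UNIV \<Longrightarrow> \<bar>\<phi>n' n z v\<bar> \<le> B' v"
  shows "(\<lambda>n. weak_form I w b c w0 (\<phi>n n) (\<phi>n' n)) \<longlonglongrightarrow> weak_form I w b c w0 \<phi> \<phi>'"
proof -
  let ?M = "lebesgue_on (I \<times> (UNIV :: (real^'n) set))"
  note S = time_interval_domain_lebesgue[OF I, where 'n='n]
  have I0: "0 \<in> I" using I unfolding time_interval_def by auto
  have T: "T \<in> I" using C1_dataD(1)[OF \<phi>] .
  have cm: "q \<in> borel_measurable ?M" if "continuous_on (I \<times> UNIV) q" for q :: "real \<times> (real^'n) \<Rightarrow> real"
    using that S by (rule continuous_imp_measurable_on_sets_lebesgue)
  have lb: "\<exists>K. \<forall>t\<in>I. \<forall>x. t \<le> T \<longrightarrow> norm x \<le> R \<longrightarrow> \<bar>h (t, x)\<bar> \<le> K" if "locally_bounded I h" for h :: "real \<times> (real^'n) \<Rightarrow> real"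
    using that T unfolding locally_bounded_def by blast
  \<comment> \<open>each summand converges by dominated convergence\<close>
  have *: "(\<lambda>n. LINT z|?M. h z * q n z) \<longlonglongrightarrow> (LINT z|?M. h z * q' z)"
    and int: "integrable ?M (\<lambda>z. h z * q' z)" "\<And>n. integrable ?M (\<lambda>z. h z * q n z)"
    if h: "locally_bounded I h" and qc: "\<And>n. continuous_on (I \<times> UNIV) (q n)" "continuous_on (I \<times> UNIV) q'"
      and off: "\<And>n t x. t \<in> I \<Longrightarrow> t \<ge> T \<or> norm x \<ge> R \<Longrightarrow> q n (t, x) = 0"
        "\<And>t x. t \<in> I \<Longrightarrow> t \<ge> T \<or> norm x \<ge> R \<Longrightarrow> q' (t, x) = 0"
      and ql: "\<And>z. z \<in> I \<times> UNIV \<Longrightarrow> (\<lambda>n. q n z) \<longlonglongrightarrow> q' z"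
      and qB: "\<And>n z. z \<in> I \<times> UNIV \<Longrightarrow> \<bar>q n z\<bar> \<le> K"
    for h q' :: "real \<times> (real^'n) \<Rightarrow> real" and q :: "nat \<Rightarrow> real \<times> (real^'n) \<Rightarrow> real" and K :: real
  proof -
    show "integrable ?M (\<lambda>z. h z * q' z)" "integrable ?M (\<lambda>z. h z * q n z)" for n
      using integrable_locally_bounded_mult[OF I T h] qc off by blast+
    have hm: "h \<in> borel_measurable ?M" using h unfolding locally_bounded_def by blast
    obtain L where L: "\<And>t x. t \<in> I \<Longrightarrow> t \<le> T \<Longrightarrow> norm x \<le> R \<Longrightarrow> \<bar>h (t, x)\<bar> \<le> L"
      using lb[OF h] by blast
    define D where "D z = (if fst z < T \<and> norm (snd z) < R then \<bar>h z\<bar> * K else 0)" for z :: "real \<times> (real^'n)"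
    have Dm: "D \<in> borel_measurable ?M"
    proof -
      have "fst \<in> borel_measurable ?M" "snd \<in> borel_measurable ?M"
        by (intro continuous_imp_measurable_on_sets_lebesgue continuous_intros S)+
      then show ?thesis unfolding D_def using hm by measurable
    qed
    have Di: "integrable ?M D"
    proof (rule integrable_bounded_support[OF I Dm, of T R "L * K"])
      show "D (t, x) = 0" if "t \<in> I" "T \<le> t \<or> R \<le> norm x" for t x
        using that by (auto simp: D_def)
      fix t and x :: "real^'n" assume t: "t \<in> I" "t < T" "norm x < R"
      have "K \<ge> 0" using qB[of "(t, x)" 0] t by simp
      then show "\<bar>D (t, x)\<bar> \<le> L * K"
        using t L[of t x] by (auto simp: D_def abs_mult intro!: mult_right_mono)
    qed
    show "(\<lambda>n. LINT z|?M. h z * q n z) \<longlonglongrightarrow> (LINT z|?M. h z * q' z)"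
    proof (rule integral_dominated_convergence[OF _ _ Di])
      show "(\<lambda>z. h z * q' z) \<in> borel_measurable ?M" "(\<lambda>z. h z * q n z) \<in> borel_measurable ?M" for n
        using hm cm[OF qc(2)] cm[OF qc(1)] by auto
      show "AE z in ?M. (\<lambda>n. h z * q n z) \<longlonglongrightarrow> h z * q' z"
        using ql by (auto intro!: AE_I2 tendsto_mult_left)
      show "AE z in ?M. norm (h z * q n z) \<le> D z" for n
      proof (rule AE_I2)
        fix z assume z: "z \<in> space ?M"
        show "norm (h z * q n z) \<le> D z"
        proof (cases "fst z < T \<and> norm (snd z) < R")
          case True
          then show ?thesis using qB[of z n] z by (auto simp: D_def abs_mult intro!: mult_left_mono)
        next
          case False
          then show ?thesis using off(1)[of "fst z" "snd z" n] z by (auto simp: D_def)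
        qed
      qed
    qed
  qed
  note n' = C1_dataD[OF n] and p = C1_dataD[OF \<phi>]
  have c1: "(\<lambda>n. LINT z|?M. w z * \<phi>n' n z v) \<longlonglongrightarrow> (LINT z|?M. w z * \<phi>' z v)"
    and i1: "integrable ?M (\<lambda>z. w z * \<phi>' z v)" "integrable ?M (\<lambda>z. w z * \<phi>n' n z v)" for v n
    by (rule *[OF w n'(4) p(4) n'(6) p(6) lim' B'] int[OF w n'(4) p(4) n'(6) p(6) lim' B']; assumption)+
  have c2: "(\<lambda>n. LINT z|?M. b i z * \<phi>n' n z v) \<longlonglongrightarrow> (LINT z|?M. b i z * \<phi>' z v)"
    and i2: "integrable ?M (\<lambda>z. b i z * \<phi>' z v)" "integrable ?M (\<lambda>z. b i z * \<phi>n' n z v)" for i v n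
    by (rule *[OF b n'(4) p(4) n'(6) p(6) lim' B'] int[OF b n'(4) p(4) n'(6) p(6) lim' B']; assumption)+
  note c3 = *[OF c n'(7) p(7) n'(5) p(5) lim B]
  note i3 = int[OF c n'(7) p(7) n'(5) p(5) lim B]
  have c4: "(\<lambda>n. LINT x|lebesgue. w0 x * \<phi>n n (0, x)) \<longlonglongrightarrow> (LINT x|lebesgue. w0 x * \<phi> (0, x))"
  proof (rule integral_dominated_convergence[where w="\<lambda>x. C * B * indicator (ball 0 R) x"])
    have m: "(\<lambda>x. q (0, x)) \<in> borel_measurable lebesgue" if "C1_data I T R q q'" for q q'
      using initial_trace_continuous[OF I that] by (intro measurable_completion) (simp add: borel_measurable_continuous_onI)
    show "(\<lambda>x. w0 x * \<phi> (0, x)) \<in> borel_measurable lebesgue" "(\<lambda>x. w0 x * \<phi>n n (0, x)) \<in> borel_measurable lebesgue" for n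
      using w0(1) m[OF \<phi>] m[OF n] by auto
    have "ball (0::real^'n) R \<in> lmeasurable" by simp
    then show "integrable lebesgue (\<lambda>x::real^'n. C * B * indicator (ball 0 R) x)"
      by (intro integrable_mult_right integrable_real_indicator) (auto simp: fmeasurable_def)
    show "AE x in lebesgue. (\<lambda>n. w0 x * \<phi>n n (0, x)) \<longlonglongrightarrow> w0 x * \<phi> (0, x)"
      using lim I0 by (auto intro!: tendsto_mult_left)
    show "AE x in lebesgue. norm (w0 x * \<phi>n n (0, x)) \<le> C * B * indicator (ball 0 R) x" for n
    proof (rule AE_I2)
      fix x
      show "norm (w0 x * \<phi>n n (0, x)) \<le> C * B * indicator (ball 0 R) x"
      proof (cases "norm x < R")
        case True
        have "\<bar>w0 x\<bar> * \<bar>\<phi>n n (0, x)\<bar> \<le> C * B"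
          using w0(2)[of x] B[of "(0, x)" n] I0 by (intro mult_mono) (auto intro: order_trans[OF abs_ge_zero])
        then show ?thesis using True by (simp add: abs_mult)
      next
        case False
        then show ?thesis using n'(5)[OF I0, of x n] by simp
      qed
    qed
  qed
  have s: "integrable ?M (\<lambda>z. \<Sum>i\<in>UNIV. b i z * \<phi>n' n z (0, axis i 1))" "integrable ?M (\<lambda>z. \<Sum>i\<in>UNIV. b i z * \<phi>' z (0, axis i 1))" for n
    using i2 by (auto intro: Bochner_Integration.integrable_sum)
  have "(\<lambda>n. (LINT z|?M. w z * \<phi>n' n z (1, 0)) + (\<Sum>i\<in>UNIV. LINT z|?M. b i z * \<phi>n' n z (0, axis i 1)) + (LINT z|?M. c z * \<phi>n n z)
     + (LINT x|lebesgue. w0 x * \<phi>n n (0, x))) \<longlonglongrightarrow>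
     (LINT z|?M. w z * \<phi>' z (1, 0)) + (\<Sum>i\<in>UNIV. LINT z|?M. b i z * \<phi>' z (0, axis i 1)) + (LINT z|?M. c z * \<phi> z)
     + (LINT x|lebesgue. w0 x * \<phi> (0, x))"
    by (intro tendsto_add tendsto_sum c1 c2 c3 c4)
  then show ?thesis unfolding weak_form_def
    using s i1 i2 i3 by (simp add: Bochner_Integration.integral_add Bochner_Integration.integral_sum)
qed

text \<open>
  Extension by 0 to the times beyond \<open>I\<close>, where \<open>T < sup I\<close> leaves an overlap of the two regions on
  which \<open>\<phi>\<close> is differentiable.
\<close>

lemma C1_data_extend:
  fixes \<phi> :: "real \<times> (real^'n) \<Rightarrow> real"
  assumes I: "time_interval I" and C: "C1_data I T R \<phi> \<phi>'"
  shows "C1_data {0..} T R (\<lambda>z. if fst z \<in> I then \<phi> z else 0) (\<lambda>z v. if fst z \<in> I then \<phi>' z v else 0)"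
proof -
  define q where "q z = (if fst z \<in> I then \<phi> z else 0)" for z
  define q' where "q' z v = (if fst z \<in> I then \<phi>' z v else 0)" for z v
  let ?S = "{0::real..} \<times> (UNIV :: (real^'n) set)"
  note D = C1_dataD[OF C]
  have pos: "\<And>t. t \<in> I \<Longrightarrow> t \<ge> 0" using I unfolding time_interval_def by auto
  obtain X where X: "open X" "I = {0..} \<inter> X"
    using I unfolding time_interval_def by (metis Int_UNIV_right atLeastLessThan_def lessThan_def open_UNIV open_lessThan)
  have beyond: "q z = 0" "q' z v = 0" if "fst z > T" for z v
    using D(5,6)[of "fst z" "snd z"] that by (auto simp: q_def q'_def)
  have loc: "at z within ?S = at z within ?S \<inter> U" if "open U" "z \<in> U" for z U
    using that by (intro at_within_nhd[of z U]) auto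
  have "(q has_derivative q' z) (at z within ?S) \<and> continuous (at z within ?S) (\<lambda>z. q' z v)" if z: "z \<in> ?S" for z v
  proof (cases "fst z \<in> I")
    case True
    have eq: "at z within ?S = at z within I \<times> UNIV"
      using loc[of "X \<times> UNIV" z] X True by (auto simp: open_Times mem_Times_iff Times_Int_Times)
    have zi: "z \<in> I \<times> UNIV" using True by (simp add: mem_Times_iff)
    have "(q has_derivative \<phi>' z) (at z within I \<times> UNIV)"
      by (rule has_derivative_transform[OF zi _ D(3)[OF zi]]) (auto simp: q_def)
    moreover have "continuous_on (I \<times> UNIV) (\<lambda>z. q' z v)"
      by (rule continuous_on_eq[OF D(4)[of v]]) (auto simp: q'_def)
    moreover have "q' z = \<phi>' z" using True by (auto simp: q'_def)
    ultimately show ?thesis unfolding eq using zi continuous_on_eq_continuous_within by metis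
  next
    case False
    then have "fst z > T" using z D(1) I unfolding time_interval_def by (auto simp: mem_Times_iff)
    have "open ({T<..} \<times> (UNIV :: (real^'n) set))" by (intro open_Times) auto
    then have eq: "at z within ?S = at z within ?S \<inter> {T<..} \<times> UNIV"
      by (rule loc) (use \<open>fst z > T\<close> in \<open>simp add: mem_Times_iff\<close>)
    have zi: "z \<in> ?S \<inter> {T<..} \<times> UNIV" using z \<open>fst z > T\<close> by (auto simp: mem_Times_iff)
    have "(q has_derivative (\<lambda>v. 0)) (at z within ?S \<inter> {T<..} \<times> UNIV)"
      by (rule has_derivative_transform[OF zi _ has_derivative_const[of 0]]) (use beyond in auto)
    moreover have "continuous_on (?S \<inter> {T<..} \<times> UNIV) (\<lambda>z. q' z v)"
    proof (rule continuous_on_eq[OF continuous_on_const[of _ 0]])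
      fix y assume "y \<in> ?S \<inter> {T<..} \<times> UNIV"
      then show "0 = q' y v" using beyond(2)[of y v] by (simp add: mem_Times_iff)
    qed
    moreover have "q' z = (\<lambda>v. 0)" using False by (auto simp: q'_def)
    ultimately show ?thesis unfolding eq using zi continuous_on_eq_continuous_within by metis
  qed
  then have "C1_data {0..} T R q q'"
    unfolding C1_data_def continuous_on_eq_continuous_within
    using D(1,2,5,6) pos by (auto simp: q_def q'_def)
  then show ?thesis by (simp add: q_def[abs_def] q'_def[abs_def])
qed

text \<open>
  The mollifications of the extended function are smooth, have a common support box and common bounds,
  and converge pointwise together with their first derivatives.
\<close>

lemma weak_form_density:
  fixes \<phi> :: "real \<times> (real^'n) \<Rightarrow> real"
  assumes I: "time_interval I"
    and w: "locally_bounded I w" and b: "\<And>i. locally_bounded I (b i)" and c: "locally_bounded I c"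
    and w0: "w0 \<in> borel_measurable lebesgue" "\<And>x. \<bar>w0 x\<bar> \<le> C"
    and smooth: "\<And>\<psi> T R \<psi>'. \<psi> \<in> test_fun I \<Longrightarrow> C1_data I T R \<psi> \<psi>' \<Longrightarrow> weak_form I w b c w0 \<psi> \<psi>' = 0"
    and \<phi>: "C1_data I T R \<phi> \<phi>'"
  shows "weak_form I w b c w0 \<phi> \<phi>' = 0"
proof -
  define q where "q z = (if fst z \<in> I then \<phi> z else 0)" for z
  define q' where "q' z v = (if fst z \<in> I then \<phi>' z v else 0)" for z v
  let ?S = "{0::real..} \<times> (UNIV :: (real^'n) set)"
  have q: "C1_data {0..} T R q q'"
    using C1_data_extend[OF I \<phi>] by (simp add: q_def[abs_def] q'_def[abs_def])
  note D = C1_dataD[OF q]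
  have I1: "time_interval {0..}" unfolding time_interval_def by simp
  have T: "T \<in> I" using C1_dataD(1)[OF \<phi>] .
  have sub: "I \<times> UNIV \<subseteq> ?S" using I unfolding time_interval_def by auto
  have fst_nonneg: "fst w \<ge> 0" if "w \<in> cbox 0 (One :: real \<times> (real^'n))" for w
  proof -
    have "(1, 0) \<in> (Basis :: (real \<times> (real^'n)) set)" by (auto simp: Basis_prod_def)
    then have "0 \<bullet> (1::real, 0::real^'n) \<le> w \<bullet> (1, 0)" using that unfolding mem_box by blast
    then show ?thesis by (simp add: inner_prod_def)
  qed
  have fc: "forward_closed ?S" unfolding forward_closed_def
  proof (intro ballI allI impI)
    fix z w :: "real \<times> (real^'n)" and e :: real
    assume "z \<in> ?S" "w \<in> cbox 0 One" "0 < e"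
    then show "z + e *\<^sub>R w \<in> ?S" using fst_nonneg[of w] by (simp add: mem_Times_iff)
  qed
  have cv: "convex ?S" by (intro convex_Times) auto
  obtain N where N: "N > 0" "\<And>w. w \<in> cbox 0 (One :: real \<times> (real^'n)) \<Longrightarrow> norm w \<le> N"
    using bounded_cbox[of 0 "One :: real \<times> (real^'n)"] bounded_pos by blast
  have "\<exists>K. \<forall>z\<in>?S. \<bar>q z\<bar> \<le> K"
    by (rule continuous_on_bounded_support[OF I1 D(1) D(7) D(5)]) blast+
  then obtain B where B: "\<And>z. z \<in> ?S \<Longrightarrow> \<bar>q z\<bar> \<le> B" by metis
  have "\<exists>K. \<forall>z\<in>?S. \<bar>q' z v\<bar> \<le> K" for v
    by (rule continuous_on_bounded_support[OF I1 D(1) D(4)[of v] D(6)]) blast+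
  then obtain B' where B': "\<And>z v. z \<in> ?S \<Longrightarrow> \<bar>q' z v\<bar> \<le> B' v" by metis
  define e where "e n = 1 / real (Suc n)" for n
  have e: "e n > 0" "e n \<le> 1" for n by (auto simp: e_def)
  define \<psi> where "\<psi> n = mollify (e n) q" for n
  define \<psi>' where "\<psi>' n z v = mollify (e n) (\<lambda>z. q' z v) z" for n z v
  \<comment> \<open>a closed box in the time half space that contains the support\<close>
  let ?a = "(0, - R *\<^sub>R One) :: real \<times> (real^'n)" and ?b = "(T, R *\<^sub>R One) :: real \<times> (real^'n)"
  have box: "cbox ?a ?b \<subseteq> ?S" by (auto simp: cbox_Pair_eq)
  have outside: "fst y \<ge> T \<or> norm (snd y) \<ge> R" if "y \<in> ?S - cbox ?a ?b" for y
  proof (rule ccontr)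
    assume "\<not> ?thesis"
    then have y: "fst y < T" "norm (snd y) < R" by auto
    have "\<bar>snd y \<bullet> i\<bar> \<le> R" if "i \<in> Basis" for i using Basis_le_norm[OF that, of "snd y"] y by simp
    then have "snd y \<in> cbox (- R *\<^sub>R One) (R *\<^sub>R One)" by (auto simp: mem_box abs_le_iff inner_simps) (metis minus_le_iff)
    moreover have "fst y \<in> cbox 0 T" using that y by (auto simp: mem_Times_iff)
    ultimately show False using that by (auto simp: cbox_Pair_eq mem_Times_iff)
  qed
  have q0: "q y = 0" "q' y v = 0" if "y \<in> ?S - cbox ?a ?b" for y v
    using outside[OF that] D(5,6)[of "fst y" "snd y"] that by (auto simp: mem_Times_iff)
  have smooth_\<psi>: "Ck_on k ?S (\<psi> n)" for k n unfolding \<psi>_def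
    by (rule Ck_on_mollify[OF fc e(1) continuous_on_subset[OF D(7) box]]) (use q0 in auto)
  have cont_\<psi>': "continuous_on ?S (\<lambda>z. \<psi>' n z v)" for n v
    using Ck_on_mollify[OF fc e(1) continuous_on_subset[OF D(4) box], of v 0 n] q0 by (simp add: \<psi>'_def)
  have der: "(\<psi> n has_derivative \<psi>' n z) (at z within ?S)" if "z \<in> ?S" for n z
    unfolding \<psi>_def \<psi>'_def[abs_def] by (rule has_derivative_mollify[OF fc cv that e(1) D(3,4)])
  have vanish: "\<psi> n (t, x) = 0 \<and> \<psi>' n (t, x) v = 0" if t: "t \<in> I" and o: "t \<ge> T \<or> norm x \<ge> R + N" for n t x v
  proof -
    have "q ((t, x) + e n *\<^sub>R w) = 0 \<and> q' ((t, x) + e n *\<^sub>R w) v = 0" if w: "w \<in> cbox 0 One" for w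
    proof -
      have S': "(t, x) + e n *\<^sub>R w \<in> ?S"
      proof -
        have "(t, x) \<in> ?S" using sub t by blast
        then show ?thesis using fc w e(1)[of n] unfolding forward_closed_def by blast
      qed
      have "fst w \<ge> 0" using w by (rule fst_nonneg)
      then have 1: "fst ((t, x) + e n *\<^sub>R w) \<ge> t" using e[of n] by simp
      have "norm (e n *\<^sub>R snd w) \<le> N"
      proof -
        have "norm (snd w) \<le> N" using N(2)[OF w] norm_snd_le[of "snd w" "fst w"] by simp
        then show ?thesis using e[of n] mult_mono[of "e n" 1 "norm (snd w)" N] by simp
      qed
      \<comment> \<open>averaging displaces a point in space by at most \<open>N\<close>, and in time only forward\<close>
      then have 2: "norm (snd ((t, x) + e n *\<^sub>R w)) \<ge> norm x - N"
        using norm_triangle_ineq2[of x "- (e n *\<^sub>R snd w)"] by simp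
      have "fst ((t, x) + e n *\<^sub>R w) \<ge> T \<or> norm (snd ((t, x) + e n *\<^sub>R w)) \<ge> R" using 1 2 o by linarith
      then show ?thesis using D(5,6)[of "fst ((t, x) + e n *\<^sub>R w)" "snd ((t, x) + e n *\<^sub>R w)"] S'
        by (metis mem_Times_iff prod.collapse)
    qed
    then have "mollify (e n) q (t, x) = integral (cbox 0 (One :: real \<times> (real^'n))) (\<lambda>w. 0)"
      "mollify (e n) (\<lambda>z. q' z v) (t, x) = integral (cbox 0 (One :: real \<times> (real^'n))) (\<lambda>w. 0)"
      unfolding mollify_def by (intro integral_cong; simp only: mult_zero_right)+
    then show ?thesis by (simp add: \<psi>_def \<psi>'_def)
  qed
  have data: "C1_data I T (R + N) (\<psi> n) (\<psi>' n)" for n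
    unfolding C1_data_def
  proof (intro conjI ballI allI impI)
    show "(\<psi> n has_derivative \<psi>' n z) (at z within I \<times> UNIV)" if "z \<in> I \<times> UNIV" for z
      using der[of z n] that sub by (blast intro: has_derivative_subset)
    show "continuous_on (I \<times> UNIV) (\<lambda>z. \<psi>' n z v)" for v
      using cont_\<psi>' sub by (rule continuous_on_subset)
  qed (use T D(2) N(1) vanish in auto)
  have \<phi>2: "C1_data I T (R + N) \<phi> \<phi>'"
    using \<phi> N(1) unfolding C1_data_def by auto
  have tf: "\<psi> n \<in> test_fun I" for n
  proof -
    have "compact_support_on I (\<psi> n)"
      by (rule compact_support_onI[OF I T, of _ "R + N"]) (use vanish in force)
    then show ?thesis unfolding test_fun_def using Ck_on_subset[OF smooth_\<psi> sub] by simp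
  qed
  have qI: "q z = \<phi> z" "q' z v = \<phi>' z v" if "z \<in> I \<times> UNIV" for z v
    using that by (auto simp: q_def q'_def)
  have "(\<lambda>n. weak_form I w b c w0 (\<psi> n) (\<psi>' n)) \<longlonglongrightarrow> weak_form I w b c w0 \<phi> \<phi>'"
  proof (rule weak_form_tendsto[OF I w b c w0 data \<phi>2, where B=B and B'=B'])
    fix n v and z :: "real \<times> (real^'n)" assume z: "z \<in> I \<times> UNIV"
    then have zS: "z \<in> ?S" using sub by blast
    show "(\<lambda>n. \<psi> n z) \<longlonglongrightarrow> \<phi> z" "(\<lambda>n. \<psi>' n z v) \<longlonglongrightarrow> \<phi>' z v"
      using mollify_tendsto[OF fc D(7) zS] mollify_tendsto[OF fc D(4) zS, of v] qI[OF z]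
      by (simp_all add: \<psi>_def \<psi>'_def e_def)
    show "\<bar>\<psi> n z\<bar> \<le> B" "\<bar>\<psi>' n z v\<bar> \<le> B' v"
      unfolding \<psi>_def \<psi>'_def using mollify_bound[OF fc D(7) zS e(1)] mollify_bound[OF fc D(4) zS e(1)] B B' by blast+
  qed
  then have "(\<lambda>n. 0) \<longlonglongrightarrow> weak_form I w b c w0 \<phi> \<phi>'" using smooth[OF tf data] by simp
  then show ?thesis using LIMSEQ_unique[OF _ tendsto_const] by metis
qed

section \<open>Initial data of weak inequalities\<close>

text \<open>
  An open set is a countable union of boxes, and \<open>1 - \<Prod> (1 - bump)\<^sup>n\<close> over the first \<open>n\<close> boxes tends to 1 on
  their union.
\<close>

lemma open_bounded_smooth_approximation:
  fixes U :: "'a::euclidean_space set"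
  assumes "open U"
  obtains \<psi> :: "nat \<Rightarrow> 'a \<Rightarrow> real" where "\<And>n k. Ck_on k UNIV (\<psi> n)"
    "\<And>n x. 0 \<le> \<psi> n x" "\<And>n x. \<psi> n x \<le> 1" "\<And>n x. x \<notin> U \<Longrightarrow> \<psi> n x = 0"
    "\<And>x. (\<lambda>n. \<psi> n x) \<longlonglongrightarrow> indicator U x"
proof (cases "U = {}")
  case True
  show thesis by (rule that[of "\<lambda>n x. 0"]) (auto simp: True)
next
  case False
  obtain D where D: "countable D" "D \<subseteq> Pow U" "\<And>X. X \<in> D \<Longrightarrow> \<exists>a b. X = box a b" "\<Union>D = U"
    using open_countable_Union_open_box[OF assms] by blast
  then have "D \<noteq> {}" using False by auto
  then have D': "\<And>j. from_nat_into D j \<in> D" "\<And>X. X \<in> D \<Longrightarrow> \<exists>j. from_nat_into D j = X"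
    using D(1) from_nat_into from_nat_into_surj by metis+
  have "\<forall>j. \<exists>a b. from_nat_into D j = box a b" using D(3) D'(1) by blast
  then obtain a b where ab: "\<And>j. from_nat_into D j = box (a j) (b j)" by metis
  define p where "p j = box_bump (a j) (b j)" for j :: nat
  define \<psi> where "\<psi> n x = 1 - (\<Prod>j<n. (1 - p j x) ^ n)" for n :: nat and x
  have p01: "0 \<le> p j x" "p j x \<le> 1" for j x using box_bump_bounds by (auto simp: p_def)
  have prod01: "0 \<le> (\<Prod>j<n. (1 - p j x) ^ n)" "(\<Prod>j<n. (1 - p j x) ^ n) \<le> 1" for n x
    using p01 by (auto intro!: prod_nonneg prod_le_1 power_le_one)
  have out: "p j x = 0" if "x \<notin> U" for j x
    using that ab[of j] D'(1)[of j] D(4) by (auto simp: p_def box_bump_eq_0_iff)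
  show thesis
  proof (rule that[of \<psi>])
    show "Ck_on k UNIV (\<psi> n)" for n k
      unfolding \<psi>_def p_def by (intro Ck_on_diff Ck_on_prod Ck_on_power Ck_on_const Ck_on_box_bump)
    show "0 \<le> \<psi> n x" "\<psi> n x \<le> 1" for n x using prod01 by (auto simp: \<psi>_def)
    show "\<psi> n x = 0" if "x \<notin> U" for n x using out[OF that] by (simp add: \<psi>_def)
    show "(\<lambda>n. \<psi> n x) \<longlonglongrightarrow> indicator U x" for x
    proof (cases "x \<in> U")
      case True
      then obtain j where "x \<in> box (a j) (b j)" using D(4) D'(2) ab by (metis UnionE)
      then have pos: "p j x > 0" by (simp add: p_def box_bump_pos_iff)
      have lim: "(\<lambda>n. (1 - p j x) ^ n) \<longlonglongrightarrow> 0"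
        using pos p01[of j x] by (intro LIMSEQ_power_zero) auto
      have "(\<lambda>n. \<Prod>i<n. (1 - p i x) ^ n) \<longlonglongrightarrow> 0"
      proof (rule tendsto_sandwich[OF _ _ tendsto_const lim])
        show "\<forall>\<^sub>F n in sequentially. 0 \<le> (\<Prod>i<n. (1 - p i x) ^ n)" using prod01 by simp
        show "\<forall>\<^sub>F n in sequentially. (\<Prod>i<n. (1 - p i x) ^ n) \<le> (1 - p j x) ^ n"
          using eventually_gt_at_top[of j]
        proof eventually_elim
          case (elim n)
          have "(\<Prod>i<n. (1 - p i x) ^ n) = (1 - p j x) ^ n * (\<Prod>i\<in>{..<n} - {j}. (1 - p i x) ^ n)"
            using elim by (subst prod.remove[of _ j]) auto
          also have "\<dots> \<le> (1 - p j x) ^ n * 1"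
            using p01 by (intro mult_left_mono prod_le_1) (auto intro!: power_le_one)
          finally show ?case by simp
        qed
      qed
      then have "(\<lambda>n. 1 - (\<Prod>i<n. (1 - p i x) ^ n)) \<longlonglongrightarrow> 1 - 0" by (intro tendsto_intros)
      then show ?thesis using True by (simp add: \<psi>_def)
    next
      case False
      then show ?thesis using out[OF False] by (simp add: \<psi>_def)
    qed
  qed
qed

text \<open>
  The bounded part \<open>A\<close> of the set where \<open>w\<close> is positive is approximated from outside by open sets up to
  arbitrarily small measure.  Hence the integral of \<open>w\<close> over \<open>A\<close> is at most 0, and \<open>A\<close> is null.
\<close>

lemma AE_nonpos_if_integral_open_nonpos:
  fixes w :: "'a::euclidean_space \<Rightarrow> real"
  assumes w: "w \<in> borel_measurable lebesgue" and C: "\<And>x. \<bar>w x\<bar> \<le> C"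
    and nonpos: "\<And>U. open U \<Longrightarrow> bounded U \<Longrightarrow> (LINT x|lebesgue. indicator U x * w x) \<le> 0"
  shows "AE x in lebesgue. w x \<le> 0"
proof -
  have C0: "C \<ge> 0" using C[of undefined] by linarith
  have int: "integrable lebesgue (\<lambda>x. indicator A x * w x)" if "A \<in> sets lebesgue" "A \<subseteq> ball 0 r" for A r
    using that w C C0 by (intro integrable_bounded_support_lebesgue[of _ r C])
      (auto simp: indicator_def abs_mult split: if_splits)
  have "AE x in lebesgue. norm x < real k \<longrightarrow> w x \<le> 0" for k :: nat
  proof -
    define A where "A = {x \<in> space lebesgue. w x > 0} \<inter> ball 0 (real k)"
    have A: "A \<in> sets lebesgue"
  proof -
    have "{x \<in> space lebesgue. w x > 0} \<in> sets lebesgue" using w by measurable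
    moreover have "ball (0::'a) (real k) \<in> sets lebesgue" by simp
    ultimately show ?thesis unfolding A_def by (rule sets.Int)
  qed
    have Ab: "A \<subseteq> ball 0 (real k)" unfolding A_def by blast
    have le: "(LINT x|lebesgue. indicator A x * w x) \<le> C * e" if e: "e > 0" for e
    proof -
      obtain V where V: "open V" "A \<subseteq> V" "V - A \<in> lmeasurable" "emeasure lebesgue (V - A) < ennreal e"
        using sets_lebesgue_outer_open[OF A e] by blast
      define U where "U = V \<inter> ball 0 (real k)"
      have U: "open U" "A \<subseteq> U" "U \<subseteq> ball 0 (real k)" using V Ab by (auto simp: U_def)
      have Us: "U \<in> sets lebesgue" using U(1) by simp
      have sub: "U - A \<subseteq> V - A" unfolding U_def by blast
      have UAs: "U - A \<in> sets lebesgue" using Us A by (rule sets.Diff)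
      have UA: "U - A \<in> lmeasurable" by (rule fmeasurableI2[OF V(3) sub UAs])
      have "measure lebesgue (U - A) \<le> measure lebesgue (V - A)"
        by (rule measure_mono_fmeasurable[OF sub UAs V(3)])
      also have "\<dots> \<le> e"
        using V(4) e unfolding emeasure_eq_measure2[OF V(3)] by (simp add: ennreal_less_iff)
      finally have m: "measure lebesgue (U - A) \<le> e" .
      have i1: "integrable lebesgue (\<lambda>x. indicator A x * w x)" using int[OF A Ab] .
      have i2: "integrable lebesgue (\<lambda>x. indicator (U - A) x * w x)"
        using U by (intro int[of _ "real k"] sets.Diff Us A) auto
      have "(LINT x|lebesgue. indicator U x * w x) = (LINT x|lebesgue. indicator A x * w x + indicator (U - A) x * w x)"
        using U(2) by (intro Bochner_Integration.integral_cong) (auto simp: indicator_def)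
      also have "\<dots> = (LINT x|lebesgue. indicator A x * w x) + (LINT x|lebesgue. indicator (U - A) x * w x)"
        by (rule Bochner_Integration.integral_add[OF i1 i2])
      finally have "(LINT x|lebesgue. indicator A x * w x) \<le> - (LINT x|lebesgue. indicator (U - A) x * w x)"
        using nonpos[OF U(1) bounded_subset[OF bounded_ball U(3)]] by linarith
      also have "\<dots> \<le> \<bar>LINT x|lebesgue. indicator (U - A) x * w x\<bar>" by linarith
      also have "\<dots> \<le> (LINT x|lebesgue. C * indicator (U - A) x)"
      proof (rule integral_abs_bound_integral[OF i2])
        show "integrable lebesgue (\<lambda>x. C * indicator (U - A) x)"
          using UA by (intro integrable_mult_right integrable_real_indicator) (auto simp: fmeasurable_def)
      qed (use C in \<open>auto simp: indicator_def\<close>)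
      also have "\<dots> = C * measure lebesgue (U - A)" using UA by simp
      also have "\<dots> \<le> C * e" using m C0 by (rule mult_left_mono)
      finally show ?thesis .
    qed
    have "(LINT x|lebesgue. indicator A x * w x) \<le> 0"
    proof (rule field_le_epsilon)
      fix e :: real assume "e > 0"
      have "C * (e / (C + 1)) \<le> e" using C0 \<open>e > 0\<close> by (simp add: field_simps)
      then show "(LINT x|lebesgue. indicator A x * w x) \<le> 0 + e" using le[of "e / (C + 1)"] C0 \<open>e > 0\<close> by simp
    qed
    moreover have nn: "\<And>x. 0 \<le> indicator A x * w x" by (auto simp: indicator_def A_def)
    ultimately have "(LINT x|lebesgue. indicator A x * w x) = 0"
      using Bochner_Integration.integral_nonneg[of lebesgue "\<lambda>x. indicator A x * w x"] by (meson order_antisym)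
    then have "AE x in lebesgue. indicator A x * w x = 0"
      using integral_nonneg_eq_0_iff_AE[OF int[OF A Ab]] nn by simp
    then show ?thesis
      by eventually_elim (auto simp: A_def indicator_def not_le split: if_splits)
  qed
  then have "AE x in lebesgue. \<forall>k::nat. norm x < real k \<longrightarrow> w x \<le> 0"
    unfolding AE_all_countable by blast
  then show ?thesis by eventually_elim (meson reals_Archimedean2)
qed

lemma C1_data_product:
  fixes \<psi> :: "real^'n \<Rightarrow> real"
  assumes I: "T \<in> I" and R: "R > 0"
    and \<theta>: "\<And>t. (\<theta> has_real_derivative \<theta>' t) (at t)" "continuous_on UNIV \<theta>'"
    and \<theta>0: "\<And>t. t \<ge> T \<Longrightarrow> \<theta> t = 0 \<and> \<theta>' t = 0"
    and \<psi>: "\<And>x. (\<psi> has_derivative \<psi>' x) (at x)" "\<And>v. continuous_on UNIV (\<lambda>x. \<psi>' x v)"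
    and \<psi>0: "\<And>x. norm x \<ge> R \<Longrightarrow> \<psi> x = 0 \<and> \<psi>' x = (\<lambda>v. 0)"
  shows "C1_data I T R (\<lambda>z. \<theta> (fst z) * \<psi> (snd z))
    (\<lambda>z v. \<theta> (fst z) * \<psi>' (snd z) (snd v) + \<theta>' (fst z) * fst v * \<psi> (snd z))"
  unfolding C1_data_def
proof (intro conjI ballI allI impI)
  show "((\<lambda>z. \<theta> (fst z) * \<psi> (snd z)) has_derivative
    (\<lambda>v. \<theta> (fst z) * \<psi>' (snd z) (snd v) + \<theta>' (fst z) * fst v * \<psi> (snd z))) (at z within I \<times> UNIV)" for z
  proof (rule has_derivative_mult)
    show "((\<lambda>z. \<theta> (fst z)) has_derivative (\<lambda>v. \<theta>' (fst z) * fst v)) (at z within I \<times> UNIV)"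
      using has_derivative_compose[OF has_derivative_fst[OF has_derivative_ident] \<theta>(1)[unfolded has_field_derivative_def], of z "I \<times> UNIV"]
      by simp
    show "((\<lambda>z. \<psi> (snd z)) has_derivative (\<lambda>v. \<psi>' (snd z) (snd v))) (at z within I \<times> UNIV)"
      using has_derivative_compose[OF has_derivative_snd[OF has_derivative_ident] \<psi>(1), of z "I \<times> UNIV"]
      by simp
  qed
  have c: "continuous_on UNIV \<theta>" "continuous_on UNIV \<psi>"
    using DERIV_continuous_on[of UNIV \<theta> \<theta>'] has_derivative_continuous_on[of UNIV \<psi> \<psi>'] \<theta>(1) \<psi>(1) by simp_all
  show "continuous_on (I \<times> UNIV) (\<lambda>z. \<theta> (fst z) * \<psi>' (snd z) (snd v) + \<theta>' (fst z) * fst v * \<psi> (snd z))" for v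
    by (intro continuous_intros continuous_on_compose2[OF c(1)] continuous_on_compose2[OF c(2)]
        continuous_on_compose2[OF \<theta>(2)] continuous_on_compose2[OF \<psi>(2)]) auto
qed (use I R \<theta>0 \<psi>0 in auto)

lemma pos_part_square_derivative:
  "((\<lambda>s::real. (max 0 s) ^ 2) has_real_derivative 2 * max 0 s) (at s)"
proof -
  consider "s > 0" | "s < 0" | "s = 0" by linarith
  then show ?thesis
  proof cases
    case 1
    have "((\<lambda>s. s ^ 2) has_real_derivative 2 * max 0 s) (at s)" using 1 by (auto intro!: derivative_eq_intros)
    then show ?thesis by (rule has_field_derivative_transform_within_open[where S="{0<..}"]) (use 1 in auto)
  next
    case 2
    have "((\<lambda>s. 0) has_real_derivative 2 * max 0 s) (at s)" using 2 by auto
    then show ?thesis by (rule has_field_derivative_transform_within_open[where S="{..<0}"]) (use 2 in auto)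
  next
    case 3
    have "((\<lambda>h::real. max 0 h) \<longlongrightarrow> 0) (at 0)" by (rule tendsto_eq_intros) (auto intro!: tendsto_eq_intros)
    then have "((\<lambda>h::real. (max 0 h) ^ 2 / h) \<longlongrightarrow> 0) (at 0)"
      by (rule Lim_transform_eventually[OF _ _]) (auto simp: eventually_at_filter max_def power2_eq_square)
    then show ?thesis using 3 by (simp add: has_field_derivative_iff)
  qed
qed

text \<open>
  Test with \<open>\<theta>(t) \<psi>(x)\<close>, where \<open>\<psi> \<ge> 0\<close> and \<open>\<theta>\<close> decreases from 1 to 0 in a short time.  The term with
  \<open>w \<theta>' \<psi>\<close> is nonnegative since both \<open>w\<close> and \<open>\<theta>'\<close> are at most 0, and the remaining
  integrals tend to 0 with the length of the time interval; what is left is that the integral of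
  \<open>w0 \<psi>\<close> is at most 0.
\<close>

lemma weak_form_initial_nonpos:
  fixes w0 :: "real^'n \<Rightarrow> real"
  assumes I: "time_interval I"
    and w: "locally_bounded I w" "\<And>z. z \<in> I \<times> UNIV \<Longrightarrow> w z \<le> 0"
    and b: "\<And>i. locally_bounded I (b i)" and c: "locally_bounded I c"
    and w0: "w0 \<in> borel_measurable lebesgue" "\<And>x. \<bar>w0 x\<bar> \<le> C"
    and weak: "\<And>\<phi> T R \<phi>'. C1_data I T R \<phi> \<phi>' \<Longrightarrow> weak_form I w b c w0 \<phi> \<phi>' = 0"
  shows "AE x in lebesgue. w0 x \<le> 0"
proof (rule AE_nonpos_if_integral_open_nonpos[OF w0])
  let ?M = "lebesgue_on (I \<times> (UNIV :: (real^'n) set))"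
  note S = time_interval_domain_lebesgue[OF I, where 'n='n]
  have I0: "0 \<in> I" "\<And>t. t \<in> I \<Longrightarrow> 0 \<le> t" using I unfolding time_interval_def by auto
  obtain T0 where T0: "T0 > 0" "T0 \<in> I" using time_interval_forward[OF I I0(1), of 1] by auto
  have down: "t \<in> I" if "0 \<le> t" "t \<le> T0" for t using I T0 that unfolding time_interval_def by auto
  have test: "(LINT x|lebesgue. w0 x * \<psi> x) \<le> 0"
    if \<psi>: "Ck_on 1 UNIV \<psi>" "\<And>x. 0 \<le> \<psi> x" "\<And>x. norm x \<ge> r \<Longrightarrow> \<psi> x = 0" for \<psi> :: "real^'n \<Rightarrow> real" and r
  proof -
    obtain \<psi>' where \<psi>': "\<And>x. (\<psi> has_derivative \<psi>' x) (at x)" "\<And>v. continuous_on UNIV (\<lambda>x. \<psi>' x v)"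
      using \<psi>(1) by auto
    define R where "R = \<bar>r\<bar> + 1"
    have R: "R > 0" "R > r" by (auto simp: R_def)
    have \<psi>0: "\<psi> x = 0 \<and> \<psi>' x = (\<lambda>v. 0)" if "norm x \<ge> R" for x
    proof
      show "\<psi> x = 0" using \<psi>(3) that R by auto
      have o: "open {x :: real^'n. norm x > r}" by (intro open_Collect_less continuous_intros)
      have "(\<psi> has_derivative (\<lambda>v. 0)) (at x)"
        by (rule has_derivative_transform_within_open[OF has_derivative_const[of 0] o]) (use \<psi>(3) that R in auto)
      then show "\<psi>' x = (\<lambda>v. 0)" using has_derivative_unique[OF \<psi>'(1)] by blast
    qed
    define G where "G z = (\<Sum>i\<in>UNIV. b i z * \<psi>' (snd z) (axis i 1)) + c z * \<psi> (snd z)" for z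
    \<comment> \<open>steep enough for \<open>\<theta>\<close> to vanish from time \<open>1 / k n \<le> T0\<close> on; the square makes it \<open>C\<^sup>1\<close>\<close>
    define k where "k n = (1 + real n) / T0" for n
    have k: "k n > 0" "1 / k n \<le> T0" for n using T0 by (auto simp: k_def field_simps)
    define \<theta> where "\<theta> n t = (max 0 (1 - k n * t)) ^ 2" for n t
    define \<theta>' where "\<theta>' n t = - 2 * k n * max 0 (1 - k n * t)" for n t
    have \<theta>der: "(\<theta> n has_real_derivative \<theta>' n t) (at t)" for n t
    proof -
      have "((\<lambda>t. 1 - k n * t) has_real_derivative - k n) (at t)" by (auto intro!: derivative_eq_intros)
      from DERIV_chain2[OF pos_part_square_derivative this] show ?thesis by (simp add: \<theta>_def[abs_def] \<theta>'_def mult_ac)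
    qed
    have \<theta>cont: "continuous_on UNIV (\<theta>' n)" for n unfolding \<theta>'_def by (intro continuous_intros)
    have \<theta>0: "\<theta> n t = 0 \<and> \<theta>' n t = 0" if "t \<ge> 1 / k n" for n t
      using that k(1)[of n] by (auto simp: \<theta>_def \<theta>'_def max_def field_simps)
    have \<theta>le: "0 \<le> \<theta> n t" "\<theta> n t \<le> 1" "\<theta>' n t \<le> 0" if "t \<ge> 0" for n t
      using that k(1)[of n] by (auto simp: \<theta>_def \<theta>'_def intro!: power_le_one mult_nonneg_nonneg)
    define \<phi> where "\<phi> n z = \<theta> n (fst z) * \<psi> (snd z)" for n and z :: "real \<times> (real^'n)"
    define \<phi>' where "\<phi>' n z v = \<theta> n (fst z) * \<psi>' (snd z) (snd v) + \<theta>' n (fst z) * fst v * \<psi> (snd z)"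
      for n and z v :: "real \<times> (real^'n)"
    have data: "C1_data I (1 / k n) R (\<phi> n) (\<phi>' n)" for n
      unfolding \<phi>_def[abs_def] \<phi>'_def[abs_def]
      by (rule C1_data_product[OF _ R(1) \<theta>der \<theta>cont \<theta>0 \<psi>' \<psi>0]) (use down k in \<open>auto simp: less_imp_le\<close>)
    have lin: "linear (\<psi>' x)" for x using \<psi>'(1) has_derivative_linear by blast
    have \<phi>'1: "\<phi>' n z (1, 0) = \<theta>' n (fst z) * \<psi> (snd z)" "\<phi>' n z (0, axis i 1) = \<theta> n (fst z) * \<psi>' (snd z) (axis i 1)" for n z i
      using linear_0[OF lin] by (auto simp: \<phi>'_def)
    have c\<psi>: "continuous_on UNIV \<psi>" using \<psi>(1) Ck_on_imp_continuous_on by blast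
    have eq: "\<theta> n (fst z) * G z = (\<Sum>i\<in>UNIV. b i z * \<phi>' n z (0, axis i 1)) + c z * \<phi> n z" for n z
      by (simp add: G_def \<phi>'1 \<phi>_def algebra_simps sum_distrib_left)
    have int: "integrable ?M (\<lambda>z. w z * \<phi>' n z (1, 0))" "integrable ?M (\<lambda>z. \<theta> n (fst z) * G z)" for n
    proof -
      note d = C1_dataD[OF data[of n]]
      note int = integrable_locally_bounded_mult[OF I d(1)]
      show "integrable ?M (\<lambda>z. w z * \<phi>' n z (1, 0))" by (rule int[OF w(1) d(4) d(6)])
      show "integrable ?M (\<lambda>z. \<theta> n (fst z) * G z)" unfolding eq
        by (intro Bochner_Integration.integrable_add Bochner_Integration.integrable_sum
            int[OF b d(4) d(6)] int[OF c d(7) d(5)])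
    qed
    have key: "(LINT x|lebesgue. w0 x * \<psi> x) \<le> - (LINT z|?M. \<theta> n (fst z) * G z)" for n
    proof -
      have "0 = weak_form I w b c w0 (\<phi> n) (\<phi>' n)" using weak[OF data] by simp
      also have "\<dots> = (LINT z|?M. w z * \<phi>' n z (1, 0) + \<theta> n (fst z) * G z) + (LINT x|lebesgue. w0 x * \<phi> n (0, x))"
        unfolding weak_form_def eq by (simp only: add.assoc)
      also have "(LINT z|?M. w z * \<phi>' n z (1, 0) + \<theta> n (fst z) * G z) = (LINT z|?M. w z * \<phi>' n z (1, 0)) + (LINT z|?M. \<theta> n (fst z) * G z)"
        by (rule Bochner_Integration.integral_add[OF int])
      finally have "(LINT x|lebesgue. w0 x * \<phi> n (0, x)) = - (LINT z|?M. w z * \<phi>' n z (1, 0)) - (LINT z|?M. \<theta> n (fst z) * G z)"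
        by simp
      moreover have "(LINT z|?M. w z * \<phi>' n z (1, 0)) \<ge> 0"
      proof (rule Bochner_Integration.integral_nonneg_AE, rule AE_I2)
        fix z assume "z \<in> space ?M"
        then have z: "z \<in> I \<times> UNIV" by simp
        then have "\<theta>' n (fst z) * \<psi> (snd z) \<le> 0"
          using \<theta>le(3)[of "fst z" n] I0(2)[of "fst z"] \<psi>(2)[of "snd z"] by (intro mult_nonpos_nonneg) (auto simp: mem_Times_iff)
        then show "0 \<le> w z * \<phi>' n z (1, 0)" using w(2)[OF z] by (simp add: \<phi>'1 mult_nonpos_nonpos)
      qed
      moreover have "\<theta> n 0 = 1" by (simp add: \<theta>_def)
      ultimately show ?thesis by (simp add: \<phi>_def)
    qed
    have "(\<lambda>n. LINT z|?M. \<theta> n (fst z) * G z) \<longlonglongrightarrow> (LINT z|?M. 0)"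
    proof (rule integral_dominated_convergence[where w="\<lambda>z. \<bar>\<theta> 0 (fst z) * G z\<bar>"])
      show "(\<lambda>z. \<theta> n (fst z) * G z) \<in> borel_measurable ?M" for n
        using int(2) by (rule borel_measurable_integrable)
      show "integrable ?M (\<lambda>z. \<bar>\<theta> 0 (fst z) * G z\<bar>)" using int(2) by (rule integrable_abs)
      have neg: "negligible {z :: real \<times> (real^'n). z \<bullet> (1, 0) = 0}"
        by (rule negligible_standard_hyperplane) (auto simp: Basis_prod_def)
      then have "AE z in (lebesgue :: (real \<times> (real^'n)) measure). z \<notin> {z. z \<bullet> (1, 0) = 0}"
        by (intro AE_not_in) (simp add: negligible_iff_null_sets)
      then have ne: "AE z in ?M. fst z \<noteq> 0"
        using S by (subst AE_restrict_space_iff) (auto simp: inner_prod_def elim: eventually_mono)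
      show "AE z in ?M. (\<lambda>n. \<theta> n (fst z) * G z) \<longlonglongrightarrow> 0"
        using ne AE_space
      proof eventually_elim
        case (elim z)
        then have t: "fst z > 0" using I0(2)[of "fst z"] by (auto simp: mem_Times_iff)
        obtain N where N: "real N > T0 / fst z" using reals_Archimedean2 by blast
        have "\<theta> n (fst z) * G z = 0" if "n \<ge> N" for n
        proof -
          have "1 + real n \<ge> T0 / fst z" using that N by linarith
          then have "1 / k n \<le> fst z" using t T0 by (simp add: k_def field_simps)
          then show ?thesis using \<theta>0 by simp
        qed
        then show ?case by (intro tendsto_eventually eventually_sequentiallyI[of N])
      qed
      show "AE z in ?M. norm (\<theta> n (fst z) * G z) \<le> \<bar>\<theta> 0 (fst z) * G z\<bar>" for n
      proof (rule AE_I2)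
        fix z assume "z \<in> space ?M"
        then have t: "fst z \<ge> 0" using I0(2) by (auto simp: mem_Times_iff)
        have "k 0 * fst z \<le> k n * fst z" using t T0 by (intro mult_right_mono) (auto simp: k_def divide_right_mono)
        then have "\<theta> n (fst z) \<le> \<theta> 0 (fst z)" unfolding \<theta>_def by (intro power_mono) auto
        then show "norm (\<theta> n (fst z) * G z) \<le> \<bar>\<theta> 0 (fst z) * G z\<bar>"
          using \<theta>le(1)[OF t, of n] by (auto simp: abs_mult intro!: mult_right_mono)
      qed
    qed simp
    then have "(\<lambda>n. - (LINT z|?M. \<theta> n (fst z) * G z)) \<longlonglongrightarrow> - 0" by (intro tendsto_minus) simp
    then show ?thesis using key by (intro LIMSEQ_le_const) auto
  qed
  fix U :: "(real^'n) set" assume U: "open U" "bounded U"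
  obtain r where r: "\<And>x. x \<in> U \<Longrightarrow> norm x < r" using U(2) bounded_pos_less by metis
  obtain \<psi> :: "nat \<Rightarrow> real^'n \<Rightarrow> real" where \<psi>: "\<And>n k. Ck_on k UNIV (\<psi> n)"
    "\<And>n x. 0 \<le> \<psi> n x" "\<And>n x. \<psi> n x \<le> 1" "\<And>n x. x \<notin> U \<Longrightarrow> \<psi> n x = 0"
    "\<And>x. (\<lambda>n. \<psi> n x) \<longlonglongrightarrow> indicator U x"
    using open_bounded_smooth_approximation[OF U(1)] by blast
  have "(LINT x|lebesgue. w0 x * \<psi> n x) \<le> 0" for n
    by (rule test[OF \<psi>(1,2), where r=r]) (use r \<psi>(4) in force)
  moreover have "(\<lambda>n. LINT x|lebesgue. w0 x * \<psi> n x) \<longlonglongrightarrow> (LINT x|lebesgue. indicator U x * w0 x)"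
  proof (rule integral_dominated_convergence[where w="\<lambda>x. C * indicator U x"])
    show "(\<lambda>x. indicator U x * w0 x) \<in> borel_measurable lebesgue"
      using w0(1) U(1) by (intro borel_measurable_times borel_measurable_indicator) auto
    have "\<psi> n \<in> borel_measurable lebesgue" for n
      using Ck_on_imp_continuous_on[OF \<psi>(1)] by (intro measurable_completion) (simp add: borel_measurable_continuous_onI)
    then show "(\<lambda>x. w0 x * \<psi> n x) \<in> borel_measurable lebesgue" for n using w0(1) by auto
    have "U \<in> lmeasurable" using U by (simp add: lmeasurable_open)
    then show "integrable lebesgue (\<lambda>x. C * indicator U x)"
      by (intro integrable_mult_right integrable_real_indicator) (auto simp: fmeasurable_def)
    show "AE x in lebesgue. (\<lambda>n. w0 x * \<psi> n x) \<longlonglongrightarrow> indicator U x * w0 x"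
      using tendsto_mult_left[OF \<psi>(5)] by (auto simp: mult.commute)
    show "AE x in lebesgue. norm (w0 x * \<psi> n x) \<le> C * indicator U x" for n
    proof (rule AE_I2)
      fix x
      show "norm (w0 x * \<psi> n x) \<le> C * indicator U x"
      proof (cases "x \<in> U")
        case True
        have "\<bar>w0 x\<bar> * \<bar>\<psi> n x\<bar> \<le> C * 1"
          using w0(2)[of x] \<psi>(2,3)[of n x] by (intro mult_mono) auto
        then show ?thesis using True by (simp add: abs_mult)
      qed (use \<psi>(4) in simp)
    qed
  qed
  ultimately show "(LINT x|lebesgue. indicator U x * w0 x) \<le> 0"
    by (intro LIMSEQ_le_const2) auto
qed

section \<open>Identities for entropy fluxes\<close>

text \<open>
  The derivatives in the sense of \<open>Ck_on\<close> on the real line are the usual ones.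
\<close>

lemma C2_deriv:
  assumes "Ck_on 2 UNIV (E :: real \<Rightarrow> real)"
  shows "(E has_real_derivative deriv E k) (at k)" "(deriv E has_real_derivative deriv (deriv E) k) (at k)"
    "continuous_on UNIV (deriv (deriv E))" "continuous_on UNIV E" "continuous_on UNIV (deriv E)"
proof -
  obtain h where h: "\<And>z. (E has_derivative h z) (at z)" "Ck_on 1 UNIV (\<lambda>z. h z 1)"
    using Ck_on_SucE[OF assms[unfolded numeral_2_eq_2]] by (metis One_nat_def UNIV_I)
  have lin: "linear (h z)" for z using h(1) has_derivative_linear by blast
  have E: "(E has_real_derivative h z 1) (at z)" for z
  proof -
    have "h z = (*) (h z 1)"
      using linear_scale[OF lin, of z _ 1] by (intro ext) (metis mult.commute mult.right_neutral real_scaleR_def)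
    then show ?thesis using h(1)[of z] by (simp add: has_field_derivative_def)
  qed
  then have dE: "deriv E = (\<lambda>z. h z 1)" by (intro ext DERIV_imp_deriv)
  obtain h2 where h2: "\<And>z. ((\<lambda>z. h z 1) has_derivative h2 z) (at z)" "continuous_on UNIV (\<lambda>z. h2 z 1)"
    using h(2) by auto
  have lin2: "linear (h2 z)" for z using h2(1) has_derivative_linear by blast
  have E2: "((\<lambda>z. h z 1) has_real_derivative h2 z 1) (at z)" for z
  proof -
    have "h2 z = (*) (h2 z 1)"
      using linear_scale[OF lin2, of z _ 1] by (intro ext) (metis mult.commute mult.right_neutral real_scaleR_def)
    then show ?thesis using h2(1)[of z] by (simp add: has_field_derivative_def)
  qed
  then have dE2: "deriv (deriv E) = (\<lambda>z. h2 z 1)" unfolding dE by (intro ext DERIV_imp_deriv)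
  show "(E has_real_derivative deriv E k) (at k)" "(deriv E has_real_derivative deriv (deriv E) k) (at k)"
    using E E2 by (simp_all add: dE2) (simp_all add: dE)
  show "continuous_on UNIV (deriv (deriv E))" using h2(2) by (simp add: dE2)
  show "continuous_on UNIV E" "continuous_on UNIV (deriv E)"
    using E E2 by (auto intro!: DERIV_continuous_on simp: dE)
qed

lemma has_vector_derivative_shift_0:
  assumes "(g has_vector_derivative D) (at 0)"
  shows "((\<lambda>w. g (w - s)) has_vector_derivative D) (at s)"
proof -
  have "((\<lambda>w. w - s) has_vector_derivative 1) (at s)" by (auto intro!: derivative_eq_intros)
  moreover have "(g has_vector_derivative D) (at (s - s))" using assms by simp
  ultimately show ?thesis using vector_diff_chain_at by (fastforce simp: o_def)
qed

lemma class_F_derivatives: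
  fixes f :: "real \<times> (real^'n) \<times> real \<Rightarrow> 'b::real_normed_vector"
  assumes "f \<in> class_F I"
  shows "continuous_on (closure I \<times> UNIV) f"
    "\<And>t x k. t \<in> closure I \<Longrightarrow> ((\<lambda>w. f (t, x, w)) has_vector_derivative d_u f (t, x, k)) (at k)"
    "\<And>t x k s. t \<in> closure I \<Longrightarrow> ((\<lambda>s. f (t, x + s *\<^sub>R axis i 1, k)) has_vector_derivative
        pderiv_x i (\<lambda>y. f (t, y, k)) (x + s *\<^sub>R axis i 1)) (at s)"
    "continuous_on (closure I \<times> UNIV) (\<lambda>(t, x, k). pderiv_x i (\<lambda>y. f (t, y, k)) x)"
proof -
  let ?S = "closure I \<times> (UNIV :: ((real^'n) \<times> real) set)"
  obtain f' where f': "\<And>z. z \<in> ?S \<Longrightarrow> (f has_derivative f' z) (at z within ?S)"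
    "\<And>v. continuous_on ?S (\<lambda>z. f' z v)"
  proof -
    have "Ck_on (Suc 0) ?S f" using assms by (simp add: class_F_def)
    from Ck_on_SucE[OF this] show thesis using that by (metis Ck_on.simps(1))
  qed
  show "continuous_on ?S f" using f'(1) has_derivative_continuous_on by blast
  have P: "pderiv_x i (\<lambda>y. f (t, y, k)) x = f' (t, x, k) (0, axis i 1, 0)" if "t \<in> closure I" for t x k
    by (rule pderiv_x_eq3[OF f'(1) that]) (use that in auto)
  show "continuous_on ?S (\<lambda>(t, x, k). pderiv_x i (\<lambda>y. f (t, y, k)) x)"
    by (rule continuous_on_eq[OF f'(2)[of "(0, axis i 1, 0)"]]) (auto simp: P)
  fix t x k s assume t: "t \<in> closure I"
  have "((\<lambda>r. f ((t, x, k) + r *\<^sub>R (0, 0, 1))) has_vector_derivative f' (t, x, k) (0, 0, 1)) (at 0)"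
    by (rule line_derivative[OF f'(1)]) (use t in auto)
  then have "((\<lambda>r. f (t, x, k + r)) has_vector_derivative f' (t, x, k) (0, 0, 1)) (at 0)"
    by simp
  from has_vector_derivative_shift_0[OF this, of k]
  have u: "((\<lambda>w. f (t, x, w)) has_vector_derivative f' (t, x, k) (0, 0, 1)) (at k)"
    by simp
  then show "((\<lambda>w. f (t, x, w)) has_vector_derivative d_u f (t, x, k)) (at k)"
    by (simp add: d_u_def vector_derivative_at)
  let ?y = "x + s *\<^sub>R axis i 1"
  have "((\<lambda>r. f ((t, ?y, k) + r *\<^sub>R (0, axis i 1, 0))) has_vector_derivative f' (t, ?y, k) (0, axis i 1, 0)) (at 0)"
    by (rule line_derivative[OF f'(1)]) (use t in auto)
  then have "((\<lambda>r. f (t, ?y + r *\<^sub>R axis i 1, k)) has_vector_derivative f' (t, ?y, k) (0, axis i 1, 0)) (at 0)"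
    by simp
  from has_vector_derivative_shift_0[OF this, of s]
  have "((\<lambda>w. f (t, ?y + (w - s) *\<^sub>R axis i 1, k)) has_vector_derivative f' (t, ?y, k) (0, axis i 1, 0)) (at s)" .
  then show "((\<lambda>s. f (t, x + s *\<^sub>R axis i 1, k)) has_vector_derivative
        pderiv_x i (\<lambda>y. f (t, y, k)) ?y) (at s)"
    by (simp add: P[OF t] algebra_simps)
qed

text \<open>
  The antiderivative is \<open>E'(k) f - F\<close>, since \<open>\<partial>\<^sub>u F = E' \<partial>\<^sub>u f\<close> cancels the other term of the product rule.
\<close>

lemma entropy_flux_by_parts:
  fixes f :: "real \<times> (real^'n) \<times> real \<Rightarrow> real^'n"
  assumes f: "f \<in> class_F I" and F: "F \<in> entropy_flux I f E" and E: "Ck_on 2 UNIV E"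
    and t: "t \<in> closure I" and ab: "a \<le> b"
  shows "((\<lambda>k. deriv (deriv E) k *\<^sub>R f (t, x, k)) has_integral
    (deriv E b *\<^sub>R f (t, x, b) - F (t, x, b)) - (deriv E a *\<^sub>R f (t, x, a) - F (t, x, a))) {a..b}"
proof (rule fundamental_theorem_of_calculus[OF ab])
  fix k
  have F': "F \<in> class_F I" and du: "d_u F (t, x, k) = deriv E k *\<^sub>R d_u f (t, x, k)"
    using F t unfolding entropy_flux_def by auto
  have "((\<lambda>k. deriv E k *\<^sub>R f (t, x, k) - F (t, x, k)) has_vector_derivative
     (deriv E k *\<^sub>R d_u f (t, x, k) + deriv (deriv E) k *\<^sub>R f (t, x, k)) - d_u F (t, x, k)) (at k)"
    by (intro has_vector_derivative_diff has_vector_derivative_scaleR C2_deriv(2)[OF E]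
        class_F_derivatives(2)[OF f t] class_F_derivatives(2)[OF F' t])
  then show "((\<lambda>k. deriv E k *\<^sub>R f (t, x, k) - F (t, x, k)) has_vector_derivative
     deriv (deriv E) k *\<^sub>R f (t, x, k)) (at k within {a..b})"
    by (simp add: du has_vector_derivative_at_within)
qed

text \<open>
  The previous identity holds at every point \<open>x\<close>, so both sides may be differentiated in \<open>x\<close>, on the left
  under the integral.
\<close>

lemma entropy_flux_by_parts_pderiv:
  fixes f :: "real \<times> (real^'n) \<times> real \<Rightarrow> real^'n" and x :: "real^'n" and i :: 'n
  assumes f: "f \<in> class_F I" and F: "F \<in> entropy_flux I f E" and E: "Ck_on 2 UNIV E"
    and t: "t \<in> closure I" and ab: "a \<le> b"
  defines "P h k \<equiv> pderiv_x i (\<lambda>y. h (t, y, k)) x"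
  shows "((\<lambda>k. deriv (deriv E) k *\<^sub>R P f k) has_integral
    (deriv E b *\<^sub>R P f b - P F b) - (deriv E a *\<^sub>R P f a - P F a)) {a..b}"
proof -
  have F': "F \<in> class_F I" using F unfolding entropy_flux_def by auto
  let ?y = "\<lambda>s. x + s *\<^sub>R axis i 1"
  let ?G = "\<lambda>s. integral {a..b} (\<lambda>k. deriv (deriv E) k *\<^sub>R f (t, ?y s, k))"
  let ?P = "\<lambda>s k. pderiv_x i (\<lambda>y. f (t, y, k)) (?y s)"
  have cE: "continuous_on S (\<lambda>p. deriv (deriv E) (q p))" if "continuous_on S q" for S :: "'z::topological_space set" and q
    by (rule continuous_on_compose2[OF C2_deriv(3)[OF E] that]) auto
  have cP: "continuous_on (UNIV \<times> cbox a b) (\<lambda>(s, k). deriv (deriv E) k *\<^sub>R ?P s k)"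
    unfolding split_beta using t
    by (intro continuous_intros cE continuous_on_compose2[OF class_F_derivatives(4)[OF f, of i],
          of _ "\<lambda>p. (t, ?y (fst p), snd p)", unfolded split_beta fst_conv snd_conv]) auto
  have cf: "continuous_on {a..b} (\<lambda>k. deriv (deriv E) k *\<^sub>R f (t, ?y s, k))" for s
    using t by (intro continuous_intros cE continuous_on_compose2[OF class_F_derivatives(1)[OF f]]) auto
  have "(?G has_vector_derivative integral (cbox a b) (\<lambda>k. deriv (deriv E) k *\<^sub>R ?P 0 k)) (at 0 within UNIV)"
    unfolding cbox_interval[symmetric]
  proof (rule leibniz_rule_vector_derivative[OF _ _ cP])
    show "((\<lambda>s. deriv (deriv E) k *\<^sub>R f (t, ?y s, k)) has_vector_derivative deriv (deriv E) k *\<^sub>R ?P s k) (at s within UNIV)" for s k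
      using has_vector_derivative_scaleR[OF DERIV_const class_F_derivatives(3)[OF f t, of x i k s], of "deriv (deriv E) k"] by simp
    show "(\<lambda>k. deriv (deriv E) k *\<^sub>R f (t, ?y s, k)) integrable_on cbox a b" for s
      using cf by (intro integrable_continuous) simp
  qed auto
  moreover have "?G = (\<lambda>s. (deriv E b *\<^sub>R f (t, ?y s, b) - F (t, ?y s, b)) - (deriv E a *\<^sub>R f (t, ?y s, a) - F (t, ?y s, a)))"
    by (intro ext integral_unique entropy_flux_by_parts[OF f F E t ab])
  moreover have "((\<lambda>s. c *\<^sub>R f (t, ?y s, k)) has_vector_derivative c *\<^sub>R P f k) (at 0)" for c k
    using has_vector_derivative_scaleR[OF DERIV_const class_F_derivatives(3)[OF f t, of x i k 0], of c] by (simp add: P_def)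
  then have "((\<lambda>s. (deriv E b *\<^sub>R f (t, ?y s, b) - F (t, ?y s, b)) - (deriv E a *\<^sub>R f (t, ?y s, a) - F (t, ?y s, a)))
     has_vector_derivative (deriv E b *\<^sub>R P f b - P F b) - (deriv E a *\<^sub>R P f a - P F a)) (at 0)"
    using class_F_derivatives(3)[OF F' t, of x i _ 0] by (intro has_vector_derivative_diff) (simp_all add: P_def)
  ultimately have eq: "integral {a..b} (\<lambda>k. deriv (deriv E) k *\<^sub>R P f k) = (deriv E b *\<^sub>R P f b - P F b) - (deriv E a *\<^sub>R P f a - P F a)"
    by (simp add: P_def vector_derivative_unique_at)
  have "continuous_on {a..b} (\<lambda>k. deriv (deriv E) k *\<^sub>R P f k)"
    unfolding P_def using t
    by (intro continuous_intros cE continuous_on_compose2[OF class_F_derivatives(4)[OF f, of i],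
          of _ "\<lambda>k. (t, x, k)", unfolded split_beta fst_conv snd_conv]) auto
  then show ?thesis using eq integrable_integral[OF integrable_continuous_interval] by metis
qed

lemma entropy_flux_by_parts_div:
  fixes f :: "real \<times> (real^'n) \<times> real \<Rightarrow> real^'n"
  assumes f: "f \<in> class_F I" and F: "F \<in> entropy_flux I f E" and E: "Ck_on 2 UNIV E"
    and t: "t \<in> closure I" and ab: "a \<le> b"
  shows "((\<lambda>k. deriv (deriv E) k * div_x f (t, x, k)) has_integral
    (deriv E b * div_x f (t, x, b) - div_x F (t, x, b)) - (deriv E a * div_x f (t, x, a) - div_x F (t, x, a))) {a..b}"
proof -
  have nth: "((\<lambda>k. g k $ i) has_integral s $ i) A" if "(g has_integral s) A"
    for g :: "real \<Rightarrow> real^'n" and s A i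
    using has_integral_linear[OF that bounded_linear_vec_nth[of i]] by (simp add: o_def)
  have "((\<lambda>k. \<Sum>i\<in>UNIV. (deriv (deriv E) k *\<^sub>R pderiv_x i (\<lambda>y. f (t, y, k)) x) $ i) has_integral
    (\<Sum>i\<in>UNIV. ((deriv E b *\<^sub>R pderiv_x i (\<lambda>y. f (t, y, b)) x - pderiv_x i (\<lambda>y. F (t, y, b)) x) -
       (deriv E a *\<^sub>R pderiv_x i (\<lambda>y. f (t, y, a)) x - pderiv_x i (\<lambda>y. F (t, y, a)) x)) $ i)) {a..b}"
    by (intro has_integral_sum nth entropy_flux_by_parts_pderiv[OF f F E t ab]) auto
  then show ?thesis by (simp add: div_x_def sum_distrib_left sum_subtractf)
qed

text \<open>
  Every term of the Kruzhkov production has the form \<open>sgn (v - k) q(k)\<close> with \<open>q\<close> continuous in \<open>k\<close>; split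
  the interval at \<open>v\<close>.
\<close>

lemma has_integral_sgn_mult:
  fixes q Q :: "real \<Rightarrow> real"
  assumes q: "\<And>a b. l \<le> a \<Longrightarrow> a \<le> b \<Longrightarrow> b \<le> r \<Longrightarrow> (q has_integral Q b - Q a) {a..b}"
    and v: "l \<le> v" "v \<le> r"
  shows "((\<lambda>k. sgn (v - k) * q k) has_integral 2 * Q v - Q l - Q r) {l..r}"
proof -
  have "((\<lambda>k. sgn (v - k) * q k) has_integral Q v - Q l) {l..v}"
    by (rule has_integral_spike_finite[OF _ _ q[of l v], of "{v}"]) (use v in auto)
  moreover have "((\<lambda>k. sgn (v - k) * q k) has_integral - (Q r - Q v)) {v..r}"
    by (rule has_integral_spike_finite[OF _ _ has_integral_neg[OF q[of v r]], of "{v}"]) (use v in auto)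
  ultimately have "((\<lambda>k. sgn (v - k) * q k) has_integral (Q v - Q l) + - (Q r - Q v)) {l..r}"
    by (rule has_integral_combine[OF v])
  then show ?thesis by (simp add: algebra_simps)
qed

text \<open>
  At a fixed point \<open>(t, x)\<close>: \<open>v\<close> is the value of \<open>u\<close>, \<open>a\<close>, \<open>b\<close> and \<open>p\<close> stand for the time derivative, the
  gradient and the value of the test function, and \<open>c\<close> for the source.  At \<open>k = v\<close> the first part of \<open>Q\<close>
  reduces to the entropy source, so that \<open>Q v\<close> is the integrand of the entropy production; at \<open>l\<close> and
  \<open>r\<close> the expression \<open>Q\<close> is affine in \<open>v\<close>, \<open>f(t, x, v)\<close> and \<open>c\<close>.
\<close>

lemma kruzhkov_integrand_has_integral:
  fixes f :: "real \<times> (real^'n) \<times> real \<Rightarrow> real^'n" and x b :: "real^'n" and a c p :: real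
  assumes f: "f \<in> class_F I" and F: "F \<in> entropy_flux I f E" and E: "Ck_on 2 UNIV E"
    and t: "t \<in> closure I" and v: "l \<le> v" "v \<le> r"
  defines "Q k \<equiv> deriv E k * ((v - k) * a + (f (t, x, v) - f (t, x, k)) \<bullet> b + (c - div_x f (t, x, k)) * p)
      + (E k * a + F (t, x, k) \<bullet> b + div_x F (t, x, k) * p)"
  shows "((\<lambda>k. deriv (deriv E) k * (\<bar>v - k\<bar> * a + kruzhkov_flux f t x v k \<bullet> b
      - sgn (v - k) * div_x f (t, x, k) * p + sgn (v - k) * c * p)) has_integral 2 * Q v - Q l - Q r) {l..r}"
proof -
  define q where "q k = deriv (deriv E) k * ((v - k) * a + (f (t, x, v) - f (t, x, k)) \<bullet> b + (c - div_x f (t, x, k)) * p)" for k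
  have "(q has_integral Q \<beta> - Q \<alpha>) {\<alpha>..\<beta>}" if "\<alpha> \<le> \<beta>" for \<alpha> \<beta>
  proof -
    have 1: "((\<lambda>k. deriv (deriv E) k * (v - k)) has_integral (deriv E \<beta> * (v - \<beta>) + E \<beta>) - (deriv E \<alpha> * (v - \<alpha>) + E \<alpha>)) {\<alpha>..\<beta>}"
    proof (rule fundamental_theorem_of_calculus[OF that])
      fix k
      have "((\<lambda>k. deriv E k * (v - k) + E k) has_real_derivative deriv (deriv E) k * (v - k)) (at k)"
        by (auto intro!: derivative_eq_intros C2_deriv[OF E])
      then show "((\<lambda>k. deriv E k * (v - k) + E k) has_vector_derivative deriv (deriv E) k * (v - k)) (at k within {\<alpha>..\<beta>})"
        using has_real_derivative_iff_has_vector_derivative has_vector_derivative_at_within by blast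
    qed
    have 2: "(deriv (deriv E) has_integral deriv E \<beta> - deriv E \<alpha>) {\<alpha>..\<beta>}"
      using C2_deriv(2)[OF E] has_real_derivative_iff_has_vector_derivative has_vector_derivative_at_within
      by (intro fundamental_theorem_of_calculus[OF that]) blast
    have 3: "((\<lambda>k. (deriv (deriv E) k *\<^sub>R f (t, x, k)) \<bullet> b) has_integral
      ((deriv E \<beta> *\<^sub>R f (t, x, \<beta>) - F (t, x, \<beta>)) - (deriv E \<alpha> *\<^sub>R f (t, x, \<alpha>) - F (t, x, \<alpha>))) \<bullet> b) {\<alpha>..\<beta>}"
      using has_integral_linear[OF entropy_flux_by_parts[OF f F E t that] bounded_linear_inner_left[of b]] by (simp add: o_def)
    note 4 = entropy_flux_by_parts_div[OF f F E t that, of x]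
    have "((\<lambda>k. deriv (deriv E) k * (v - k) * a + deriv (deriv E) k * (f (t, x, v) \<bullet> b + c * p)
       - (deriv (deriv E) k *\<^sub>R f (t, x, k)) \<bullet> b - deriv (deriv E) k * div_x f (t, x, k) * p) has_integral
       ((deriv E \<beta> * (v - \<beta>) + E \<beta>) - (deriv E \<alpha> * (v - \<alpha>) + E \<alpha>)) * a + (deriv E \<beta> - deriv E \<alpha>) * (f (t, x, v) \<bullet> b + c * p)
       - ((deriv E \<beta> *\<^sub>R f (t, x, \<beta>) - F (t, x, \<beta>)) - (deriv E \<alpha> *\<^sub>R f (t, x, \<alpha>) - F (t, x, \<alpha>))) \<bullet> b
       - ((deriv E \<beta> * div_x f (t, x, \<beta>) - div_x F (t, x, \<beta>)) - (deriv E \<alpha> * div_x f (t, x, \<alpha>) - div_x F (t, x, \<alpha>))) * p) {\<alpha>..\<beta>}"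
      by (intro has_integral_add has_integral_diff has_integral_mult_left 1 2 3 4)
    moreover have "(\<lambda>k. deriv (deriv E) k * (v - k) * a + deriv (deriv E) k * (f (t, x, v) \<bullet> b + c * p)
       - (deriv (deriv E) k *\<^sub>R f (t, x, k)) \<bullet> b - deriv (deriv E) k * div_x f (t, x, k) * p) = q"
      by (auto simp: q_def algebra_simps inner_simps)
    ultimately show ?thesis
      by (simp add: Q_def algebra_simps inner_simps)
  qed
  then have "((\<lambda>k. sgn (v - k) * q k) has_integral 2 * Q v - Q l - Q r) {l..r}"
    by (intro has_integral_sgn_mult v) auto
  moreover have "sgn (v - k) * q k = deriv (deriv E) k * (\<bar>v - k\<bar> * a + kruzhkov_flux f t x v k \<bullet> b
      - sgn (v - k) * div_x f (t, x, k) * p + sgn (v - k) * c * p)" for k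
    by (auto simp: q_def kruzhkov_flux_def abs_sgn algebra_simps inner_simps)
  ultimately show ?thesis by simp
qed

section \<open>Linearity of weak formulations and trivial fluxes\<close>

lemma continuous_bounded_compact:
  fixes G :: "real \<times> (real^'n) \<times> real \<Rightarrow> real"
  assumes I: "time_interval I" and G: "continuous_on (closure I \<times> UNIV) G" and T: "T \<in> I"
  shows "\<exists>B. \<forall>t\<in>I. \<forall>x. \<forall>k\<in>{l..r}. t \<le> T \<longrightarrow> norm x \<le> R \<longrightarrow> \<bar>G (t, x, k)\<bar> \<le> B"
proof -
  have sub: "{0..T} \<subseteq> closure I" and pos: "\<And>t. t \<in> I \<Longrightarrow> t \<ge> 0"
    using I T closure_subset[of I] unfolding time_interval_def by auto
  have "compact ({0..T} \<times> cball (0::real^'n) R \<times> {l..r})" by (intro compact_Times) auto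
  moreover have "continuous_on ({0..T} \<times> cball (0::real^'n) R \<times> {l..r}) G"
    by (rule continuous_on_subset[OF G]) (use sub in auto)
  ultimately have "bounded (G ` ({0..T} \<times> cball (0::real^'n) R \<times> {l..r}))"
    using compact_continuous_image compact_imp_bounded by blast
  then obtain B where "\<forall>y\<in>G ` ({0..T} \<times> cball (0::real^'n) R \<times> {l..r}). norm y \<le> B"
    unfolding bounded_iff by blast
  then show ?thesis using pos by (intro exI[of _ B]) auto
qed

lemma locally_boundedD:
  "locally_bounded I h \<Longrightarrow> h \<in> borel_measurable (lebesgue_on (I \<times> UNIV))"
  unfolding locally_bounded_def by blast

text \<open>
  Sums, differences and products only differ in the function \<open>bd\<close> that bounds the result.
\<close>

lemma locally_bounded_op:
  assumes h: "locally_bounded I h1" "locally_bounded I h2"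
    and m: "(\<lambda>z. op (h1 z) (h2 z)) \<in> borel_measurable (lebesgue_on (I \<times> UNIV))"
    and op: "\<And>a b A B. \<bar>a\<bar> \<le> A \<Longrightarrow> \<bar>b\<bar> \<le> B \<Longrightarrow> \<bar>op a b\<bar> \<le> bd A B"
  shows "locally_bounded I (\<lambda>z. op (h1 z) (h2 z))"
  unfolding locally_bounded_def
proof (intro conjI m ballI allI)
  fix T R assume T: "T \<in> I"
  obtain A where A: "\<forall>t\<in>I. \<forall>x. t \<le> T \<longrightarrow> norm x \<le> R \<longrightarrow> \<bar>h1 (t, x)\<bar> \<le> A"
    using h(1) T unfolding locally_bounded_def by meson
  obtain B where B: "\<forall>t\<in>I. \<forall>x. t \<le> T \<longrightarrow> norm x \<le> R \<longrightarrow> \<bar>h2 (t, x)\<bar> \<le> B"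
    using h(2) T unfolding locally_bounded_def by meson
  show "\<exists>B. \<forall>t\<in>I. \<forall>x. t \<le> T \<longrightarrow> norm x \<le> R \<longrightarrow> \<bar>op (h1 (t, x)) (h2 (t, x))\<bar> \<le> B"
    using A B op by (intro exI[of _ "bd A B"]) blast
qed

lemma locally_bounded_add: "locally_bounded I h1 \<Longrightarrow> locally_bounded I h2 \<Longrightarrow> locally_bounded I (\<lambda>z. h1 z + h2 z)"
  by (rule locally_bounded_op[where op="(+)" and bd="(+)"]) (auto intro: borel_measurable_add borel_measurable_diff locally_boundedD)

lemma locally_bounded_diff: "locally_bounded I h1 \<Longrightarrow> locally_bounded I h2 \<Longrightarrow> locally_bounded I (\<lambda>z. h1 z - h2 z)"
  by (rule locally_bounded_op[where op="(-)" and bd="(+)"]) (auto intro: borel_measurable_add borel_measurable_diff locally_boundedD)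

lemma locally_bounded_mult: "locally_bounded I h1 \<Longrightarrow> locally_bounded I h2 \<Longrightarrow> locally_bounded I (\<lambda>z. h1 z * h2 z)"
  by (rule locally_bounded_op[where op="(*)" and bd="(*)"])
    (auto simp: abs_mult intro!: mult_mono intro: borel_measurable_times locally_boundedD order_trans[OF abs_ge_zero])

lemma locally_boundedI:
  assumes "h \<in> borel_measurable (lebesgue_on (I \<times> UNIV))" "\<And>z. \<bar>h z\<bar> \<le> B"
  shows "locally_bounded I h"
  using assms unfolding locally_bounded_def by blast

lemma locally_bounded_const: "locally_bounded I (\<lambda>z. c)"
  by (rule locally_boundedI[of _ _ "\<bar>c\<bar>"]) auto

lemma domain_projections_measurable:
  fixes I :: "real set"
  assumes "time_interval I"
  shows "fst \<in> borel_measurable (lebesgue_on (I \<times> (UNIV :: (real^'n) set)))"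
    "snd \<in> borel_measurable (lebesgue_on (I \<times> (UNIV :: (real^'n) set)))"
  by (intro continuous_imp_measurable_on_sets_lebesgue continuous_intros time_interval_domain_lebesgue assms)+

lemma locally_bounded_compose:
  fixes G :: "real \<times> (real^'n) \<times> real \<Rightarrow> real"
  assumes I: "time_interval I" and G: "continuous_on (closure I \<times> UNIV) G"
    and v: "v \<in> borel_measurable (lebesgue_on (I \<times> UNIV))" "\<And>z. l \<le> v z" "\<And>z. v z \<le> r"
  shows "locally_bounded I (\<lambda>z. G (fst z, snd z, v z))"
  unfolding locally_bounded_def
proof (intro conjI ballI allI)
  show "(\<lambda>z. G (fst z, snd z, v z)) \<in> borel_measurable (lebesgue_on (I \<times> UNIV))"
  proof (rule borel_measurable_compose_continuous_on[OF G])
    show "(\<lambda>z. (fst z, snd z, v z)) \<in> borel_measurable (lebesgue_on (I \<times> UNIV))"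
      by (intro borel_measurable_Pair domain_projections_measurable[OF I] v)
    show "(fst w, snd w, v w) \<in> closure I \<times> UNIV" if "w \<in> space (lebesgue_on (I \<times> UNIV))" for w
      using that closure_subset[of I] by (auto simp: mem_Times_iff)
  qed
  fix T R assume "T \<in> I"
  then obtain B where "\<forall>t\<in>I. \<forall>x. \<forall>k\<in>{l..r}. t \<le> T \<longrightarrow> norm x \<le> R \<longrightarrow> \<bar>G (t, x, k)\<bar> \<le> B"
    using continuous_bounded_compact[OF I G] by blast
  then show "\<exists>B. \<forall>t\<in>I. \<forall>x. t \<le> T \<longrightarrow> norm x \<le> R \<longrightarrow> \<bar>G (fst (t, x), snd (t, x), v (t, x))\<bar> \<le> B"
    using v by (intro exI[of _ B]) auto
qed

lemma continuous_div_x: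
  assumes "f \<in> class_F I"
  shows "continuous_on (closure I \<times> UNIV) (div_x f)"
proof -
  have "continuous_on (closure I \<times> UNIV) (\<lambda>z. \<Sum>i\<in>UNIV. (case z of (t, x, k) \<Rightarrow> pderiv_x i (\<lambda>y. f (t, y, k)) x) $ i)"
    by (intro continuous_on_sum continuous_on_component class_F_derivatives(4)[OF assms])
  then show ?thesis by (rule continuous_on_eq) (auto simp: div_x_def)
qed

definition weak_integrand where
  "weak_integrand w b c \<phi> \<phi>' z =
     w z * \<phi>' z (1, 0) + (\<Sum>i\<in>UNIV. b i z * \<phi>' z (0, axis i 1)) + c z * \<phi> z"

lemma weak_form_alt:
  "weak_form I w b c w0 \<phi> \<phi>' = (LINT z|lebesgue_on (I \<times> UNIV). weak_integrand w b c \<phi> \<phi>' z)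
     + (LINT x|lebesgue. w0 x * \<phi> (0, x))"
  by (simp add: weak_form_def weak_integrand_def)

lemma weak_pieces_integrable:
  fixes \<phi> :: "real \<times> (real^'n) \<Rightarrow> real"
  assumes I: "time_interval I" and \<phi>: "C1_data I T R \<phi> \<phi>'"
  shows "locally_bounded I h \<Longrightarrow> integrable (lebesgue_on (I \<times> UNIV)) (\<lambda>z. h z * \<phi>' z v)"
    "locally_bounded I h \<Longrightarrow> integrable (lebesgue_on (I \<times> UNIV)) (\<lambda>z. h z * \<phi> z)"
  using integrable_locally_bounded_mult[OF I C1_dataD(1)[OF \<phi>] _ C1_dataD(4)[OF \<phi>] C1_dataD(6)[OF \<phi>]]
    integrable_locally_bounded_mult[OF I C1_dataD(1)[OF \<phi>] _ C1_dataD(7)[OF \<phi>] C1_dataD(5)[OF \<phi>]]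
  by blast+

lemma weak_integrand_integrable:
  assumes I: "time_interval I" and \<phi>: "C1_data I T R \<phi> \<phi>'"
    and lb: "locally_bounded I w" "\<And>i. locally_bounded I (b i)" "locally_bounded I c"
  shows "integrable (lebesgue_on (I \<times> UNIV)) (weak_integrand w b c \<phi> \<phi>')"
  unfolding weak_integrand_def[abs_def]
  by (intro Bochner_Integration.integrable_add Bochner_Integration.integrable_sum
      weak_pieces_integrable[OF I \<phi>] lb)

lemma initial_integrable:
  fixes \<phi> :: "real \<times> (real^'n) \<Rightarrow> real"
  assumes I: "time_interval I" and \<phi>: "C1_data I T R \<phi> \<phi>'"
    and w0: "w0 \<in> borel_measurable lebesgue" "\<And>x. \<bar>w0 x\<bar> \<le> C"
  shows "integrable lebesgue (\<lambda>x. w0 x * \<phi> (0, x))"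
proof -
  have I0: "0 \<in> I" using I unfolding time_interval_def by auto
  have m: "(\<lambda>x. \<phi> (0, x)) \<in> borel_measurable lebesgue"
    using initial_trace_continuous[OF I \<phi>] by (intro measurable_completion) (simp add: borel_measurable_continuous_onI)
  have "\<exists>B. \<forall>z\<in>I \<times> UNIV. \<bar>\<phi> z\<bar> \<le> B"
    by (rule continuous_on_bounded_support[OF I C1_dataD(1)[OF \<phi>] C1_dataD(7)[OF \<phi>] C1_dataD(5)[OF \<phi>]]) blast+
  then obtain B where B: "\<And>z. z \<in> I \<times> UNIV \<Longrightarrow> \<bar>\<phi> z\<bar> \<le> B" by blast
  show ?thesis
  proof (rule integrable_bounded_support_lebesgue[of _ R "C * B"])
    show "(\<lambda>x. w0 x * \<phi> (0, x)) \<in> borel_measurable lebesgue" using w0 m by auto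
    show "w0 x * \<phi> (0, x) = 0" if "norm x \<ge> R" for x using C1_dataD(5)[OF \<phi> I0] that by simp
    show "\<bar>w0 x * \<phi> (0, x)\<bar> \<le> C * B" for x
      unfolding abs_mult using w0(2)[of x] B[of "(0, x)"] I0 by (intro mult_mono) (auto intro: order_trans[OF abs_ge_zero])
  qed
qed

lemma weak_form_linear:
  assumes I: "time_interval I" and \<phi>: "C1_data I T R \<phi> \<phi>'"
    and 1: "locally_bounded I w1" "\<And>i. locally_bounded I (b1 i)" "locally_bounded I c1"
      "w01 \<in> borel_measurable lebesgue" "\<And>x. \<bar>w01 x\<bar> \<le> C1"
    and 2: "locally_bounded I w2" "\<And>i. locally_bounded I (b2 i)" "locally_bounded I c2"
      "w02 \<in> borel_measurable lebesgue" "\<And>x. \<bar>w02 x\<bar> \<le> C2"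
  shows "weak_form I (\<lambda>z. \<alpha> * w1 z + \<beta> * w2 z) (\<lambda>i z. \<alpha> * b1 i z + \<beta> * b2 i z) (\<lambda>z. \<alpha> * c1 z + \<beta> * c2 z)
      (\<lambda>x. \<alpha> * w01 x + \<beta> * w02 x) \<phi> \<phi>' = \<alpha> * weak_form I w1 b1 c1 w01 \<phi> \<phi>' + \<beta> * weak_form I w2 b2 c2 w02 \<phi> \<phi>'"
proof -
  have a: "weak_integrand (\<lambda>z. \<alpha> * w1 z + \<beta> * w2 z) (\<lambda>i z. \<alpha> * b1 i z + \<beta> * b2 i z) (\<lambda>z. \<alpha> * c1 z + \<beta> * c2 z) \<phi> \<phi>' z =
    \<alpha> * weak_integrand w1 b1 c1 \<phi> \<phi>' z + \<beta> * weak_integrand w2 b2 c2 \<phi> \<phi>' z" for z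
    by (simp add: weak_integrand_def algebra_simps sum.distrib sum_distrib_left)
  have b: "(\<alpha> * w01 x + \<beta> * w02 x) * \<phi> (0, x) = \<alpha> * (w01 x * \<phi> (0, x)) + \<beta> * (w02 x * \<phi> (0, x))" for x
    by (simp add: algebra_simps)
  show ?thesis unfolding weak_form_alt a b
    using weak_integrand_integrable[OF I \<phi> 1(1-3)] weak_integrand_integrable[OF I \<phi> 2(1-3)]
      initial_integrable[OF I \<phi> 1(4,5)] initial_integrable[OF I \<phi> 2(4,5)]
    by (simp add: algebra_simps)
qed

text \<open>
  A flux and a density that do not involve the unknown solve the equation whose source is their
  divergence: the time part is the fundamental theorem of calculus, the space part is integration by
  parts in each coordinate.
\<close>

lemma weak_form_trivial:
  fixes G :: "real \<times> (real^'n) \<times> real \<Rightarrow> real^'n"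
  assumes I: "time_interval I" and \<phi>: "C1_data I T R \<phi> \<phi>'" and G: "G \<in> class_F I"
  shows "weak_form I (\<lambda>z. e) (\<lambda>i z. G (fst z, snd z, k) $ i) (\<lambda>z. div_x G (fst z, snd z, k)) (\<lambda>x. e) \<phi> \<phi>' = 0"
proof -
  let ?M = "lebesgue_on (I \<times> (UNIV :: (real^'n) set))"
  let ?w' = "\<lambda>i z. pderiv_x i (\<lambda>y. G (fst z, y, k)) (snd z) $ i"
  have sub: "I \<subseteq> closure I" by (rule closure_subset)
  have cw: "continuous_on (I \<times> UNIV) (\<lambda>z. G (fst z, snd z, k) $ i)" for i
    by (intro continuous_on_component continuous_on_compose2[OF class_F_derivatives(1)[OF G]] continuous_intros)
      (use sub in auto)
  have cw': "continuous_on (I \<times> UNIV) (?w' i)" for i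
    using sub by (intro continuous_on_component continuous_on_compose2[OF class_F_derivatives(4)[OF G, of i],
          of _ "\<lambda>z. (fst z, snd z, k)", unfolded split_beta fst_conv snd_conv] continuous_intros) auto
  have "((\<lambda>s. G (t, x + s *\<^sub>R axis i 1, k) $ i) has_real_derivative ?w' i (t, x)) (at 0)" if "t \<in> I" for t x i
    using bounded_linear.has_vector_derivative[OF bounded_linear_vec_nth class_F_derivatives(3)[OF G, of t x i k 0], of i] sub that
    by (simp add: has_real_derivative_iff_has_vector_derivative subset_iff)
  then have parts: "(LINT z|?M. G (fst z, snd z, k) $ i * \<phi>' z (0, axis i 1) + ?w' i z * \<phi> z) = 0" for i
    by (intro integral_by_parts_x[OF I \<phi> cw cw']) simp
  have i: "integrable ?M (\<lambda>z. G (fst z, snd z, k) $ i * \<phi>' z (0, axis i 1) + ?w' i z * \<phi> z)" for i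
  proof -
    note d = C1_dataD[OF \<phi>]
    have "integrable ?M (\<lambda>z. 1 * (G (fst z, snd z, k) $ i * \<phi>' z (0, axis i 1) + ?w' i z * \<phi> z))"
      by (rule integrable_locally_bounded_mult[OF I d(1) locally_bounded_const, of _ R])
        (use d(5,6) in \<open>auto intro!: continuous_intros cw cw' d(4,7)\<close>)
    then show ?thesis by simp
  qed
  have i0: "integrable ?M (\<lambda>z. e * \<phi>' z (1, 0))" by (rule weak_pieces_integrable(1)[OF I \<phi> locally_bounded_const])
  have "weak_integrand (\<lambda>z. e) (\<lambda>i z. G (fst z, snd z, k) $ i) (\<lambda>z. div_x G (fst z, snd z, k)) \<phi> \<phi>' z =
    e * \<phi>' z (1, 0) + (\<Sum>i\<in>UNIV. G (fst z, snd z, k) $ i * \<phi>' z (0, axis i 1) + ?w' i z * \<phi> z)" for z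
    by (simp add: weak_integrand_def div_x_def sum.distrib sum_distrib_right)
  then have "(LINT z|?M. weak_integrand (\<lambda>z. e) (\<lambda>i z. G (fst z, snd z, k) $ i) (\<lambda>z. div_x G (fst z, snd z, k)) \<phi> \<phi>' z) =
    (LINT z|?M. e * \<phi>' z (1, 0)) + (\<Sum>i\<in>UNIV. LINT z|?M. G (fst z, snd z, k) $ i * \<phi>' z (0, axis i 1) + ?w' i z * \<phi> z)"
    using i i0 by (simp add: Bochner_Integration.integral_sum)
  also have "\<dots> = - e * (LINT x|lebesgue. \<phi> (0, x))"
    using parts integral_time_derivative[OF I \<phi>] by simp
  finally show ?thesis by (simp add: weak_form_alt)
qed

section \<open>Entropy productions as weak formulations\<close>

lemma iterated_flux:
  fixes \<phi> :: "real \<times> (real^'n) \<Rightarrow> real"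
  assumes I: "time_interval I" and \<phi>: "C1_data I T R \<phi> \<phi>'"
    and lb: "locally_bounded I w" "\<And>i. locally_bounded I (b i)"
    and ae: "AE z in lebesgue_on (I \<times> UNIV). w' z = w z \<and> (\<forall>i. b' z $ i = b i z)"
  shows "(LINT t:I|lebesgue. LINT x|lebesgue. w' (t, x) * d_t I \<phi> (t, x) + b' (t, x) \<bullet> grad_x \<phi> (t, x)) =
    (LINT z|lebesgue_on (I \<times> UNIV). w z * \<phi>' z (1, 0) + (\<Sum>i\<in>UNIV. b i z * \<phi>' z (0, axis i 1)))"
proof (rule iterated_integral_eq_AE[OF I, where h'="\<lambda>z. w' z * d_t I \<phi> z + b' z \<bullet> grad_x \<phi> z"])
  let ?M = "lebesgue_on (I \<times> (UNIV :: (real^'n) set))"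
  show "integrable ?M (\<lambda>z. w z * \<phi>' z (1, 0) + (\<Sum>i\<in>UNIV. b i z * \<phi>' z (0, axis i 1)))"
    by (intro Bochner_Integration.integrable_add Bochner_Integration.integrable_sum
      weak_pieces_integrable[OF I \<phi>] lb)
  have d: "d_t I \<phi> z = \<phi>' z (1, 0) \<and> grad_x \<phi> z = (\<chi> i. \<phi>' z (0, axis i 1))" if "z \<in> I \<times> UNIV" for z
  proof -
    obtain t x where z: "z = (t, x)" "t \<in> I" using \<open>z \<in> I \<times> UNIV\<close> by auto
    have "(\<phi> has_derivative \<phi>' (t, x)) (at (t, x) within I \<times> UNIV)" using C1_dataD(3)[OF \<phi>] z by auto
    then show ?thesis using d_t_eq[OF _ I z(2)] grad_x_eq[OF _ z(2)] z(1) by blast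
  qed
  show "AE z in ?M. w' z * d_t I \<phi> z + b' z \<bullet> grad_x \<phi> z =
     w z * \<phi>' z (1, 0) + (\<Sum>i\<in>UNIV. b i z * \<phi>' z (0, axis i 1))"
    using ae AE_space
  proof eventually_elim
    case (elim z)
    then have "z \<in> I \<times> UNIV" by simp
    then show ?case using elim d by (simp add: inner_vec_def)
  qed
qed

lemma iterated_source:
  fixes \<phi> :: "real \<times> (real^'n) \<Rightarrow> real"
  assumes I: "time_interval I" and \<phi>: "C1_data I T R \<phi> \<phi>'" and lb: "locally_bounded I c"
    and ae: "AE z in lebesgue_on (I \<times> UNIV). c' z = c z"
  shows "(LINT t:I|lebesgue. LINT x|lebesgue. c' (t, x) * \<phi> (t, x)) =
    (LINT z|lebesgue_on (I \<times> UNIV). c z * \<phi> z)"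
  by (rule iterated_integral_eq_AE[OF I weak_pieces_integrable(2)[OF I \<phi> lb], where h'="\<lambda>z. c' z * \<phi> z"])
    (use ae in eventually_elim, simp)

lemma initial_integral_cong:
  fixes \<phi> :: "real \<times> (real^'n) \<Rightarrow> real"
  assumes I: "time_interval I" and \<phi>: "C1_data I T R \<phi> \<phi>'"
    and w0: "w0 \<in> borel_measurable lebesgue" "AE x in lebesgue. w0' x = w0 x"
  shows "(LINT x|lebesgue. w0' x * \<phi> (0, x)) = (LINT x|lebesgue. w0 x * \<phi> (0, x))"
proof -
  have m: "(\<lambda>x. \<phi> (0, x)) \<in> borel_measurable lebesgue"
    using initial_trace_continuous[OF I \<phi>] by (intro measurable_completion) (simp add: borel_measurable_continuous_onI)
  have ae: "AE x in lborel. w0' x = w0 x" using w0(2) by (simp add: AE_completion_iff)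
  have "w0' \<in> borel_measurable lebesgue" by (rule borel_measurable_lebesgue_AE[OF ae w0(1)])
  then show ?thesis using m w0 by (intro integral_cong_AE) (auto elim: eventually_mono)
qed

lemma weak_form_split:
  fixes \<phi> :: "real \<times> (real^'n) \<Rightarrow> real"
  assumes I: "time_interval I" and \<phi>: "C1_data I T R \<phi> \<phi>'"
    and lb: "locally_bounded I w" "\<And>i. locally_bounded I (b i)" "locally_bounded I c"
  shows "weak_form I w b c w0 \<phi> \<phi>' =
    (LINT z|lebesgue_on (I \<times> UNIV). w z * \<phi>' z (1, 0) + (\<Sum>i\<in>UNIV. b i z * \<phi>' z (0, axis i 1)))
    + (LINT z|lebesgue_on (I \<times> UNIV). c z * \<phi> z) + (LINT x|lebesgue. w0 x * \<phi> (0, x))"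
proof -
  have "integrable (lebesgue_on (I \<times> UNIV)) (\<lambda>z. w z * \<phi>' z (1, 0) + (\<Sum>i\<in>UNIV. b i z * \<phi>' z (0, axis i 1)))"
    by (intro Bochner_Integration.integrable_add Bochner_Integration.integrable_sum
      weak_pieces_integrable[OF I \<phi>] lb)
  then show ?thesis unfolding weak_form_def
    using weak_pieces_integrable(2)[OF I \<phi> lb(3)] by (simp add: Bochner_Integration.integral_add)
qed

text \<open>
  Here \<open>v\<close> is a representative of \<open>u\<close> with values in \<open>[l, r]\<close> at every point, so that no exceptional sets
  have to be carried through the estimates.
\<close>

locale bounded_state =
  fixes I :: "real set" and f :: "real \<times> (real^'n) \<times> real \<Rightarrow> real^'n"
    and g :: "real \<times> (real^'n) \<times> real \<Rightarrow> real"
    and u v :: "real \<times> (real^'n) \<Rightarrow> real" and l r :: real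
  assumes I: "time_interval I" and f: "f \<in> class_F I" and g: "continuous_on (closure I \<times> UNIV) g"
    and v: "v \<in> borel_measurable (lebesgue_on (I \<times> UNIV))" "\<And>z. l \<le> v z" "\<And>z. v z \<le> r"
    and uv: "AE z in lebesgue_on (I \<times> UNIV). u z = v z"
begin

lemma AE_state: "(\<And>z. u z = v z \<Longrightarrow> P z) \<Longrightarrow> AE z in lebesgue_on (I \<times> UNIV). P z"
  using uv by (auto elim: eventually_mono)

lemma locally_bounded_at_state: "continuous_on (closure I \<times> UNIV) (G :: real \<times> (real^'n) \<times> real \<Rightarrow> real) \<Longrightarrow> locally_bounded I (\<lambda>z. G (fst z, snd z, v z))"
  by (rule locally_bounded_compose[OF I _ v])

lemma locally_bounded_at_level: "continuous_on (closure I \<times> UNIV) (G :: real \<times> (real^'n) \<times> real \<Rightarrow> real) \<Longrightarrow> locally_bounded I (\<lambda>z. G (fst z, snd z, k))"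
  by (rule locally_bounded_compose[OF I, of G "\<lambda>z. k" k k]) auto

lemma locally_bounded_fun_state: "continuous_on UNIV e \<Longrightarrow> locally_bounded I (\<lambda>z. e (v z))"
  using locally_bounded_at_state[of "\<lambda>p. e (snd (snd p))"] continuous_on_compose2[of UNIV e "closure I \<times> UNIV" "\<lambda>p. snd (snd p)"]
  by (simp add: continuous_on_snd)

lemma locally_bounded_sgn: "locally_bounded I (\<lambda>z. sgn (v z - k))"
  using v(1) by (intro locally_boundedI[of _ _ 1]) (auto simp: sgn_if)

lemma continuous_class_F_component: "F \<in> class_F I \<Longrightarrow> continuous_on (closure I \<times> UNIV) (\<lambda>p. (F p :: real^'n) $ i)"
  by (intro continuous_on_component class_F_derivatives(1))

abbreviation conservation_form where
  "conservation_form \<equiv> weak_form I v (\<lambda>i z. f (fst z, snd z, v z) $ i) (\<lambda>z. g (fst z, snd z, v z))"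

lemma locally_bounded_conservation: "locally_bounded I v" "locally_bounded I (\<lambda>z. f (fst z, snd z, v z) $ i)"
    "locally_bounded I (\<lambda>z. g (fst z, snd z, v z))"
  using locally_bounded_fun_state[of "\<lambda>k. k"] locally_bounded_at_state[OF continuous_class_F_component[OF f, of i]] locally_bounded_at_state[OF g] by auto

lemma distributional_eq_conservation_form:
  assumes \<phi>: "C1_data I T R \<phi> \<phi>'" and w0: "w0 \<in> borel_measurable lebesgue" "AE x in lebesgue. uo x = w0 x"
  shows "(LINT t:I|lebesgue. LINT x|lebesgue. u (t, x) * d_t I \<phi> (t, x) + f (t, x, u (t, x)) \<bullet> grad_x \<phi> (t, x))
     + (LINT t:I|lebesgue. LINT x|lebesgue. g (t, x, u (t, x)) * \<phi> (t, x))
     + (LINT x|lebesgue. uo x * \<phi> (0, x)) = conservation_form w0 \<phi> \<phi>'"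
proof -
  have 1: "(LINT t:I|lebesgue. LINT x|lebesgue. u (t, x) * d_t I \<phi> (t, x) + f (t, x, u (t, x)) \<bullet> grad_x \<phi> (t, x)) =
    (LINT z|lebesgue_on (I \<times> UNIV). v z * \<phi>' z (1, 0) + (\<Sum>i\<in>UNIV. f (fst z, snd z, v z) $ i * \<phi>' z (0, axis i 1)))"
    using iterated_flux[OF I \<phi> locally_bounded_conservation(1), where b="\<lambda>i z. f (fst z, snd z, v z) $ i" and w'=u
        and b'="\<lambda>z. f (fst z, snd z, u z)", OF locally_bounded_conservation(2) AE_state] by simp
  have 2: "(LINT t:I|lebesgue. LINT x|lebesgue. g (t, x, u (t, x)) * \<phi> (t, x)) =
    (LINT z|lebesgue_on (I \<times> UNIV). g (fst z, snd z, v z) * \<phi> z)"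
    using iterated_source[OF I \<phi> locally_bounded_conservation(3), of "\<lambda>z. g (fst z, snd z, u z)", OF AE_state] by simp
  show ?thesis unfolding weak_form_split[OF I \<phi> locally_bounded_conservation] 1 2 initial_integral_cong[OF I \<phi> w0] ..
qed

abbreviation entropy_form where
  "entropy_form E F \<equiv> weak_form I (\<lambda>z. E (v z)) (\<lambda>i z. F (fst z, snd z, v z) $ i)
     (\<lambda>z. - (deriv E (v z) * div_x f (fst z, snd z, v z)) + div_x F (fst z, snd z, v z)
        + deriv E (v z) * g (fst z, snd z, v z))"

lemma locally_bounded_entropy:
  assumes "Ck_on 2 UNIV E" "F \<in> entropy_flux I f E"
  shows "locally_bounded I (\<lambda>z. E (v z))" "locally_bounded I (\<lambda>z. F (fst z, snd z, v z) $ i)"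
    "locally_bounded I (\<lambda>z. deriv E (v z) * div_x f (fst z, snd z, v z))"
    "locally_bounded I (\<lambda>z. div_x F (fst z, snd z, v z))"
    "locally_bounded I (\<lambda>z. deriv E (v z) * g (fst z, snd z, v z))"
    "locally_bounded I (\<lambda>z. - (deriv E (v z) * div_x f (fst z, snd z, v z)) + div_x F (fst z, snd z, v z)
        + deriv E (v z) * g (fst z, snd z, v z))"
proof -
  have F: "F \<in> class_F I" using assms(2) unfolding entropy_flux_def by blast
  note E = C2_deriv[OF assms(1)]
  show "locally_bounded I (\<lambda>z. E (v z))" "locally_bounded I (\<lambda>z. F (fst z, snd z, v z) $ i)"
    using locally_bounded_fun_state[OF E(4)] locally_bounded_at_state[OF continuous_class_F_component[OF F]] by auto
  show a: "locally_bounded I (\<lambda>z. deriv E (v z) * div_x f (fst z, snd z, v z))"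
    and b: "locally_bounded I (\<lambda>z. div_x F (fst z, snd z, v z))"
    and c: "locally_bounded I (\<lambda>z. deriv E (v z) * g (fst z, snd z, v z))"
    by (intro locally_bounded_mult locally_bounded_fun_state[OF E(5)] locally_bounded_at_state continuous_div_x f F g)+
  have "locally_bounded I (\<lambda>z. (0 - deriv E (v z) * div_x f (fst z, snd z, v z)) + div_x F (fst z, snd z, v z)
        + deriv E (v z) * g (fst z, snd z, v z))"
    by (intro locally_bounded_add locally_bounded_diff locally_bounded_const a b c)
  then show "locally_bounded I (\<lambda>z. - (deriv E (v z) * div_x f (fst z, snd z, v z)) + div_x F (fst z, snd z, v z)
        + deriv E (v z) * g (fst z, snd z, v z))" by simp
qed

lemma entropy_production_eq_entropy_form:
  assumes \<phi>: "C1_data I T R \<phi> \<phi>'" and E: "Ck_on 2 UNIV E" and F: "F \<in> entropy_flux I f E"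
    and w0: "w0 \<in> borel_measurable lebesgue" "AE x in lebesgue. uo x = w0 x"
  shows "entropy_production I f g uo u E F \<phi> = entropy_form E F (\<lambda>x. E (w0 x)) \<phi> \<phi>'"
proof -
  let ?M = "lebesgue_on (I \<times> (UNIV :: (real^'n) set))"
  note lb = locally_bounded_entropy[OF E F]
  have 1: "(LINT t:I|lebesgue. LINT x|lebesgue. E (u (t, x)) * d_t I \<phi> (t, x) + F (t, x, u (t, x)) \<bullet> grad_x \<phi> (t, x)) =
    (LINT z|?M. E (v z) * \<phi>' z (1, 0) + (\<Sum>i\<in>UNIV. F (fst z, snd z, v z) $ i * \<phi>' z (0, axis i 1)))"
    using iterated_flux[OF I \<phi> lb(1), where b="\<lambda>i z. F (fst z, snd z, v z) $ i" and w'="\<lambda>z. E (u z)"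
        and b'="\<lambda>z. F (fst z, snd z, u z)", OF lb(2) AE_state] by simp
  have 2: "(LINT t:I|lebesgue. LINT x|lebesgue. deriv E (u (t, x)) * div_x f (t, x, u (t, x)) * \<phi> (t, x)) =
    (LINT z|?M. deriv E (v z) * div_x f (fst z, snd z, v z) * \<phi> z)"
    using iterated_source[OF I \<phi> lb(3), of "\<lambda>z. deriv E (u z) * div_x f (fst z, snd z, u z)", OF AE_state] by simp
  have 3: "(LINT t:I|lebesgue. LINT x|lebesgue. div_x F (t, x, u (t, x)) * \<phi> (t, x)) =
    (LINT z|?M. div_x F (fst z, snd z, v z) * \<phi> z)"
    using iterated_source[OF I \<phi> lb(4), of "\<lambda>z. div_x F (fst z, snd z, u z)", OF AE_state] by simp
  have 4: "(LINT t:I|lebesgue. LINT x|lebesgue. deriv E (u (t, x)) * g (t, x, u (t, x)) * \<phi> (t, x)) =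
    (LINT z|?M. deriv E (v z) * g (fst z, snd z, v z) * \<phi> z)"
    using iterated_source[OF I \<phi> lb(5), of "\<lambda>z. deriv E (u z) * g (fst z, snd z, u z)", OF AE_state] by simp
  have "E \<in> borel_measurable borel" using C2_deriv(4)[OF E] by (rule borel_measurable_continuous_onI)
  then have m: "(\<lambda>x. E (w0 x)) \<in> borel_measurable lebesgue" using w0(1) by measurable
  have ae: "AE x in lebesgue. E (uo x) = E (w0 x)" using w0(2) by eventually_elim simp
  have "(LINT z|?M. (- (deriv E (v z) * div_x f (fst z, snd z, v z)) + div_x F (fst z, snd z, v z)
        + deriv E (v z) * g (fst z, snd z, v z)) * \<phi> z) =
     (LINT z|?M. - (deriv E (v z) * div_x f (fst z, snd z, v z) * \<phi> z) + div_x F (fst z, snd z, v z) * \<phi> z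
        + deriv E (v z) * g (fst z, snd z, v z) * \<phi> z)"
    by (simp add: algebra_simps)
  also have "\<dots> = - (LINT z|?M. deriv E (v z) * div_x f (fst z, snd z, v z) * \<phi> z) + (LINT z|?M. div_x F (fst z, snd z, v z) * \<phi> z)
     + (LINT z|?M. deriv E (v z) * g (fst z, snd z, v z) * \<phi> z)"
    using weak_pieces_integrable(2)[OF I \<phi> lb(3)] weak_pieces_integrable(2)[OF I \<phi> lb(4)] weak_pieces_integrable(2)[OF I \<phi> lb(5)]
    by (simp add: Bochner_Integration.integral_add)
  finally show ?thesis
    unfolding entropy_production_def weak_form_split[OF I \<phi> lb(1,2,6)] 1 2 3 4 initial_integral_cong[OF I \<phi> m ae] by simp
qed

abbreviation kruzhkov_source where
  "kruzhkov_source k z \<equiv> sgn (v z - k) * (g (fst z, snd z, v z) - div_x f (fst z, snd z, k))"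

abbreviation kruzhkov_form where
  "kruzhkov_form k \<equiv> weak_form I (\<lambda>z. \<bar>v z - k\<bar>) (\<lambda>i z. kruzhkov_flux f (fst z) (snd z) (v z) k $ i) (kruzhkov_source k)"

lemma locally_bounded_kruzhkov: "locally_bounded I (\<lambda>z. \<bar>v z - k\<bar>)"
    "locally_bounded I (\<lambda>z. kruzhkov_flux f (fst z) (snd z) (v z) k $ i)" "locally_bounded I (kruzhkov_source k)"
    "locally_bounded I (\<lambda>z. sgn (v z - k) * div_x f (fst z, snd z, k))"
    "locally_bounded I (\<lambda>z. sgn (v z - k) * g (fst z, snd z, v z))"
proof -
  show "locally_bounded I (\<lambda>z. \<bar>v z - k\<bar>)" by (rule locally_bounded_fun_state[of "\<lambda>w. \<bar>w - k\<bar>"]) (intro continuous_intros)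
  have "locally_bounded I (\<lambda>z. sgn (v z - k) * (f (fst z, snd z, v z) $ i - f (fst z, snd z, k) $ i))"
    by (intro locally_bounded_mult locally_bounded_diff locally_bounded_sgn locally_bounded_at_state[where G="\<lambda>p. f p $ i"] locally_bounded_at_level[where G="\<lambda>p. f p $ i"] continuous_class_F_component f)
  then show "locally_bounded I (\<lambda>z. kruzhkov_flux f (fst z) (snd z) (v z) k $ i)" by (simp add: kruzhkov_flux_def)
  show "locally_bounded I (kruzhkov_source k)" "locally_bounded I (\<lambda>z. sgn (v z - k) * div_x f (fst z, snd z, k))"
    "locally_bounded I (\<lambda>z. sgn (v z - k) * g (fst z, snd z, v z))"
    by (intro locally_bounded_mult locally_bounded_diff locally_bounded_sgn locally_bounded_at_state locally_bounded_at_level continuous_div_x f g)+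
qed

lemma kruzhkov_production_eq_kruzhkov_form:
  assumes \<phi>: "C1_data I T R \<phi> \<phi>'"
    and w0: "w0 \<in> borel_measurable lebesgue" "AE x in lebesgue. uo x = w0 x"
  shows "kruzhkov_production I f g uo u k \<phi> = kruzhkov_form k (\<lambda>x. \<bar>w0 x - k\<bar>) \<phi> \<phi>'"
proof -
  let ?M = "lebesgue_on (I \<times> (UNIV :: (real^'n) set))"
  note lb = locally_bounded_kruzhkov[of k]
  have 1: "(LINT t:I|lebesgue. LINT x|lebesgue. \<bar>u (t, x) - k\<bar> * d_t I \<phi> (t, x) + kruzhkov_flux f t x (u (t, x)) k \<bullet> grad_x \<phi> (t, x)) =
    (LINT z|?M. \<bar>v z - k\<bar> * \<phi>' z (1, 0) + (\<Sum>i\<in>UNIV. kruzhkov_flux f (fst z) (snd z) (v z) k $ i * \<phi>' z (0, axis i 1)))"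
    using iterated_flux[OF I \<phi> lb(1), where b="\<lambda>i z. kruzhkov_flux f (fst z) (snd z) (v z) k $ i"
        and w'="\<lambda>z. \<bar>u z - k\<bar>" and b'="\<lambda>z. kruzhkov_flux f (fst z) (snd z) (u z) k", OF lb(2) AE_state] by simp
  have 2: "(LINT t:I|lebesgue. LINT x|lebesgue. sgn (u (t, x) - k) * div_x f (t, x, k) * \<phi> (t, x)) =
    (LINT z|?M. sgn (v z - k) * div_x f (fst z, snd z, k) * \<phi> z)"
    using iterated_source[OF I \<phi> lb(4), of "\<lambda>z. sgn (u z - k) * div_x f (fst z, snd z, k)", OF AE_state] by simp
  have 3: "(LINT t:I|lebesgue. LINT x|lebesgue. sgn (u (t, x) - k) * g (t, x, u (t, x)) * \<phi> (t, x)) =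
    (LINT z|?M. sgn (v z - k) * g (fst z, snd z, v z) * \<phi> z)"
    using iterated_source[OF I \<phi> lb(5), of "\<lambda>z. sgn (u z - k) * g (fst z, snd z, u z)", OF AE_state] by simp
  have m: "(\<lambda>x. \<bar>w0 x - k\<bar>) \<in> borel_measurable lebesgue" using w0(1) by measurable
  have ae: "AE x in lebesgue. \<bar>uo x - k\<bar> = \<bar>w0 x - k\<bar>" using w0(2) by eventually_elim simp
  have "(LINT z|?M. kruzhkov_source k z * \<phi> z) = (LINT z|?M. sgn (v z - k) * g (fst z, snd z, v z) * \<phi> z - sgn (v z - k) * div_x f (fst z, snd z, k) * \<phi> z)"
    by (simp add: algebra_simps)
  also have "\<dots> = (LINT z|?M. sgn (v z - k) * g (fst z, snd z, v z) * \<phi> z) - (LINT z|?M. sgn (v z - k) * div_x f (fst z, snd z, k) * \<phi> z)"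
    by (intro Bochner_Integration.integral_diff weak_pieces_integrable(2)[OF I \<phi>] lb)
  finally show ?thesis
    unfolding kruzhkov_production_def weak_form_split[OF I \<phi> lb(1-3)] 1 2 3 initial_integral_cong[OF I \<phi> m ae] by simp
qed

end

section \<open>Integration over the Kruzhkov parameter\<close>

text \<open>
  The counterpart of local boundedness for functions that depend also on the Kruzhkov parameter
  \<open>k\<close>, with bounds uniform in \<open>k\<close>; it is what Fubini's theorem needs.
\<close>

definition parameter_bounded :: "real set \<Rightarrow> real \<Rightarrow> real \<Rightarrow> (real \<times> (real \<times> (real^'n)) \<Rightarrow> real) \<Rightarrow> bool" where
  "parameter_bounded I l r X \<longleftrightarrow>
     X \<in> borel_measurable (lebesgue_on {l..r} \<Otimes>\<^sub>M lebesgue_on (I \<times> UNIV)) \<and>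
     (\<forall>T\<in>I. \<forall>R. \<exists>B. \<forall>k\<in>{l..r}. \<forall>t\<in>I. \<forall>x. t \<le> T \<longrightarrow> norm x \<le> R \<longrightarrow> \<bar>X (k, t, x)\<bar> \<le> B)"

lemma parameter_bounded_op:
  assumes h: "parameter_bounded I l r X1" "parameter_bounded I l r X2"
    and m: "(\<lambda>z. op (X1 z) (X2 z)) \<in> borel_measurable (lebesgue_on {l..r} \<Otimes>\<^sub>M lebesgue_on (I \<times> UNIV))"
    and op: "\<And>a b A B. \<bar>a\<bar> \<le> A \<Longrightarrow> \<bar>b\<bar> \<le> B \<Longrightarrow> \<bar>op a b\<bar> \<le> bd A B"
  shows "parameter_bounded I l r (\<lambda>z. op (X1 z) (X2 z))"
  unfolding parameter_bounded_def
proof (intro conjI m ballI allI)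
  fix T R assume T: "T \<in> I"
  obtain A where A: "\<forall>k\<in>{l..r}. \<forall>t\<in>I. \<forall>x. t \<le> T \<longrightarrow> norm x \<le> R \<longrightarrow> \<bar>X1 (k, t, x)\<bar> \<le> A"
    using h(1) T unfolding parameter_bounded_def by meson
  obtain B where B: "\<forall>k\<in>{l..r}. \<forall>t\<in>I. \<forall>x. t \<le> T \<longrightarrow> norm x \<le> R \<longrightarrow> \<bar>X2 (k, t, x)\<bar> \<le> B"
    using h(2) T unfolding parameter_bounded_def by meson
  show "\<exists>B. \<forall>k\<in>{l..r}. \<forall>t\<in>I. \<forall>x. t \<le> T \<longrightarrow> norm x \<le> R \<longrightarrow> \<bar>op (X1 (k, t, x)) (X2 (k, t, x))\<bar> \<le> B"
    using A B op by (intro exI[of _ "bd A B"]) blast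
qed

lemma parameter_boundedD:
  "parameter_bounded I l r X \<Longrightarrow> X \<in> borel_measurable (lebesgue_on {l..r} \<Otimes>\<^sub>M lebesgue_on (I \<times> UNIV))"
  unfolding parameter_bounded_def by blast

lemma parameter_bounded_diff:
  "parameter_bounded I l r X1 \<Longrightarrow> parameter_bounded I l r X2 \<Longrightarrow> parameter_bounded I l r (\<lambda>z. X1 z - X2 z)"
  by (rule parameter_bounded_op[where op="(-)" and bd="(+)"]) (auto intro: borel_measurable_diff parameter_boundedD)

lemma parameter_bounded_mult:
  "parameter_bounded I l r X1 \<Longrightarrow> parameter_bounded I l r X2 \<Longrightarrow> parameter_bounded I l r (\<lambda>z. X1 z * X2 z)"
  by (rule parameter_bounded_op[where op="(*)" and bd="(*)"])
    (auto simp: abs_mult intro!: mult_mono intro: borel_measurable_times parameter_boundedD order_trans[OF abs_ge_zero])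

lemma fst_parameter_measurable: "fst \<in> borel_measurable (lebesgue_on {l..r::real} \<Otimes>\<^sub>M N)"
proof -
  have "(\<lambda>k::real. k) \<in> borel_measurable (lebesgue_on {l..r})"
    by (intro continuous_imp_measurable_on_sets_lebesgue continuous_intros) auto
  then show ?thesis by (rule measurable_compose[OF measurable_fst])
qed

lemma parameter_bounded_state:
  assumes "locally_bounded I h"
  shows "parameter_bounded I l r (\<lambda>p. h (snd p))"
  unfolding parameter_bounded_def
proof (intro conjI)
  show "(\<lambda>p. h (snd p)) \<in> borel_measurable (lebesgue_on {l..r} \<Otimes>\<^sub>M lebesgue_on (I \<times> UNIV))"
    by (rule measurable_compose[OF measurable_snd locally_boundedD[OF assms]])
  show "\<forall>T\<in>I. \<forall>R. \<exists>B. \<forall>k\<in>{l..r}. \<forall>t\<in>I. \<forall>x. t \<le> T \<longrightarrow> norm x \<le> R \<longrightarrow> \<bar>h (snd (k, t, x))\<bar> \<le> B"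
    using assms unfolding locally_bounded_def by fastforce
qed

lemma parameter_bounded_level:
  assumes "continuous_on UNIV e"
  shows "parameter_bounded I l r (\<lambda>p. e (fst p))"
  unfolding parameter_bounded_def
proof (intro conjI)
  have "e \<in> borel_measurable borel" using assms by (rule borel_measurable_continuous_onI)
  then show "(\<lambda>p. e (fst p)) \<in> borel_measurable (lebesgue_on {l..r} \<Otimes>\<^sub>M lebesgue_on (I \<times> UNIV))"
    using measurable_compose[OF fst_parameter_measurable] by blast
  have "bounded (e ` {l..r})"
    by (intro compact_imp_bounded compact_continuous_image continuous_on_subset[OF assms]) auto
  then obtain B where "\<forall>y\<in>e ` {l..r}. norm y \<le> B" unfolding bounded_iff by blast
  then show "\<forall>T\<in>I. \<forall>R. \<exists>B. \<forall>k\<in>{l..r}. \<forall>t\<in>I. \<forall>x. t \<le> T \<longrightarrow> norm x \<le> R \<longrightarrow> \<bar>e (fst (k, t, x))\<bar> \<le> B"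
    by (intro ballI allI exI[of _ B]) auto
qed

lemma parameter_bounded_continuous:
  fixes G :: "real \<times> (real^'n) \<times> real \<Rightarrow> real"
  assumes I: "time_interval I" and G: "continuous_on (closure I \<times> UNIV) G"
  shows "parameter_bounded I l r (\<lambda>p. G (fst (snd p), snd (snd p), fst p))"
  unfolding parameter_bounded_def
proof (intro conjI ballI allI)
  show "(\<lambda>p. G (fst (snd p), snd (snd p), fst p)) \<in> borel_measurable (lebesgue_on {l..r} \<Otimes>\<^sub>M lebesgue_on (I \<times> UNIV))"
  proof (rule borel_measurable_compose_continuous_on[OF G])
    show "(\<lambda>p. (fst (snd p), snd (snd p), fst p)) \<in> borel_measurable (lebesgue_on {l..r} \<Otimes>\<^sub>M lebesgue_on (I \<times> (UNIV :: (real^'n) set)))"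
      by (intro borel_measurable_Pair fst_parameter_measurable
          measurable_compose[OF measurable_snd domain_projections_measurable(1)[OF I]]
          measurable_compose[OF measurable_snd domain_projections_measurable(2)[OF I]])
    show "(fst (snd p), snd (snd p), fst p) \<in> closure I \<times> UNIV"
      if "p \<in> space (lebesgue_on {l..r} \<Otimes>\<^sub>M lebesgue_on (I \<times> (UNIV :: (real^'n) set)))" for p
      using that closure_subset[of I] by (auto simp: space_pair_measure)
  qed
  fix T R assume "T \<in> I"
  then show "\<exists>B. \<forall>k\<in>{l..r}. \<forall>t\<in>I. \<forall>x. t \<le> T \<longrightarrow> norm x \<le> R \<longrightarrow>
     \<bar>G (fst (snd (k, t, x)), snd (snd (k, t, x)), fst (k, t, x))\<bar> \<le> B"
    using continuous_bounded_compact[OF I G, of T l r R] by fastforce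
qed

lemma parameter_bounded_sgn:
  assumes "locally_bounded I v"
  shows "parameter_bounded I l r (\<lambda>p. sgn (v (snd p) - fst p))"
  unfolding parameter_bounded_def
proof (intro conjI ballI allI)
  show "(\<lambda>p. sgn (v (snd p) - fst p)) \<in> borel_measurable (lebesgue_on {l..r} \<Otimes>\<^sub>M lebesgue_on (I \<times> UNIV))"
    using parameter_boundedD[OF parameter_bounded_state[OF assms]] fst_parameter_measurable by measurable
  show "\<exists>B. \<forall>k\<in>{l..r}. \<forall>t\<in>I. \<forall>x. t \<le> T \<longrightarrow> norm x \<le> R \<longrightarrow> \<bar>sgn (v (snd (k, t, x)) - fst (k, t, x))\<bar> \<le> B" for T R
    by (intro exI[of _ 1]) (auto simp: sgn_if)
qed

text \<open>
  The dominating function \<open>B q\<close> does not depend on \<open>k\<close>, and \<open>[l, r]\<close> has finite measure.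
\<close>

lemma integrable_product_bounded:
  fixes X :: "real \<times> 'a \<Rightarrow> real"
  assumes M: "sigma_finite_measure M" and q: "integrable M q"
    and X: "X \<in> borel_measurable (lebesgue_on {l..r} \<Otimes>\<^sub>M M)"
    and B: "\<And>k z. k \<in> {l..r} \<Longrightarrow> z \<in> space M \<Longrightarrow> \<bar>X (k, z) * q z\<bar> \<le> B * \<bar>q z\<bar>"
  shows "integrable (lebesgue_on {l..r} \<Otimes>\<^sub>M M) (\<lambda>p. X p * q (snd p))"
proof -
  let ?N = "lebesgue_on {l..r}"
  interpret M: sigma_finite_measure M by (rule M)
  interpret N: finite_measure ?N by (rule finite_measure_lebesgue_on) simp
  interpret P: pair_sigma_finite ?N M ..
  have qm: "(\<lambda>p. q (snd p)) \<in> borel_measurable (?N \<Otimes>\<^sub>M M)"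
    by (rule measurable_compose[OF measurable_snd borel_measurable_integrable[OF q]])
  have D: "integrable (?N \<Otimes>\<^sub>M M) (\<lambda>p. B * q (snd p))"
  proof (rule P.Fubini_integrable)
    show "(\<lambda>p. B * q (snd p)) \<in> borel_measurable (?N \<Otimes>\<^sub>M M)"
      by (intro borel_measurable_times borel_measurable_const qm)
  qed (use q in simp_all)
  show ?thesis
  proof (rule Bochner_Integration.integrable_bound[OF D])
    show "(\<lambda>p. X p * q (snd p)) \<in> borel_measurable (?N \<Otimes>\<^sub>M M)"
      by (intro borel_measurable_times X qm)
    show "AE p in ?N \<Otimes>\<^sub>M M. norm (X p * q (snd p)) \<le> norm (B * q (snd p))"
    proof (rule AE_I2)
      fix p assume "p \<in> space (?N \<Otimes>\<^sub>M M)"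
      then have "\<bar>X p * q (snd p)\<bar> \<le> B * \<bar>q (snd p)\<bar>"
        using B[of "fst p" "snd p"] by (auto simp: space_pair_measure)
      also have "\<dots> \<le> \<bar>B\<bar> * \<bar>q (snd p)\<bar>" by (intro mult_right_mono) auto
      finally show "norm (X p * q (snd p)) \<le> norm (B * q (snd p))" by (simp add: abs_mult)
    qed
  qed
qed

lemma integrable_parameter_bounded_mult:
  fixes X :: "real \<times> (real \<times> (real^'n)) \<Rightarrow> real"
  assumes I: "time_interval I" "T \<in> I" and X: "parameter_bounded I l r X"
    and q: "continuous_on (I \<times> UNIV) q"
    and off: "\<And>t x. t \<in> I \<Longrightarrow> t \<ge> T \<or> norm x \<ge> R \<Longrightarrow> q (t, x) = 0"
  shows "integrable (lebesgue_on {l..r} \<Otimes>\<^sub>M lebesgue_on (I \<times> UNIV)) (\<lambda>p. X p * q (snd p))"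
proof -
  obtain B where B: "\<forall>k\<in>{l..r}. \<forall>t\<in>I. \<forall>x. t \<le> T \<longrightarrow> norm x \<le> R \<longrightarrow> \<bar>X (k, t, x)\<bar> \<le> B"
    using X I(2) unfolding parameter_bounded_def by meson
  show ?thesis
  proof (rule integrable_product_bounded[OF _ _ parameter_boundedD[OF X]])
    show "sigma_finite_measure (lebesgue_on (I \<times> (UNIV :: (real^'n) set)))"
      by (rule sigma_finite_measure_restrict_space[OF sigma_finite_lebesgue time_interval_domain_lebesgue[OF I(1)]])
    show "integrable (lebesgue_on (I \<times> UNIV)) q"
      using integrable_locally_bounded_mult[OF I locally_bounded_const[of I 1] q off] by simp
    fix k z assume k: "k \<in> {l..r}" and "z \<in> space (lebesgue_on (I \<times> (UNIV :: (real^'n) set)))"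
    then obtain t x where z: "z = (t, x)" "t \<in> I" by auto
    show "\<bar>X (k, z) * q z\<bar> \<le> B * \<bar>q z\<bar>"
    proof (cases "t < T \<and> norm x < R")
      case True
      then have "\<bar>X (k, z)\<bar> \<le> B" using B k z by simp
      then show ?thesis unfolding abs_mult by (intro mult_right_mono) auto
    next
      case False
      then have "q z = 0" using off[of t x] z by (auto simp: not_less)
      then show ?thesis by simp
    qed
  qed
qed

context bounded_state
begin

lemma kruzhkov_integrand_integrable:
  assumes \<phi>: "C1_data I T R \<phi> \<phi>'" and e: "continuous_on UNIV e"
  shows "integrable (lebesgue_on {l..r} \<Otimes>\<^sub>M lebesgue_on (I \<times> UNIV))
    (\<lambda>(k, z). e k * weak_integrand (\<lambda>z. \<bar>v z - k\<bar>) (\<lambda>i z. kruzhkov_flux f (fst z) (snd z) (v z) k $ i) (kruzhkov_source k) \<phi> \<phi>' z)"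
proof -
  let ?NM = "lebesgue_on {l..r} \<Otimes>\<^sub>M lebesgue_on (I \<times> (UNIV :: (real^'n) set))"
  note d = C1_dataD[OF \<phi>]
  have pv: "parameter_bounded I l r (\<lambda>p. sgn (v (snd p) - fst p))"
    by (rule parameter_bounded_sgn[OF locally_bounded_conservation(1)])
  have pe: "parameter_bounded I l r (\<lambda>p. e (fst p))"
    by (rule parameter_bounded_level[OF e])
  have 1: "parameter_bounded I l r (\<lambda>p. e (fst p) * (sgn (v (snd p) - fst p) * (v (snd p) - fst p)))"
    by (intro parameter_bounded_mult parameter_bounded_diff pv pe parameter_bounded_state locally_bounded_conservation(1)
        parameter_bounded_level[where e="\<lambda>k. k"] continuous_intros)
  have 2: "parameter_bounded I l r (\<lambda>p. e (fst p) * (sgn (v (snd p) - fst p) *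
      (f (fst (snd p), snd (snd p), v (snd p)) $ i - f (fst (snd p), snd (snd p), fst p) $ i)))" for i
    by (intro parameter_bounded_mult parameter_bounded_diff pv pe
        parameter_bounded_state[where h="\<lambda>z. f (fst z, snd z, v z) $ i"] locally_bounded_conservation(2)
        parameter_bounded_continuous[OF I, where G="\<lambda>p. f p $ i"] continuous_class_F_component f)
  have 3: "parameter_bounded I l r (\<lambda>p. e (fst p) * (sgn (v (snd p) - fst p) *
      (g (fst (snd p), snd (snd p), v (snd p)) - div_x f (fst (snd p), snd (snd p), fst p))))"
    by (intro parameter_bounded_mult parameter_bounded_diff pv pe
        parameter_bounded_state[where h="\<lambda>z. g (fst z, snd z, v z)"] locally_bounded_conservation(3)
        parameter_bounded_continuous[OF I] continuous_div_x f)
  have "integrable ?NM (\<lambda>p. (e (fst p) * (sgn (v (snd p) - fst p) * (v (snd p) - fst p))) * \<phi>' (snd p) (1, 0)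
     + (\<Sum>i\<in>UNIV. (e (fst p) * (sgn (v (snd p) - fst p) *
      (f (fst (snd p), snd (snd p), v (snd p)) $ i - f (fst (snd p), snd (snd p), fst p) $ i))) * \<phi>' (snd p) (0, axis i 1))
     + (e (fst p) * (sgn (v (snd p) - fst p) *
      (g (fst (snd p), snd (snd p), v (snd p)) - div_x f (fst (snd p), snd (snd p), fst p)))) * \<phi> (snd p))"
    by (intro Bochner_Integration.integrable_add Bochner_Integration.integrable_sum
        integrable_parameter_bounded_mult[OF I d(1) 1 d(4) d(6)] integrable_parameter_bounded_mult[OF I d(1) 2 d(4) d(6)]
        integrable_parameter_bounded_mult[OF I d(1) 3 d(7) d(5)])
  then show ?thesis
    by (rule Bochner_Integration.integrable_cong[THEN iffD1, OF refl, rotated])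
      (auto simp: weak_integrand_def kruzhkov_flux_def abs_sgn algebra_simps sum_distrib_left)
qed

lemma initial_parameter_integrable:
  fixes w0 :: "real^'n \<Rightarrow> real"
  assumes \<phi>: "C1_data I T R \<phi> \<phi>'" and e: "continuous_on UNIV e"
    and w0: "w0 \<in> borel_measurable lebesgue" "\<And>x. l \<le> w0 x" "\<And>x. w0 x \<le> r"
  shows "integrable (lebesgue_on {l..r} \<Otimes>\<^sub>M lebesgue) (\<lambda>(k, x). e k * (\<bar>w0 x - k\<bar> * \<phi> (0, x)))"
proof -
  let ?NL = "lebesgue_on {l..r} \<Otimes>\<^sub>M (lebesgue :: (real^'n) measure)"
  have "bounded (e ` {l..r})"
    by (intro compact_imp_bounded compact_continuous_image continuous_on_subset[OF e]) auto
  then obtain B where B: "\<forall>y\<in>e ` {l..r}. norm y \<le> B" unfolding bounded_iff by blast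
  have em: "e \<in> borel_measurable borel" using e by (rule borel_measurable_continuous_onI)
  have "integrable ?NL (\<lambda>p. (e (fst p) * \<bar>w0 (snd p) - fst p\<bar>) * \<phi> (0, snd p))"
  proof (rule integrable_product_bounded[OF sigma_finite_lebesgue, where q="\<lambda>x. \<phi> (0, x)" and B="B * (r - l)"])
    show "integrable lebesgue (\<lambda>x. \<phi> (0, x))" using initial_integrable[OF I \<phi>, of "\<lambda>x. 1" 1] by simp
    have "(\<lambda>p. e (fst p)) \<in> borel_measurable ?NL" "(\<lambda>p. w0 (snd p)) \<in> borel_measurable ?NL" "fst \<in> borel_measurable ?NL"
      by (rule measurable_compose[OF fst_parameter_measurable em] measurable_compose[OF measurable_snd w0(1)]
          fst_parameter_measurable)+
    then show "(\<lambda>p. e (fst p) * \<bar>w0 (snd p) - fst p\<bar>) \<in> borel_measurable ?NL" by measurable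
    fix k x assume k: "k \<in> {l..r}"
    have "norm (e k) \<le> B" using B k by blast
    moreover have "\<bar>w0 x - k\<bar> \<le> r - l" using w0(2,3)[of x] k by auto
    ultimately have "\<bar>e k * \<bar>w0 x - k\<bar>\<bar> \<le> B * (r - l)" unfolding abs_mult by (intro mult_mono) auto
    then show "\<bar>(e (fst (k, x)) * \<bar>w0 (snd (k, x)) - fst (k, x)\<bar>) * \<phi> (0, x)\<bar> \<le> B * (r - l) * \<bar>\<phi> (0, x)\<bar>"
      by (simp only: fst_conv snd_conv abs_mult[of _ "\<phi> (0, x)"] mult_right_mono abs_ge_zero)
  qed
  then show ?thesis by (simp add: case_prod_unfold mult.assoc)
qed

text \<open>
  The core identity.  After exchanging the order of integration, the inner integral over \<open>k\<close> is
  \<open>2 Q(v) - Q(l) - Q(r)\<close>.  Here \<open>Q(v)\<close> is the integrand \<open>NE\<close> of the entropy production, while \<open>Q(k)\<close> for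
  \<open>k = l\<close> and \<open>k = r\<close> splits into \<open>E'(k)\<close> times the integrand \<open>ND\<close> of the conservation law and
  integrands \<open>NT\<close> that do not involve \<open>v\<close> and whose weak forms are trivial.
\<close>

lemma integral_kruzhkov_form:
  fixes w0 :: "real^'n \<Rightarrow> real"
  assumes \<phi>: "C1_data I T R \<phi> \<phi>'" and E: "Ck_on 2 UNIV E" and F: "F \<in> entropy_flux I f E"
    and w0: "w0 \<in> borel_measurable lebesgue" "\<And>x. l \<le> w0 x" "\<And>x. w0 x \<le> r"
  shows "(LINT k:{l..r}|lebesgue. deriv (deriv E) k * kruzhkov_form k (\<lambda>x. \<bar>w0 x - k\<bar>) \<phi> \<phi>') =
    2 * entropy_form E F (\<lambda>x. E (w0 x)) \<phi> \<phi>' - (deriv E l + deriv E r) * conservation_form w0 \<phi> \<phi>'"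
proof -
  let ?N = "lebesgue_on {l..r}" and ?L = "lebesgue :: (real^'n) measure"
  let ?M = "lebesgue_on (I \<times> (UNIV :: (real^'n) set))"
  let ?e = "deriv (deriv E)"
  note e = C2_deriv(3)[OF E]
  have F': "F \<in> class_F I" using F unfolding entropy_flux_def by blast
  interpret L: sigma_finite_measure ?L by (rule sigma_finite_lebesgue)
  interpret N: finite_measure ?N by (rule finite_measure_lebesgue_on) simp
  interpret M: sigma_finite_measure ?M
    by (rule sigma_finite_measure_restrict_space[OF sigma_finite_lebesgue time_interval_domain_lebesgue[OF I]])
  interpret P: pair_sigma_finite ?N ?M ..
  interpret P0: pair_sigma_finite ?N ?L ..
  define K where "K k z = ?e k * weak_integrand (\<lambda>z. \<bar>v z - k\<bar>) (\<lambda>i z. kruzhkov_flux f (fst z) (snd z) (v z) k $ i) (kruzhkov_source k) \<phi> \<phi>' z" for k z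
  define K0 where "K0 k x = ?e k * (\<bar>w0 x - k\<bar> * \<phi> (0, x))" for k x
  have Ki: "integrable (?N \<Otimes>\<^sub>M ?M) (case_prod K)"
    using kruzhkov_integrand_integrable[OF \<phi> e] by (simp add: K_def[abs_def])
  have K0i: "integrable (?N \<Otimes>\<^sub>M ?L) (case_prod K0)"
    using initial_parameter_integrable[OF \<phi> e w0] by (simp add: K0_def[abs_def])
  have "(LINT k:{l..r}|lebesgue. ?e k * kruzhkov_form k (\<lambda>x. \<bar>w0 x - k\<bar>) \<phi> \<phi>') =
    (LINT k|?N. (LINT z|?M. K k z) + (LINT x|?L. K0 k x))"
  proof -
    have "?e k * kruzhkov_form k (\<lambda>x. \<bar>w0 x - k\<bar>) \<phi> \<phi>' = (LINT z|?M. K k z) + (LINT x|?L. K0 k x)" for k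
      by (simp only: K_def K0_def weak_form_alt distrib_left integral_mult_right_zero)
    then show ?thesis unfolding set_lebesgue_integral_def by (subst integral_restrict_space) simp_all
  qed
  also have "\<dots> = (LINT k|?N. LINT z|?M. K k z) + (LINT k|?N. LINT x|?L. K0 k x)"
    by (rule Bochner_Integration.integral_add[OF P.integrable_fst[OF Ki] P0.integrable_fst[OF K0i]])
  also have "\<dots> = (LINT z|?M. LINT k|?N. K k z) + (LINT x|?L. LINT k|?N. K0 k x)"
    by (simp only: P.Fubini_integral[OF Ki] P0.Fubini_integral[OF K0i])
  finally have swap: "(LINT k:{l..r}|lebesgue. ?e k * kruzhkov_form k (\<lambda>x. \<bar>w0 x - k\<bar>) \<phi> \<phi>') =
    (LINT z|?M. LINT k|?N. K k z) + (LINT x|?L. LINT k|?N. K0 k x)" .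
  define NE where "NE = weak_integrand (\<lambda>z. E (v z)) (\<lambda>i z. F (fst z, snd z, v z) $ i)
     (\<lambda>z. - (deriv E (v z) * div_x f (fst z, snd z, v z)) + div_x F (fst z, snd z, v z)
        + deriv E (v z) * g (fst z, snd z, v z)) \<phi> \<phi>'"
  define ND where "ND = weak_integrand v (\<lambda>i z. f (fst z, snd z, v z) $ i) (\<lambda>z. g (fst z, snd z, v z)) \<phi> \<phi>'"
  define NT where "NT c G k = weak_integrand (\<lambda>z. c) (\<lambda>i z. G (fst z, snd z, k) $ i) (\<lambda>z. div_x G (fst z, snd z, k)) \<phi> \<phi>'"
    for c :: real and G :: "real \<times> (real^'n) \<times> real \<Rightarrow> real^'n" and k :: real
  \<comment> \<open>the value at 0 of the tangent to \<open>E\<close> at \<open>k\<close>\<close>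
  define c where "c k = E k - k * deriv E k" for k
  have iE: "integrable ?M NE" unfolding NE_def by (rule weak_integrand_integrable[OF I \<phi> locally_bounded_entropy(1,2,6)[OF E F]])
  have iD: "integrable ?M ND" unfolding ND_def by (rule weak_integrand_integrable[OF I \<phi> locally_bounded_conservation])
  have iT: "integrable ?M (NT a G k)" if "G \<in> class_F I" for a G k unfolding NT_def
    by (intro weak_integrand_integrable[OF I \<phi>] locally_bounded_const locally_bounded_at_level[where G="\<lambda>p. G p $ _"] locally_bounded_at_level[where G="div_x G"]
        continuous_class_F_component continuous_div_x that)
  define W where "W z = 2 * NE z - (deriv E l * ND z + NT (c l) F l z - deriv E l * NT 0 f l z)
      - (deriv E r * ND z + NT (c r) F r z - deriv E r * NT 0 f r z)" for z
  have inner: "(LINT k|?N. K k z) = W z"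
    if z: "z \<in> I \<times> UNIV" and int: "integrable ?N (\<lambda>k. K k z)" for z
  proof -
    obtain t x where tx: "z = (t, x)" "t \<in> I" using z by auto
    have t: "t \<in> closure I" using tx(2) closure_subset by blast
    let ?b = "\<chi> i. \<phi>' z (0, axis i 1)" and ?a = "\<phi>' z (1, 0)" and ?p = "\<phi> z" and ?c = "g (t, x, v z)"
    let ?Q = "\<lambda>k. deriv E k * ((v z - k) * ?a + (f (t, x, v z) - f (t, x, k)) \<bullet> ?b + (?c - div_x f (t, x, k)) * ?p)
      + (E k * ?a + F (t, x, k) \<bullet> ?b + div_x F (t, x, k) * ?p)"
    have Keq: "K k z = ?e k * (\<bar>v z - k\<bar> * ?a + kruzhkov_flux f t x (v z) k \<bullet> ?b
      - sgn (v z - k) * div_x f (t, x, k) * ?p + sgn (v z - k) * ?c * ?p)" for k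
      by (simp add: K_def weak_integrand_def tx inner_vec_def algebra_simps)
    have "((\<lambda>k. K k z) has_integral 2 * ?Q (v z) - ?Q l - ?Q r) {l..r}"
      unfolding Keq by (rule kruzhkov_integrand_has_integral[OF f F E t v(2,3)])
    then have "integral {l..r} (\<lambda>k. K k z) = 2 * ?Q (v z) - ?Q l - ?Q r" by (rule integral_unique)
    moreover have "(LINT k|?N. K k z) = integral {l..r} (\<lambda>k. K k z)"
      by (rule lebesgue_integral_eq_integral[OF int]) simp
    moreover have "NE z = ?Q (v z)"
      by (simp add: NE_def weak_integrand_def tx inner_vec_def algebra_simps)
    moreover have "deriv E k * ND z + NT (c k) F k z - deriv E k * NT 0 f k z = ?Q k" for k
      by (simp add: ND_def NT_def c_def weak_integrand_def tx inner_vec_def algebra_simps sum_distrib_left sum.distrib sum_subtractf)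
    ultimately show ?thesis by (simp add: W_def)
  qed
  have "(LINT z|?M. LINT k|?N. K k z) = (LINT z|?M. W z)"
  proof (rule integral_cong_AE)
    show "(\<lambda>z. LINT k|?N. K k z) \<in> borel_measurable ?M" using P.integrable_snd[OF Ki] by auto
    show "(\<lambda>z. W z) \<in> borel_measurable ?M"
      unfolding W_def using iE iD iT[OF F'] iT[OF f] by measurable
    show "AE z in ?M. (LINT k|?N. K k z) = W z"
      using P.AE_integrable_snd[OF Ki] AE_space
    proof eventually_elim
      case (elim z)
      then show ?case by (intro inner) auto
    qed
  qed
  also have "\<dots> = 2 * integral\<^sup>L ?M NE
      - (deriv E l * integral\<^sup>L ?M ND + integral\<^sup>L ?M (NT (c l) F l) - deriv E l * integral\<^sup>L ?M (NT 0 f l))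
      - (deriv E r * integral\<^sup>L ?M ND + integral\<^sup>L ?M (NT (c r) F r) - deriv E r * integral\<^sup>L ?M (NT 0 f r))"
    unfolding W_def using iE iD iT[OF F'] iT[OF f] by simp
  finally have main: "(LINT z|?M. LINT k|?N. K k z) = \<dots>" .
  have "\<bar>w0 x\<bar> \<le> \<bar>l\<bar> + \<bar>r\<bar>" for x using w0(2,3)[of x] by linarith
  note iw = initial_integrable[OF I \<phi> w0(1) this]
  have i1: "integrable ?L (\<lambda>x. \<phi> (0, x))" using initial_integrable[OF I \<phi>, of "\<lambda>x. 1" 1] by simp
  have iEw: "integrable ?L (\<lambda>x. E (w0 x) * \<phi> (0, x))"
  proof -
    have "E \<in> borel_measurable borel" using C2_deriv(4)[OF E] by (rule borel_measurable_continuous_onI)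
    then have "(\<lambda>x. E (w0 x)) \<in> borel_measurable lebesgue" using w0(1) by measurable
    moreover have "bounded (E ` {l..r})"
      by (intro compact_imp_bounded compact_continuous_image continuous_on_subset[OF C2_deriv(4)[OF E]]) auto
    then obtain B where "\<forall>y\<in>E ` {l..r}. norm y \<le> B" unfolding bounded_iff by blast
    then have "\<bar>E (w0 x)\<bar> \<le> B" for x using w0(2,3)[of x] by auto
    ultimately show ?thesis by (rule initial_integrable[OF I \<phi>])
  qed
  define W0 where "W0 x = 2 * (E (w0 x) * \<phi> (0, x)) - (deriv E l * (w0 x * \<phi> (0, x)) + c l * \<phi> (0, x))
     - (deriv E r * (w0 x * \<phi> (0, x)) + c r * \<phi> (0, x))" for x
  have inner0: "(LINT k|?N. K0 k x) = W0 x" if int: "integrable ?N (\<lambda>k. K0 k x)" for x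
  proof -
    have "0 \<in> closure I" using I closure_subset[of I] unfolding time_interval_def by auto
    \<comment> \<open>in the initial term \<open>\<phi>(0, x)\<close> takes the place of the time derivative, and there is no flux or source\<close>
    from kruzhkov_integrand_has_integral[OF f F E this w0(2,3), where x=x and a="\<phi> (0, x)" and b=0 and c=0 and p=0]
    have "((\<lambda>k. K0 k x) has_integral 2 * (E (w0 x) * \<phi> (0, x)) - (deriv E l * ((w0 x - l) * \<phi> (0, x)) + E l * \<phi> (0, x))
     - (deriv E r * ((w0 x - r) * \<phi> (0, x)) + E r * \<phi> (0, x))) {l..r}" by (simp add: K0_def)
    then have "integral {l..r} (\<lambda>k. K0 k x) = 2 * (E (w0 x) * \<phi> (0, x)) - (deriv E l * ((w0 x - l) * \<phi> (0, x)) + E l * \<phi> (0, x))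
     - (deriv E r * ((w0 x - r) * \<phi> (0, x)) + E r * \<phi> (0, x))" by (rule integral_unique)
    moreover have "(LINT k|?N. K0 k x) = integral {l..r} (\<lambda>k. K0 k x)"
      by (rule lebesgue_integral_eq_integral[OF int]) simp
    ultimately show ?thesis by (simp add: W0_def c_def algebra_simps)
  qed
  have "(LINT x|?L. LINT k|?N. K0 k x) = (LINT x|?L. W0 x)"
  proof (rule integral_cong_AE)
    show "(\<lambda>x. LINT k|?N. K0 k x) \<in> borel_measurable ?L" using P0.integrable_snd[OF K0i] by auto
    show "(\<lambda>x. W0 x) \<in> borel_measurable ?L"
      unfolding W0_def using iEw iw i1 by measurable
    show "AE x in ?L. (LINT k|?N. K0 k x) = W0 x"
      using P0.AE_integrable_snd[OF K0i] by eventually_elim (rule inner0)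
  qed
  also have "\<dots> = 2 * (LINT x|?L. E (w0 x) * \<phi> (0, x))
     - (deriv E l * (LINT x|?L. w0 x * \<phi> (0, x)) + c l * (LINT x|?L. \<phi> (0, x)))
     - (deriv E r * (LINT x|?L. w0 x * \<phi> (0, x)) + c r * (LINT x|?L. \<phi> (0, x)))"
    unfolding W0_def using iEw iw i1 by simp
  finally have init: "(LINT x|?L. LINT k|?N. K0 k x) = \<dots>" .
  have triv: "integral\<^sup>L ?M (NT a G k) = - a * (LINT x|?L. \<phi> (0, x))" if "G \<in> class_F I" for a G k
    using weak_form_trivial[OF I \<phi> that, of a k] by (simp add: weak_form_alt NT_def)
  have eE: "entropy_form E F (\<lambda>x. E (w0 x)) \<phi> \<phi>' = integral\<^sup>L ?M NE + (LINT x|?L. E (w0 x) * \<phi> (0, x))"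
    and eD: "conservation_form w0 \<phi> \<phi>' = integral\<^sup>L ?M ND + (LINT x|?L. w0 x * \<phi> (0, x))"
    by (simp_all only: weak_form_alt NE_def ND_def)
  show ?thesis
    unfolding swap main init triv[OF F'] triv[OF f] eE eD by (simp add: algebra_simps)
qed

end

section \<open>Equivalence of the two formulations\<close>

lemma domain_not_null:
  fixes I :: "real set"
  assumes I: "time_interval I" and ae: "AE z in lebesgue_on (I \<times> (UNIV :: (real^'n) set)). P z"
  shows "\<exists>z\<in>I \<times> UNIV. P z"
proof (rule ccontr)
  let ?D = "I \<times> (UNIV :: (real^'n) set)"
  assume "\<not> ?thesis"
  then have "AE z in lebesgue. z \<notin> ?D"
    using ae time_interval_domain_lebesgue[OF I, where 'n='n]
    by (subst (asm) AE_restrict_space_iff) (auto elim: eventually_mono)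
  then have "?D \<in> null_sets lebesgue"
    using AE_iff_null_sets[OF time_interval_domain_lebesgue[OF I, where 'n='n]] by blast
  then have "negligible ?D" by (simp add: negligible_iff_null_sets)
  moreover obtain T where T: "T > 0" "{0<..<T} \<subseteq> I"
    using I unfolding time_interval_def by (metis atLeastLessThan_iff atLeast_iff greaterThanLessThan_iff less_eq_real_def subsetI zero_less_one)
  ultimately have "negligible ({0<..<T} \<times> (UNIV :: (real^'n) set))"
    by (meson Sigma_mono negligible_subset order_refl)
  moreover have "open ({0<..<T} \<times> (UNIV :: (real^'n) set))" by (intro open_Times) auto
  moreover have "(T / 2, 0) \<in> {0<..<T} \<times> (UNIV :: (real^'n) set)" using T by auto
  ultimately show False using open_not_negligible by blast
qed

text \<open>
  The essential bounds are finite because \<open>u\<close> is essentially bounded and the domain is not a null set.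
\<close>

lemma ess_range_hull_interval:
  fixes u :: "real \<times> (real^'n) \<Rightarrow> real"
  assumes I: "time_interval I" and u: "u \<in> L_inf (lebesgue_on (I \<times> UNIV))"
  obtains l r where "ess_range_hull I u = {l..r}" "AE z in lebesgue_on (I \<times> UNIV). l \<le> u z \<and> u z \<le> r"
proof -
  let ?M = "lebesgue_on (I \<times> (UNIV :: (real^'n) set))"
  have um: "u \<in> borel_measurable ?M" using u unfolding L_inf_def by blast
  obtain C where C: "AE z in ?M. \<bar>u z\<bar> \<le> C" using u unfolding L_inf_def by blast
  have bound: "\<exists>s. esssup ?M (\<lambda>z. ereal (h z)) = ereal s" "AE z in ?M. ereal (h z) \<le> esssup ?M (\<lambda>z. ereal (h z))"
    if h: "h \<in> borel_measurable ?M" "AE z in ?M. \<bar>h z\<bar> \<le> C" for h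
  proof -
    show ae: "AE z in ?M. ereal (h z) \<le> esssup ?M (\<lambda>z. ereal (h z))" by (rule esssup_AE)
    have "esssup ?M (\<lambda>z. ereal (h z)) \<le> ereal C"
      using h by (intro esssup_I) (auto elim!: eventually_mono)
    moreover have "AE z in ?M. ereal (- C) \<le> esssup ?M (\<lambda>z. ereal (h z))"
      using ae h(2)
    proof eventually_elim
      case (elim z)
      then have "ereal (- C) \<le> ereal (h z)" by simp
      then show ?case using elim(1) by (rule order_trans)
    qed
    then have "ereal (- C) \<le> esssup ?M (\<lambda>z. ereal (h z))"
      using domain_not_null[OF I] by blast
    ultimately show "\<exists>s. esssup ?M (\<lambda>z. ereal (h z)) = ereal s"
      by (cases "esssup ?M (\<lambda>z. ereal (h z))") auto
  qed
  have C': "AE z in ?M. \<bar>- u z\<bar> \<le> C" using C by simp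
  have um': "(\<lambda>z. - u z) \<in> borel_measurable ?M" using um by simp
  obtain r where r: "esssup ?M (\<lambda>z. ereal (u z)) = ereal r" using bound(1)[OF um C] by blast
  obtain s where s: "esssup ?M (\<lambda>z. ereal (- u z)) = ereal s" using bound(1)[OF um' C'] by blast
  show thesis
  proof (rule that[of "- s" r])
    show "ess_range_hull I u = {- s..r}" unfolding ess_range_hull_def Let_def r s by auto
    show "AE z in ?M. - s \<le> u z \<and> u z \<le> r"
      using bound(2)[OF um C] bound(2)[OF um' C'] unfolding r s by eventually_elim auto
  qed
qed

lemma C1_data_imp_C1c:
  assumes "time_interval I" "C1_data I T R \<phi> \<phi>'"
  shows "\<phi> \<in> C1c I"
proof -
  note d = C1_dataD[OF assms(2)]
  have "Ck_on 1 (I \<times> UNIV) \<phi>" using d(3,4) by (auto intro!: exI[of _ \<phi>'])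
  moreover have "compact_support_on I \<phi>"
    by (rule compact_support_onI[OF assms(1) d(1), of _ R]) (use d(5) in force)
  ultimately show ?thesis unfolding C1c_def by simp
qed

lemma test_fun_subset_C1c: "test_fun I \<subseteq> C1c I"
  unfolding test_fun_def C1c_def by blast

context bounded_state
begin

text \<open>
  Constants solve the homogeneous equation with constant initial datum.  Subtracting \<open>r\<close> from \<open>v\<close>, or
  \<open>v\<close> from \<open>l\<close>, therefore gives weak formulations with a nonpositive density.
\<close>

lemma conservation_form_initial_bounds:
  assumes w0: "w0 \<in> borel_measurable lebesgue" "\<And>x. \<bar>w0 x\<bar> \<le> C"
    and weak: "\<And>\<phi> T R \<phi>'. C1_data I T R \<phi> \<phi>' \<Longrightarrow> conservation_form w0 \<phi> \<phi>' = 0"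
  shows "AE x in lebesgue. l \<le> w0 x \<and> w0 x \<le> r"
proof -
  have const: "weak_form I (\<lambda>z. k) (\<lambda>i z. 0) (\<lambda>z. 0) (\<lambda>x. k) \<phi> \<phi>' = 0" if "C1_data I T R \<phi> \<phi>'" for k T R \<phi> \<phi>'
    using integral_time_derivative[OF I that] by (simp add: weak_form_def)
  have lin: "weak_form I (\<lambda>z. \<alpha> * v z + \<beta> * k) (\<lambda>i z. \<alpha> * f (fst z, snd z, v z) $ i) (\<lambda>z. \<alpha> * g (fst z, snd z, v z))
    (\<lambda>x. \<alpha> * w0 x + \<beta> * k) \<phi> \<phi>' = 0" if "C1_data I T R \<phi> \<phi>'" for \<alpha> \<beta> k T R \<phi> \<phi>'
    using weak_form_linear[where ?w2.0="\<lambda>z. k" and ?b2.0="\<lambda>i z. 0" and ?c2.0="\<lambda>z. 0" and ?w02.0="\<lambda>x. k" and ?C2.0="\<bar>k\<bar>"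
        and \<alpha>=\<alpha> and \<beta>=\<beta>, OF I that locally_bounded_conservation w0 locally_bounded_const locally_bounded_const locally_bounded_const]
      weak[OF that] const[OF that, of k]
    by simp
  have gen: "AE x in lebesgue. \<alpha> * w0 x + \<beta> * k \<le> 0" if "\<And>z. \<alpha> * v z + \<beta> * k \<le> 0" for \<alpha> \<beta> k
  proof (rule weak_form_initial_nonpos[OF I _ that])
    show "locally_bounded I (\<lambda>z. \<alpha> * v z + \<beta> * k)"
      by (intro locally_bounded_add locally_bounded_mult locally_bounded_const locally_bounded_conservation)
    show "locally_bounded I (\<lambda>z. \<alpha> * f (fst z, snd z, v z) $ i)" for i
      by (intro locally_bounded_mult locally_bounded_const locally_bounded_conservation)
    show "locally_bounded I (\<lambda>z. \<alpha> * g (fst z, snd z, v z))"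
      by (intro locally_bounded_mult locally_bounded_const locally_bounded_conservation)
    show "(\<lambda>x. \<alpha> * w0 x + \<beta> * k) \<in> borel_measurable lebesgue" using w0(1) by measurable
    show "\<bar>\<alpha> * w0 x + \<beta> * k\<bar> \<le> \<bar>\<alpha>\<bar> * C + \<bar>\<beta> * k\<bar>" for x
      using mult_left_mono[OF w0(2)[of x], of "\<bar>\<alpha>\<bar>"] abs_triangle_ineq[of "\<alpha> * w0 x" "\<beta> * k"]
      by (simp add: abs_mult)
  qed (rule lin)
  have "AE x in lebesgue. 1 * w0 x + (-1) * r \<le> 0" by (rule gen) (use v(3) in simp)
  moreover have "AE x in lebesgue. (-1) * w0 x + 1 * l \<le> 0" by (rule gen) (use v(2) in simp)
  ultimately show ?thesis by eventually_elim auto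
qed

end

theorem theorem2p17:
  fixes I :: "real set"
    and f :: "real \<times> (real^'n) \<times> real \<Rightarrow> real^'n"
    and g :: "real \<times> (real^'n) \<times> real \<Rightarrow> real"
    and uo :: "real^'n \<Rightarrow> real"
    and u :: "real \<times> (real^'n) \<Rightarrow> real"
  assumes "time_interval I"
    and "f \<in> class_F I"
    and "continuous_on (closure I \<times> UNIV) g"
    and "uo \<in> L_inf lebesgue"
    and "u \<in> L_inf (lebesgue_on (I \<times> UNIV))"
  shows "distributional_solution I f g uo u \<longleftrightarrow>
    (\<forall>E. Ck_on 2 UNIV E \<longrightarrow>
      (\<forall>F\<in>entropy_flux I f E. \<forall>\<phi>\<in>test_fun I.
        entropy_production I f g uo u E F \<phi> =
          1 / 2 * (LINT k:ess_range_hull I u|lebesgue.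
            deriv (deriv E) k * kruzhkov_production I f g uo u k \<phi>)))"
proof -
  let ?M = "lebesgue_on (I \<times> (UNIV :: (real^'n) set))"
  note I = assms(1)
  obtain l r where J: "ess_range_hull I u = {l..r}" and lr: "AE z in ?M. l \<le> u z \<and> u z \<le> r"
    using ess_range_hull_interval[OF I assms(5)] by blast
  have "l \<le> r" using domain_not_null[OF I lr] by force
  define v where "v z = max l (min r (u z))" for z
  have um: "u \<in> borel_measurable ?M" using assms(5) unfolding L_inf_def by blast
  interpret bounded_state I f g u v l r
  proof
    show "v \<in> borel_measurable ?M" unfolding v_def using um by measurable
    show "l \<le> v z" "v z \<le> r" for z using \<open>l \<le> r\<close> by (auto simp: v_def)
    show "AE z in ?M. u z = v z" using lr by eventually_elim (auto simp: v_def)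
  qed (use assms in auto)
  obtain C where C: "AE x in lebesgue. \<bar>uo x\<bar> \<le> C" and uom: "uo \<in> borel_measurable lebesgue"
    using assms(4) unfolding L_inf_def by blast
  \<comment> \<open>until the values of the initial datum are located in \<open>[l, r]\<close>, a representative with an arbitrary bound is used\<close>
  define w where "w x = max (- \<bar>C\<bar>) (min \<bar>C\<bar> (uo x))" for x
  have w: "w \<in> borel_measurable lebesgue" "\<And>x. \<bar>w x\<bar> \<le> \<bar>C\<bar>" "AE x in lebesgue. uo x = w x"
  proof -
    show "w \<in> borel_measurable lebesgue" unfolding w_def using uom by measurable
    show "\<bar>w x\<bar> \<le> \<bar>C\<bar>" for x by (auto simp: w_def)
    show "AE x in lebesgue. uo x = w x" using C by eventually_elim (auto simp: w_def)
  qed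
  have dist_eq: "distributional_solution I f g uo u \<longleftrightarrow>
    (\<forall>\<phi> T R \<phi>'. C1_data I T R \<phi> \<phi>' \<longrightarrow> conservation_form w \<phi> \<phi>' = 0)"
  proof (intro iffI allI impI)
    fix \<phi> :: "real \<times> (real^'n) \<Rightarrow> real" and T R \<phi>' assume "distributional_solution I f g uo u" and \<phi>: "C1_data I T R \<phi> \<phi>'"
    then show "conservation_form w \<phi> \<phi>' = 0"
      unfolding distributional_solution_def distributional_eq_conservation_form[OF \<phi> w(1,3), symmetric]
      using C1_data_imp_C1c[OF I \<phi>] by blast
  next
    assume weak: "\<forall>\<phi> T R \<phi>'. C1_data I T R \<phi> \<phi>' \<longrightarrow> conservation_form w \<phi> \<phi>' = 0"
    show "distributional_solution I f g uo u" unfolding distributional_solution_def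
    proof
      fix \<phi> :: "real \<times> (real^'n) \<Rightarrow> real" assume "\<phi> \<in> C1c I"
      then obtain T R \<phi>' where \<phi>: "C1_data I T R \<phi> \<phi>'" using C1c_obtain_data[OF I] by blast
      show "(LINT t:I|lebesgue. LINT x|lebesgue. u (t, x) * d_t I \<phi> (t, x) + f (t, x, u (t, x)) \<bullet> grad_x \<phi> (t, x))
         + (LINT t:I|lebesgue. LINT x|lebesgue. g (t, x, u (t, x)) * \<phi> (t, x))
         + (LINT x|lebesgue. uo x * \<phi> (0, x)) = 0"
        unfolding distributional_eq_conservation_form[OF \<phi> w(1,3)] using weak \<phi> by blast
    qed
  qed
  show ?thesis
  proof
    assume "distributional_solution I f g uo u"
    then have weak: "conservation_form w \<phi> \<phi>' = 0" if "C1_data I T R \<phi> \<phi>'" for \<phi> T R \<phi>'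
      using dist_eq that by blast
    have wb: "AE x in lebesgue. l \<le> w x \<and> w x \<le> r"
      by (rule conservation_form_initial_bounds[OF w(1,2) weak])
    define w' where "w' x = max l (min r (uo x))" for x
    have w': "w' \<in> borel_measurable lebesgue" "\<And>x. l \<le> w' x" "\<And>x. w' x \<le> r" "AE x in lebesgue. uo x = w' x"
    proof -
      show "w' \<in> borel_measurable lebesgue" unfolding w'_def using uom by measurable
      show "l \<le> w' x" "w' x \<le> r" for x using \<open>l \<le> r\<close> by (auto simp: w'_def)
      show "AE x in lebesgue. uo x = w' x" using wb w(3) by eventually_elim (auto simp: w'_def)
    qed
    show "\<forall>E. Ck_on 2 UNIV E \<longrightarrow> (\<forall>F\<in>entropy_flux I f E. \<forall>\<phi>\<in>test_fun I.
        entropy_production I f g uo u E F \<phi> =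
          1 / 2 * (LINT k:ess_range_hull I u|lebesgue.
            deriv (deriv E) k * kruzhkov_production I f g uo u k \<phi>))"
    proof (intro allI impI ballI)
      fix E F and \<phi> :: "real \<times> (real^'n) \<Rightarrow> real"
      assume E: "Ck_on 2 UNIV E" and F: "F \<in> entropy_flux I f E" and "\<phi> \<in> test_fun I"
      then obtain T R \<phi>' where \<phi>: "C1_data I T R \<phi> \<phi>'"
        using C1c_obtain_data[OF I] test_fun_subset_C1c by blast
      have "conservation_form w' \<phi> \<phi>' = conservation_form w \<phi> \<phi>'"
        using distributional_eq_conservation_form[OF \<phi> w(1,3)] distributional_eq_conservation_form[OF \<phi> w'(1,4)] by simp
      then have "conservation_form w' \<phi> \<phi>' = 0" using weak[OF \<phi>] by simp
      then show "entropy_production I f g uo u E F \<phi> =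
          1 / 2 * (LINT k:ess_range_hull I u|lebesgue. deriv (deriv E) k * kruzhkov_production I f g uo u k \<phi>)"
        unfolding J entropy_production_eq_entropy_form[OF \<phi> E F w'(1,4)] kruzhkov_production_eq_kruzhkov_form[OF \<phi> w'(1,4)]
          integral_kruzhkov_form[OF \<phi> E F w'(1-3)] by simp
    qed
  next
    assume entropy: "\<forall>E. Ck_on 2 UNIV E \<longrightarrow> (\<forall>F\<in>entropy_flux I f E. \<forall>\<phi>\<in>test_fun I.
        entropy_production I f g uo u E F \<phi> =
          1 / 2 * (LINT k:ess_range_hull I u|lebesgue.
            deriv (deriv E) k * kruzhkov_production I f g uo u k \<phi>))"
    have d1: "deriv (\<lambda>k::real. k) = (\<lambda>k. 1)" by (intro ext DERIV_imp_deriv DERIV_ident)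
    have d2: "deriv (\<lambda>k::real. 1 :: real) = (\<lambda>k. 0)" by (intro ext DERIV_imp_deriv DERIV_const)
    have id2: "Ck_on 2 UNIV (\<lambda>k::real. k)"
      unfolding numeral_2_eq_2 by (rule Ck_on_real_Suc[OF DERIV_ident Ck_on_const])
    have fid: "f \<in> entropy_flux I f (\<lambda>k. k)" unfolding entropy_flux_def using assms(2) by (simp add: d1)
    have smooth: "conservation_form w \<psi> \<psi>' = 0" if "\<psi> \<in> test_fun I" "C1_data I T R \<psi> \<psi>'" for \<psi> T R \<psi>'
    proof -
      have "entropy_production I f g uo u (\<lambda>k. k) f \<psi> = 0"
        using entropy[rule_format, OF id2 fid that(1)] unfolding d1 d2 by (simp add: set_lebesgue_integral_def)
      then show ?thesis using distributional_eq_conservation_form[OF that(2) w(1,3)] by (simp add: entropy_production_def d1)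
    qed
    have "conservation_form w \<phi> \<phi>' = 0" if "C1_data I T R \<phi> \<phi>'" for \<phi> T R \<phi>'
      by (rule weak_form_density[OF I locally_bounded_conservation w(1,2) smooth that])
    then show "distributional_solution I f g uo u" using dist_eq by blast
  qed
qed

end
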